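(* Let $K$ be a field of characteristic zero, $\delta\in K$, $r,p\ge0$, and assume that the Brauer algebra $D_r$ with parameter $\delta$ is semisimple. Let $\lambda\vdash p$ and put $U(r,\lambda)=\mathrm{Inf}_p^r(S^\lambda)$, where $S^\lambda$ is the irreducible representation of $K\mathfrak S_p$ corresponding to $\lambda$. Then $$U(r+1,\lambda)\downarrow^{D_{r+1}}_{D_r}\;\cong\;\bigoplus_{\mu=\lambda\pm\square}U(r,\mu),$$ where the sum is over all partitions $\mu$ obtained from $\lambda$ by adding or removing a cell.
   Context: For $r,s\ge 0$ let $D(r,s)$ be the set of perfect matchings of $[r]\amalg[s]$, drawn with $r$ points on the top edge and $s$ points on the bottom edge of a rectangle. For $x\in D(r,s)$, $y\in D(s,t)$ stack $x$ on top of $y$; $c(x,y)$ is the number of closed loops produced, $x\circ y$ is the result after deleting loops, and $x\cdot y=\delta^{c(x,y)}x\circ y$. The Brauer algebra $D_r$ is the $K$-vector space with basis $D(r,r)$ and this product. $D_r$ is included in $D_{r+1}$ by adding a vertical strand on the right. The propagating number $\mathrm{pr}(x)$ is the number of strands joining the top edge to the bottom edge, and $D(r,s;p)=\{x\in D(r,s):\mathrm{pr}(x)=p\}$. $KD(p,r;p)$ is a $K\mathfrak S_p$-$D_r$ bimodule under the product $x\cdot y$, where diagrams with propagating number less than $p$ are set to zero. For a right $K\mathfrak S_p$-module $V$, $\mathrm{Inf}_p^rV=V\otimes_{K\mathfrak S_p}KD(p,r;p)$, a right $D_r$-module; in particular $U(r,\mu)=0$ if $|\mu|>r$ or $r-|\mu|$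 is odd. *)

theory Defs
  imports
    "HOL-Algebra.Sym_Groups"
    "HOL-Algebra.Free_Abelian_Groups"
    "HOL-Algebra.AbelCoset"
    "HOL-Library.Disjoint_Sets"
    "HOL.Modules"
begin

section \<open>Right modules over a ring\<close>

text \<open>As in the HOL-Algebra record of modules, the multiplicative fields inherited from the record
  of rings carry no information for modules; they are left undefined.\<close>

record ('a, 'm) right_module = "'m ring" +
  ract :: "'m \<Rightarrow> 'a \<Rightarrow> 'm"  (infixl \<open>\<lhd>\<index>\<close> 70)

record ('r, 'a, 'm) bimodule = "('a, 'm) right_module" +
  lact :: "'r \<Rightarrow> 'm \<Rightarrow> 'm"

definition right_module_iso ::
    "('a, 'c) ring_scheme \<Rightarrow> ('a, 'm, 'd) right_module_scheme \<Rightarrow> ('a, 'n, 'e) right_module_scheme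
      \<Rightarrow> bool" where
  "right_module_iso A M N \<longleftrightarrow>
    (\<exists>f. bij_betw f (carrier M) (carrier N) \<and>
         (\<forall>m\<in>carrier M. \<forall>m'\<in>carrier M. f (m \<oplus>\<^bsub>M\<^esub> m') = f m \<oplus>\<^bsub>N\<^esub> f m') \<and>
         (\<forall>m\<in>carrier M. \<forall>a\<in>carrier A. f (m \<lhd>\<^bsub>M\<^esub> a) = f m \<lhd>\<^bsub>N\<^esub> a))"

definition right_submodule ::
    "('a, 'c) ring_scheme \<Rightarrow> ('a, 'm, 'd) right_module_scheme \<Rightarrow> 'm set \<Rightarrow> bool" where
  "right_submodule A M N \<longleftrightarrow>
    additive_subgroup N M \<and> (\<forall>n\<in>N. \<forall>a\<in>carrier A. n \<lhd>\<^bsub>M\<^esub> a \<in> N)"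

text \<open>A module is semisimple if every submodule is a direct summand; a ring is semisimple if
  it is semisimple as a module over itself (the choice of side is immaterial).\<close>

definition semisimple_right_module ::
    "('a, 'c) ring_scheme \<Rightarrow> ('a, 'm, 'd) right_module_scheme \<Rightarrow> bool" where
  "semisimple_right_module A M \<longleftrightarrow>
    (\<forall>N. right_submodule A M N \<longrightarrow>
      (\<exists>N'. right_submodule A M N' \<and> N \<inter> N' = {\<zero>\<^bsub>M\<^esub>} \<and> N <+>\<^bsub>M\<^esub> N' = carrier M))"

definition regular_right_module :: "('a, 'c) ring_scheme \<Rightarrow> ('a, 'a) right_module" where
  "regular_right_module A =
    \<lparr>carrier = carrier A, mult = undefined, one = undefined, zero = zero A, add = add A,
     ract = mult A\<rparr>"

definition semisimple_ring :: "('a, 'c) ring_scheme \<Rightarrow> bool" where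
  "semisimple_ring A \<longleftrightarrow> semisimple_right_module A (regular_right_module A)"

definition restrict_scalars ::
    "('a \<Rightarrow> 'b) \<Rightarrow> ('b, 'm, 'd) right_module_scheme \<Rightarrow> ('a, 'm) right_module" where
  "restrict_scalars \<phi> M =
    \<lparr>carrier = carrier M, mult = undefined, one = undefined, zero = zero M, add = add M,
     ract = (\<lambda>m a. m \<lhd>\<^bsub>M\<^esub> \<phi> a)\<rparr>"

definition direct_sum_module ::
    "'i set \<Rightarrow> ('i \<Rightarrow> ('a, 'm, 'd) right_module_scheme) \<Rightarrow> ('a, 'i \<Rightarrow> 'm) right_module" where
  "direct_sum_module I M =
    \<lparr>carrier = {f \<in> \<Pi>\<^sub>E i\<in>I. carrier (M i). finite {i\<in>I. f i \<noteq> \<zero>\<^bsub>M i\<^esub>}},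
     mult = undefined, one = undefined,
     zero = (\<lambda>i\<in>I. \<zero>\<^bsub>M i\<^esub>),
     add = (\<lambda>f g. \<lambda>i\<in>I. f i \<oplus>\<^bsub>M i\<^esub> g i),
     ract = (\<lambda>f a. \<lambda>i\<in>I. f i \<lhd>\<^bsub>M i\<^esub> a)\<rparr>"

text \<open>For a right \<open>R\<close>-module \<open>V\<close> and a bimodule \<open>W\<close> with \<open>R\<close> acting on the left, \<open>V \<otimes>\<^sub>R W\<close> is the
  free abelian group on \<open>V \<times> W\<close> modulo the subgroup generated by the biadditivity relations and
  the relations \<open>(v r, w) - (v, r w)\<close>. In \<^const>\<open>free_Abelian_group\<close> the group operation, written
  multiplicatively, is addition of formal integer combinations.\<close>

definition tensor_relations ::
    "('r, 'c) ring_scheme \<Rightarrow> ('r, 'v, 'd) right_module_scheme \<Rightarrow> ('r, 'a, 'w, 'e) bimodule_scheme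
      \<Rightarrow> (('v \<times> 'w) \<Rightarrow>\<^sub>0 int) set" where
  "tensor_relations R V W =
     {frag_of (v \<oplus>\<^bsub>V\<^esub> v', w) - frag_of (v, w) - frag_of (v', w) | v v' w.
        v \<in> carrier V \<and> v' \<in> carrier V \<and> w \<in> carrier W} \<union>
     {frag_of (v, w \<oplus>\<^bsub>W\<^esub> w') - frag_of (v, w) - frag_of (v, w') | v w w'.
        v \<in> carrier V \<and> w \<in> carrier W \<and> w' \<in> carrier W} \<union>
     {frag_of (v \<lhd>\<^bsub>V\<^esub> r, w) - frag_of (v, lact W r w) | v r w.
        v \<in> carrier V \<and> r \<in> carrier R \<and> w \<in> carrier W}"

definition tensor_module ::
    "('r, 'c) ring_scheme \<Rightarrow> ('r, 'v, 'd) right_module_scheme \<Rightarrow> ('r, 'a, 'w, 'e) bimodule_scheme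
      \<Rightarrow> ('a, (('v \<times> 'w) \<Rightarrow>\<^sub>0 int) set) right_module" where
  "tensor_module R V W =
    (let F = free_Abelian_group (carrier V \<times> carrier W);
         N = generate F (tensor_relations R V W)
     in \<lparr>carrier = carrier (F Mod N), mult = undefined, one = undefined,
         zero = \<one>\<^bsub>F Mod N\<^esub>, add = mult (F Mod N),
         ract = (\<lambda>X a. \<Union>x\<in>X. N #>\<^bsub>F\<^esub> frag_extend (\<lambda>(v, w). frag_of (v, w \<lhd>\<^bsub>W\<^esub> a)) x)\<rparr>)"


section \<open>Free modules with a given basis\<close>

text \<open>For a set \<open>X\<close>, the free module \<open>KX\<close> is the set of finitely supported functions whose support
  lies in \<open>X\<close>.\<close>

definition free_on :: "'b set \<Rightarrow> ('b \<Rightarrow>\<^sub>0 'k::zero) set" where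
  "free_on X = {a. Poly_Mapping.keys a \<subseteq> X}"

definition scale :: "'k::comm_ring_1 \<Rightarrow> ('b \<Rightarrow>\<^sub>0 'k) \<Rightarrow> ('b \<Rightarrow>\<^sub>0 'k)" where
  "scale c = Poly_Mapping.map ((*) c)"

definition linear_ext :: "('b \<Rightarrow> 'c \<Rightarrow>\<^sub>0 'k::comm_ring_1) \<Rightarrow> ('b \<Rightarrow>\<^sub>0 'k) \<Rightarrow> ('c \<Rightarrow>\<^sub>0 'k)" where
  "linear_ext f a = (\<Sum>x\<in>Poly_Mapping.keys a. scale (Poly_Mapping.lookup a x) (f x))"

definition bilinear_ext ::
    "('b \<Rightarrow> 'c \<Rightarrow> 'd \<Rightarrow>\<^sub>0 'k::comm_ring_1) \<Rightarrow> ('b \<Rightarrow>\<^sub>0 'k) \<Rightarrow> ('c \<Rightarrow>\<^sub>0 'k) \<Rightarrow> ('d \<Rightarrow>\<^sub>0 'k)" where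
  "bilinear_ext f a b =
    (\<Sum>x\<in>Poly_Mapping.keys a. \<Sum>y\<in>Poly_Mapping.keys b.
       scale (Poly_Mapping.lookup a x * Poly_Mapping.lookup b y) (f x y))"

definition group_algebra :: "('g, 'c) monoid_scheme \<Rightarrow> ('g \<Rightarrow>\<^sub>0 'k::comm_ring_1) ring" where
  "group_algebra G =
    \<lparr>carrier = free_on (carrier G),
     mult = bilinear_ext (\<lambda>g h. Poly_Mapping.single (g \<otimes>\<^bsub>G\<^esub> h) 1),
     one = Poly_Mapping.single \<one>\<^bsub>G\<^esub> 1,
     zero = 0,
     add = (+)\<rparr>"


section \<open>Diagrams and the Brauer algebra\<close>

text \<open>The points \<open>Inl i\<close> lie on the top edge and the points \<open>Inr j\<close> on the bottom edge.\<close>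

type_synonym diagram = "(nat + nat) set set"

definition diagrams :: "nat \<Rightarrow> nat \<Rightarrow> diagram set" where
  "diagrams r s = {x. partition_on ({1..r} <+> {1..s}) x \<and> (\<forall>e\<in>x. card e = 2)}"

definition propagating_number :: "diagram \<Rightarrow> nat" where
  "propagating_number x = card {e\<in>x. e \<inter> range Inl \<noteq> {} \<and> e \<inter> range Inr \<noteq> {}}"

definition diagrams_prop :: "nat \<Rightarrow> nat \<Rightarrow> nat \<Rightarrow> diagram set" where
  "diagrams_prop r s p = {x \<in> diagrams r s. propagating_number x = p}"

text \<open>Stacking \<open>x\<close> on \<open>y\<close> gives a graph on top points \<open>Inl i\<close>, middle points \<open>Inr (Inl j)\<close> and bottom
  points \<open>Inr (Inr k)\<close>. A component of this graph is a closed loop if it contains no outer point,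
  and otherwise a strand joining its two outer points.\<close>

definition stack :: "diagram \<Rightarrow> diagram \<Rightarrow> (nat + (nat + nat)) set set" where
  "stack x y = (image (map_sum id Inl)) ` x \<union> (image Inr) ` y"

definition components :: "'v set set \<Rightarrow> 'v set set" where
  "components E = (\<lambda>u. {(v, w). {v, w} \<in> E}\<^sup>* `` {u}) ` \<Union>E"

definition outer_points :: "(nat + (nat + nat)) set \<Rightarrow> (nat + nat) set" where
  "outer_points C = map_sum id Inr -` C"

definition loops :: "diagram \<Rightarrow> diagram \<Rightarrow> nat" where
  "loops x y = card {C \<in> components (stack x y). outer_points C = {}}"

definition compose_diagrams :: "diagram \<Rightarrow> diagram \<Rightarrow> diagram" where
  "compose_diagrams x y = outer_points ` {C \<in> components (stack x y). outer_points C \<noteq> {}}"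

definition diagram_mult :: "'k::comm_ring_1 \<Rightarrow> diagram \<Rightarrow> diagram \<Rightarrow> (diagram \<Rightarrow>\<^sub>0 'k)" where
  "diagram_mult \<delta> x y = Poly_Mapping.single (compose_diagrams x y) (\<delta> ^ loops x y)"

definition identity_diagram :: "nat \<Rightarrow> diagram" where
  "identity_diagram r = {{Inl i, Inr i} | i. i \<in> {1..r}}"

definition brauer_algebra :: "'k::comm_ring_1 \<Rightarrow> nat \<Rightarrow> (diagram \<Rightarrow>\<^sub>0 'k) ring" where
  "brauer_algebra \<delta> r =
    \<lparr>carrier = free_on (diagrams r r),
     mult = bilinear_ext (diagram_mult \<delta>),
     one = Poly_Mapping.single (identity_diagram r) 1,
     zero = 0,
     add = (+)\<rparr>"

definition brauer_inclusion :: "nat \<Rightarrow> (diagram \<Rightarrow>\<^sub>0 'k::comm_ring_1) \<Rightarrow> (diagram \<Rightarrow>\<^sub>0 'k)" where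
  "brauer_inclusion r =
    linear_ext (\<lambda>x. Poly_Mapping.single (insert {Inl (Suc r), Inr (Suc r)} x) 1)"


section \<open>Inflation\<close>

text \<open>With the bottom point \<open>i\<close> joined to the top point \<open>\<pi> i\<close>, stacking the diagram of \<open>\<pi>\<close> on that
  of \<open>\<sigma>\<close> gives the diagram of \<open>\<pi> \<circ> \<sigma>\<close>, so this is compatible with the product of
  \<^const>\<open>sym_group\<close>.\<close>

definition permutation_diagram :: "nat \<Rightarrow> (nat \<Rightarrow> nat) \<Rightarrow> diagram" where
  "permutation_diagram p \<pi> = {{Inl (\<pi> i), Inr i} | i. i \<in> {1..p}}"

definition truncated_mult :: "'k::comm_ring_1 \<Rightarrow> nat \<Rightarrow> diagram \<Rightarrow> diagram \<Rightarrow> (diagram \<Rightarrow>\<^sub>0 'k)" where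
  "truncated_mult \<delta> p x y =
    (if propagating_number (compose_diagrams x y) < p then 0 else diagram_mult \<delta> x y)"

text \<open>The bimodule \<open>KD(p,r;p)\<close>.\<close>

definition diagram_bimodule ::
    "'k::comm_ring_1 \<Rightarrow> nat \<Rightarrow> nat
      \<Rightarrow> ((nat \<Rightarrow> nat) \<Rightarrow>\<^sub>0 'k, diagram \<Rightarrow>\<^sub>0 'k, diagram \<Rightarrow>\<^sub>0 'k) bimodule" where
  "diagram_bimodule \<delta> p r =
    \<lparr>carrier = free_on (diagrams_prop p r p), mult = undefined, one = undefined,
     zero = 0, add = (+),
     ract = bilinear_ext (truncated_mult \<delta> p),
     lact = bilinear_ext (\<lambda>\<pi>. truncated_mult \<delta> p (permutation_diagram p \<pi>))\<rparr>"

definition inflation ::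
    "'k::comm_ring_1 \<Rightarrow> nat \<Rightarrow> nat \<Rightarrow> ((nat \<Rightarrow> nat) \<Rightarrow>\<^sub>0 'k, 'v, 'd) right_module_scheme
      \<Rightarrow> (diagram \<Rightarrow>\<^sub>0 'k, (('v \<times> (diagram \<Rightarrow>\<^sub>0 'k)) \<Rightarrow>\<^sub>0 int) set) right_module" where
  "inflation \<delta> p r V = tensor_module (group_algebra (sym_group p)) V (diagram_bimodule \<delta> p r)"


section \<open>Partitions and Specht modules\<close>

definition partitions :: "nat \<Rightarrow> nat list set" where
  "partitions p = {l. sorted_wrt (\<ge>) l \<and> 0 \<notin> set l \<and> sum_list l = p}"

definition young_diagram :: "nat list \<Rightarrow> (nat \<times> nat) set" where
  "young_diagram l = {(i, j). i < length l \<and> j < l ! i}"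

text \<open>The partitions obtained from \<open>l\<close> by adding or removing a cell.\<close>

definition add_remove_cell :: "nat list \<Rightarrow> nat list set" where
  "add_remove_cell l =
    {m \<in> \<Union>(range partitions).
      (\<exists>c. c \<notin> young_diagram l \<and> young_diagram m = insert c (young_diagram l)) \<or>
      (\<exists>c. c \<notin> young_diagram m \<and> young_diagram l = insert c (young_diagram m))}"

definition tableaux :: "nat list \<Rightarrow> (nat \<times> nat \<Rightarrow> nat) set" where
  "tableaux l = {t. bij_betw t (young_diagram l) {1..sum_list l}}"

text \<open>The row equivalence class of a tableau is encoded by the map sending each entry to the index
  of the row containing it.\<close>

type_synonym tabloid = "nat \<Rightarrow> nat"

definition tabloid :: "nat list \<Rightarrow> (nat \<times> nat \<Rightarrow> nat) \<Rightarrow> tabloid" where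
  "tabloid l t = (\<lambda>a\<in>{1..sum_list l}. fst (inv_into (young_diagram l) t a))"

definition column_stabilizer :: "nat list \<Rightarrow> (nat \<times> nat \<Rightarrow> nat) \<Rightarrow> (nat \<Rightarrow> nat) set" where
  "column_stabilizer l t =
    {\<sigma>. \<sigma> permutes {1..sum_list l} \<and>
        (\<forall>c\<in>young_diagram l. \<exists>d\<in>young_diagram l. \<sigma> (t c) = t d \<and> snd d = snd c)}"

definition polytabloid :: "nat list \<Rightarrow> (nat \<times> nat \<Rightarrow> nat) \<Rightarrow> (tabloid \<Rightarrow>\<^sub>0 'k::comm_ring_1)" where
  "polytabloid l t =
    (\<Sum>\<sigma>\<in>column_stabilizer l t. Poly_Mapping.single (tabloid l (\<sigma> \<circ> t)) (of_int (sign \<sigma>)))"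

text \<open>The Specht module is spanned by the polytabloids. The right action of a permutation is the
  left action of its inverse; in terms of row indices, \<open>\<pi>\<^sup>-\<^sup>1\<close> sends the tabloid \<open>f\<close> to \<open>f \<circ> \<pi>\<close>.\<close>

definition specht_module ::
    "nat list \<Rightarrow> ((nat \<Rightarrow> nat) \<Rightarrow>\<^sub>0 'k::field, tabloid \<Rightarrow>\<^sub>0 'k) right_module" where
  "specht_module l =
    \<lparr>carrier = Modules.module.span scale (polytabloid l ` tableaux l),
     mult = undefined, one = undefined, zero = 0, add = (+),
     ract = bilinear_ext (\<lambda>f \<pi>. Poly_Mapping.single (f \<circ> \<pi>) 1)\<rparr>"

definition U ::
    "'k::field \<Rightarrow> nat \<Rightarrow> nat list
      \<Rightarrow> (diagram \<Rightarrow>\<^sub>0 'k, (((tabloid \<Rightarrow>\<^sub>0 'k) \<times> (diagram \<Rightarrow>\<^sub>0 'k)) \<Rightarrow>\<^sub>0 int) set) right_module" where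
  "U \<delta> r l = inflation \<delta> (sum_list l) r (specht_module l)"

end

theory Submission
  imports Defs "HOL.Vector_Spaces"
begin

text \<open>Let \<open>e\<^sub>l\<close> be a Young idempotent of shape \<open>l\<close>. Then \<open>S\<^sup>l\<close> is the right ideal generated by
  \<open>e\<^sub>l\<close> and \<open>U(r,l)\<close> is \<open>e\<^sub>l KD(p,r;p)\<close>. In \<open>KD(p,r+1;p)\<close>, restricted to \<open>D\<^sub>r\<close>, the diagrams
  in which the last bottom point is joined to the top edge span a submodule induced from
  \<open>KD(p-1,r;p-1)\<close>; bending the last bottom point up identifies the quotient with
  \<open>KD(p+1,r;p+1)\<close>. Multiplying with \<open>e\<^sub>l\<close>, the submodule is governed by the restriction of \<open>S\<^sup>l\<close>
  to \<open>S\<^sub>p\<^sub>-\<^sub>1\<close> and the quotient by its induction to \<open>S\<^sub>p\<^sub>+\<^sub>1\<close>, and semisimplicity of \<open>D\<^sub>r\<close> splits the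
  extension. The branching rules are proved together by induction: since
  \<open>KS\<^sub>n\<^sub>+\<^sub>1 = KS\<^sub>n + KS\<^sub>n s KS\<^sub>n\<close>, the restriction rule shows that \<open>e\<^sub>l KS\<^sub>n\<^sub>+\<^sub>1 e\<^sub>l\<close> is spanned by one more
  element than \<open>l\<close> has removable cells, that is, by as many elements as \<open>l\<close> has addable cells; so it
  is spanned by the orthogonal idempotents equivalent to the \<open>e\<^sub>m\<close> with \<open>m\<close> obtained from \<open>l\<close> by
  adding a cell, and \<open>e\<^sub>l\<close> is their sum.\<close>


section \<open>Linear maps between free modules\<close>

text \<open>Over an arbitrary field of characteristic zero there is no positive definite form, so
  the scalar that turns a Young symmetrizer into an idempotent is shown to be nonzero with integer
  coefficients, whose sums of squares cannot vanish. The two branching rules are interlocked: if the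
  idempotents of degree n-1 generate the whole group algebra and the induction rule holds for them,
  reciprocity gives the restriction rule from degree n to n-1, which bounds the corner algebra in
  degree n from above, while the count of addable against removable cells bounds it from below. The
  generation statement is therefore carried along in the same induction. Following strands through a
  stack is replaced by linear algebra: a diagram acts like a 0-1 matrix indexed by colourings of its
  two edges, stacking becomes a matrix product, and each closed loop contributes a factor two.
  Associativity and the compatibility with relabelling, strands and bending become exchanges or
  reindexings of finite sums. Since inflated modules are modelled by the fixed vectors of an
  idempotent, the branching argument itself meets no quotient; the tensor product is compared with
  this model separately.\<close>

abbreviation coef :: "('b \<Rightarrow>\<^sub>0 'k::zero) \<Rightarrow> 'b \<Rightarrow> 'k" where
  "coef \<equiv> Poly_Mapping.lookup"

abbreviation mon :: "'b \<Rightarrow> 'b \<Rightarrow>\<^sub>0 'k::zero_neq_one" where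
  "mon x \<equiv> Poly_Mapping.single x 1"

lemma coef_scale [simp]: "coef (scale c a) x = c * coef a x"
  by (simp add: scale_def Poly_Mapping.map.rep_eq when_def)

interpretation scale: Modules.module "scale :: 'k::comm_ring_1 \<Rightarrow> ('b \<Rightarrow>\<^sub>0 'k) \<Rightarrow> _"
  by unfold_locales (auto intro!: poly_mapping_eqI simp: lookup_add algebra_simps)

lemma scale_single [simp]: "scale c (Poly_Mapping.single x d) = Poly_Mapping.single x (c * d)"
  by (rule poly_mapping_eqI) (simp add: lookup_single when_def)

lemma scale_eq_0_iff: "scale c a = 0 \<longleftrightarrow> c = 0 \<or> a = 0" for c :: "'k::field"
proof
  assume *: "scale c a = 0"
  have "coef a x = 0" if "c \<noteq> 0" for x
    using coef_scale[of c a x] that by (simp add: *)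
  then show "c = 0 \<or> a = 0" by (auto intro: poly_mapping_eqI)
qed auto

lemma free_on_iff: "a \<in> free_on S \<longleftrightarrow> (\<forall>x. coef a x \<noteq> 0 \<longrightarrow> x \<in> S)"
  by (auto simp: free_on_def in_keys_iff)

lemma free_on_add [intro]: "a \<in> free_on S \<Longrightarrow> b \<in> free_on S \<Longrightarrow> a + b \<in> free_on S"
  for a :: "'b \<Rightarrow>\<^sub>0 'k::comm_ring_1"
  unfolding free_on_iff lookup_add by (metis add.left_neutral)

lemma free_on_zero [simp, intro]: "0 \<in> free_on S"
  by (simp add: free_on_iff)

lemma free_on_scale [intro]: "a \<in> free_on S \<Longrightarrow> scale c a \<in> free_on S"
  unfolding free_on_iff coef_scale by (metis mult_zero_right)

lemma free_on_uminus [intro]: "a \<in> free_on S \<Longrightarrow> - a \<in> free_on S"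
  for a :: "'b \<Rightarrow>\<^sub>0 'k::comm_ring_1"
  by (auto simp: free_on_iff)

lemma free_on_diff [intro]: "a \<in> free_on S \<Longrightarrow> b \<in> free_on S \<Longrightarrow> a - b \<in> free_on S"
  for a :: "'b \<Rightarrow>\<^sub>0 'k::comm_ring_1"
  using free_on_add[of a S "-b"] free_on_uminus[of b S] by simp

lemma free_on_sum [intro]: "(\<And>i. i \<in> I \<Longrightarrow> a i \<in> free_on S) \<Longrightarrow> (\<Sum>i\<in>I. a i) \<in> free_on S"
  for a :: "'i \<Rightarrow> 'b \<Rightarrow>\<^sub>0 'k::comm_ring_1"
  by (induction I rule: infinite_finite_induct) auto

lemma free_on_single [simp]: "x \<in> S \<Longrightarrow> Poly_Mapping.single x c \<in> free_on S"
  by (simp add: free_on_iff lookup_single when_def)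

lemma free_on_mono: "a \<in> free_on S \<Longrightarrow> S \<subseteq> T \<Longrightarrow> a \<in> free_on T"
  by (auto simp: free_on_def)

lemma sum_monomials: "a = (\<Sum>x\<in>Poly_Mapping.keys a. scale (coef a x) (mon x))"
proof (rule poly_mapping_eqI)
  fix y
  have "(\<Sum>x\<in>Poly_Mapping.keys a. coef a x * (1 when x = y)) = (\<Sum>x\<in>Poly_Mapping.keys a. if x = y then coef a y else 0)"
    by (rule sum.cong) (auto simp: when_def)
  also have "\<dots> = coef a y" by (simp add: in_keys_iff)
  finally show "coef a y = coef (\<Sum>x\<in>Poly_Mapping.keys a. scale (coef a x) (mon x)) y"
    by (simp add: lookup_sum lookup_single mult_when)
qed

text \<open>Linearity is a bare predicate on functions, so that \<open>lin_intros\<close> can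
  establish it for any expression built from the maps below; \<open>lin_eqI\<close> and its
  multilinear variants then reduce every identity to basis elements.\<close>

definition lin :: "(('b \<Rightarrow>\<^sub>0 'k::comm_ring_1) \<Rightarrow> ('c \<Rightarrow>\<^sub>0 'k)) \<Rightarrow> bool" where
  "lin F \<longleftrightarrow> (\<forall>a b. F (a + b) = F a + F b) \<and> (\<forall>c a. F (scale c a) = scale c (F a))"

lemma lin_add: "lin F \<Longrightarrow> F (a + b) = F a + F b"
  and lin_scale: "lin F \<Longrightarrow> F (scale c a) = scale c (F a)"
  by (auto simp: lin_def)

lemma lin_0: "lin F \<Longrightarrow> F 0 = 0"
  using lin_scale[of F 0 0] by simp

lemma lin_uminus: "lin F \<Longrightarrow> F (- a) = - F a"
  using lin_scale[of F "-1" a] by simp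

lemma lin_diff: "lin F \<Longrightarrow> F (a - b) = F a - F b"
  using lin_add[of F a "-b"] by (simp add: lin_uminus)

lemma lin_sum: "lin F \<Longrightarrow> F (\<Sum>i\<in>I. a i) = (\<Sum>i\<in>I. F (a i))"
  by (induction I rule: infinite_finite_induct) (simp_all add: lin_0 lin_add)

lemma lin_eqI:
  assumes "lin F" "lin G" "a \<in> free_on S" "\<And>x. x \<in> S \<Longrightarrow> F (mon x) = G (mon x)"
  shows "F a = G a"
proof -
  have "F (\<Sum>x\<in>Poly_Mapping.keys a. scale (coef a x) (mon x)) = G (\<Sum>x\<in>Poly_Mapping.keys a. scale (coef a x) (mon x))"
    unfolding lin_sum[OF assms(1)] lin_sum[OF assms(2)] lin_scale[OF assms(1)] lin_scale[OF assms(2)]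
    using assms(3,4) by (intro sum.cong) (auto simp: free_on_def)
  then show ?thesis using sum_monomials[of a] by simp
qed

lemma lin_eqI_UNIV:
  assumes "lin F" "lin G" "\<And>x. F (mon x) = G (mon x)"
  shows "F a = G a"
  by (rule lin_eqI[OF assms(1,2), of a UNIV]) (use assms(3) in \<open>auto simp: free_on_iff\<close>)

lemma lin_closed:
  assumes "lin F" "a \<in> free_on S" "\<And>x. x \<in> S \<Longrightarrow> F (mon x) \<in> free_on T"
  shows "F a \<in> free_on T"
proof -
  have "F a = (\<Sum>x\<in>Poly_Mapping.keys a. scale (coef a x) (F (mon x)))"
    by (subst sum_monomials[of a], subst lin_sum[OF assms(1)]) (simp only: lin_scale[OF assms(1)])
  then show ?thesis using assms(2,3) by (auto simp: free_on_def[of S])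
qed

lemma free_on_induct [consumes 1, case_names scaled add]:
  assumes "a \<in> free_on S" and "\<And>x c. x \<in> S \<Longrightarrow> P (scale c (mon x))" and "\<And>a b. P a \<Longrightarrow> P b \<Longrightarrow> P (a + b)"
    and "P 0"
  shows "P a"
proof -
  have "P (\<Sum>x\<in>I. scale (coef a x) (mon x))" if "I \<subseteq> S" for I
    using that
  proof (induction I rule: infinite_finite_induct)
    case (insert x F)
    then show ?case using assms(2)[of x "coef a x"] assms(3) by simp
  qed (simp_all add: assms(4))
  from this[of "Poly_Mapping.keys a"] assms(1) sum_monomials[of a] show ?thesis by (simp add: free_on_def)
qed

named_theorems lin_intros

lemma linear_ext_superset:
  assumes "finite S" "Poly_Mapping.keys a \<subseteq> S"
  shows "linear_ext f a = (\<Sum>x\<in>S. scale (coef a x) (f x))"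
  unfolding linear_ext_def
  by (rule sum.mono_neutral_left) (use assms in \<open>auto simp: in_keys_iff\<close>)

lemma lin_linear_ext: "lin (linear_ext f)"
  unfolding lin_def
proof (intro conjI allI)
  fix a b :: "'a \<Rightarrow>\<^sub>0 'b" and c
  let ?S = "Poly_Mapping.keys a \<union> Poly_Mapping.keys b"
  show "linear_ext f (a + b) = linear_ext f a + linear_ext f b"
    using Poly_Mapping.keys_add[of a b]
    by (simp add: linear_ext_superset[of ?S] lookup_add scale.scale_left_distrib sum.distrib)
  show "linear_ext f (scale c a) = scale c (linear_ext f a)"
  proof -
    have "Poly_Mapping.keys (scale c a) \<subseteq> Poly_Mapping.keys a"
      by (auto simp: in_keys_iff)
    then show ?thesis
      by (simp add: linear_ext_superset[of "Poly_Mapping.keys a"] scale.scale_sum_right)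
  qed
qed

lemma linear_ext_single [simp]: "linear_ext f (Poly_Mapping.single x c) = scale c (f x)"
  by (cases "c = 0") (simp_all add: linear_ext_def)

lemma bilinear_ext_linear_ext: "bilinear_ext f a b = linear_ext (\<lambda>x. linear_ext (f x) b) a"
  by (simp add: bilinear_ext_def linear_ext_def scale.scale_sum_right)

lemma lin_ident [lin_intros]: "lin (\<lambda>x. x)"
  by (simp add: lin_def)

lemma lin_zero [lin_intros]: "lin (\<lambda>x. 0)"
  by (simp add: lin_def)

lemma lin_plus [lin_intros]: "lin F \<Longrightarrow> lin G \<Longrightarrow> lin (\<lambda>x. F x + G x)"
  by (simp add: lin_def scale.scale_right_distrib)

lemma lin_setsum [lin_intros]: "(\<And>i. i \<in> I \<Longrightarrow> lin (F i)) \<Longrightarrow> lin (\<lambda>x. \<Sum>i\<in>I. F i x)"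
  by (induction I rule: infinite_finite_induct) (simp_all add: lin_zero lin_plus)

lemma lin_scaled [lin_intros]: "lin F \<Longrightarrow> lin (\<lambda>x. scale c (F x))"
  by (simp add: lin_def scale.scale_right_distrib mult.commute)

lemma lin_comp_linear_ext [lin_intros]: "lin F \<Longrightarrow> lin (\<lambda>x. linear_ext f (F x))"
  using lin_linear_ext[of f] by (simp add: lin_def)

lemma lin_bilinear_ext_left [lin_intros]: "lin F \<Longrightarrow> lin (\<lambda>x. bilinear_ext f (F x) b)"
  unfolding bilinear_ext_linear_ext by (rule lin_comp_linear_ext)

lemma lin_bilinear_ext_right [lin_intros]: "lin F \<Longrightarrow> lin (\<lambda>x. bilinear_ext f b (F x))"
  unfolding bilinear_ext_linear_ext[abs_def] linear_ext_def[of _ b]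
  by (intro lin_setsum lin_scaled lin_comp_linear_ext)

lemma bilinear_ext_single [simp]:
  "bilinear_ext f (Poly_Mapping.single x c) (Poly_Mapping.single y d) = scale (c * d) (f x y)"
  by (simp add: bilinear_ext_linear_ext)

lemma bilinear_ext_add_left: "bilinear_ext f (a + b) c = bilinear_ext f a c + bilinear_ext f b c"
  by (rule lin_add) (intro lin_intros)

lemma bilinear_ext_add_right: "bilinear_ext f c (a + b) = bilinear_ext f c a + bilinear_ext f c b"
  by (rule lin_add) (intro lin_intros)

lemma bilinear_ext_sum_left: "bilinear_ext f (\<Sum>i\<in>I. a i) c = (\<Sum>i\<in>I. bilinear_ext f (a i) c)"
  by (rule lin_sum) (intro lin_intros)

lemma bilinear_ext_sum_right: "bilinear_ext f c (\<Sum>i\<in>I. a i) = (\<Sum>i\<in>I. bilinear_ext f c (a i))"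
  by (rule lin_sum) (intro lin_intros)

lemma bilinear_ext_closed:
  assumes "a \<in> free_on S" "b \<in> free_on T" "\<And>x y. x \<in> S \<Longrightarrow> y \<in> T \<Longrightarrow> f x y \<in> free_on V"
  shows "bilinear_ext f a b \<in> free_on V"
proof (rule lin_closed[where F = "\<lambda>a. bilinear_ext f a b", OF _ assms(1)])
  fix x assume x: "x \<in> S"
  show "bilinear_ext f (mon x) b \<in> free_on V"
    by (rule lin_closed[where F = "\<lambda>b. bilinear_ext f (mon x) b", OF _ assms(2)])
      (use x assms(3) in \<open>auto intro: lin_intros\<close>)
qed (intro lin_intros)

lemma bilin_eqI:
  assumes "\<And>b. lin (\<lambda>a. F a b)" "\<And>b. lin (\<lambda>a. G a b)" "\<And>a. lin (F a)" "\<And>a. lin (G a)"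
    and "a \<in> free_on S" "b \<in> free_on T"
    and "\<And>x y. x \<in> S \<Longrightarrow> y \<in> T \<Longrightarrow> F (mon x) (mon y) = G (mon x) (mon y)"
  shows "F a b = G a b"
proof (rule lin_eqI[where F = "\<lambda>a. F a b" and G = "\<lambda>a. G a b", OF assms(1,2,5)])
  fix x assume "x \<in> S"
  then show "F (mon x) b = G (mon x) b"
    using lin_eqI[of "F (mon x)" "G (mon x)" b T] assms by blast
qed

section \<open>The group algebra of finitary permutations\<close>

text \<open>Finitary permutations of all natural numbers: every symmetric group lies in this one
  type, and the inclusion of one group algebra in the next is an inclusion of sets rather than an
  embedding.\<close>

typedef fperm = "{f :: nat \<Rightarrow> nat. permutation f}" morphisms app Fperm
  using permutation_id by blast

setup_lifting type_definition_fperm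

type_synonym 'k perm_alg = "fperm \<Rightarrow>\<^sub>0 'k"
type_synonym 'k diagram_comb = "diagram \<Rightarrow>\<^sub>0 'k"

text \<open>The group law is written additively so that the convolution product of
  \<^theory>\<open>HOL-Library.Poly_Mapping\<close> becomes the product of the group algebra.\<close>

instantiation fperm :: group_add
begin

lift_definition zero_fperm :: fperm is id by simp
lift_definition plus_fperm :: "fperm \<Rightarrow> fperm \<Rightarrow> fperm" is "(\<circ>)" by (rule permutation_compose)
lift_definition uminus_fperm :: "fperm \<Rightarrow> fperm" is "Hilbert_Choice.inv" by (rule permutation_inverse)
definition minus_fperm :: "fperm \<Rightarrow> fperm \<Rightarrow> fperm" where "minus_fperm g h = g + - h"

instance
proof
  fix a b c :: fperm
  show "a + b + c = a + (b + c)" by transfer (simp add: comp_assoc)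
  show "0 + a = a" by transfer simp
  show "a + 0 = a" by transfer simp
  show "- a + a = 0" by transfer (simp add: permutation_bijective bij_is_inj)
  show "a + - b = a - b" by (simp add: minus_fperm_def)
qed

end

lemma app_zero [simp]: "app 0 i = i" by transfer simp
lemma app_add [simp]: "app (g + h) i = app g (app h i)" by transfer simp
lemma app_permutation: "permutation (app g)" using app by blast
lemma app_uminus_app [simp]: "app (- g) (app g i) = i" using app_add[of "- g" g i] by (simp del: app_add)
lemma app_app_uminus [simp]: "app g (app (- g) i) = i" using app_add[of g "- g" i] by (simp del: app_add)
lemma app_inject_iff [simp]: "app g i = app g j \<longleftrightarrow> i = j" by (metis app_uminus_app)
lemma fperm_eqI: "(\<And>i. app g i = app h i) \<Longrightarrow> g = h" by (metis app_inject ext)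
lemma app_Fperm: "p permutes A \<Longrightarrow> finite A \<Longrightarrow> app (Fperm p) = p"
  using Fperm_inverse permutation_permutes by blast

definition Sym :: "nat \<Rightarrow> fperm set" where "Sym n = {g. app g permutes {1..n}}"

lemma Sym_zero [simp]: "0 \<in> Sym n"
  by (simp add: Sym_def zero_fperm.rep_eq permutes_id)
lemma Sym_add [simp, intro]: "g \<in> Sym n \<Longrightarrow> h \<in> Sym n \<Longrightarrow> g + h \<in> Sym n"
  by (simp add: Sym_def plus_fperm.rep_eq permutes_compose)
lemma Sym_uminus [simp, intro]: "g \<in> Sym n \<Longrightarrow> - g \<in> Sym n"
  by (simp add: Sym_def uminus_fperm.rep_eq permutes_inv)
lemma Sym_uminus_iff [simp]: "- g \<in> Sym n \<longleftrightarrow> g \<in> Sym n"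
  using Sym_uminus[of "- g" n] by auto
lemma Sym_add_iff_left: "g \<in> Sym n \<Longrightarrow> g + h \<in> Sym n \<longleftrightarrow> h \<in> Sym n"
  using Sym_add[of "- g" n "g + h"] by (auto simp flip: add.assoc)
lemma Sym_add_iff_right: "h \<in> Sym n \<Longrightarrow> g + h \<in> Sym n \<longleftrightarrow> g \<in> Sym n"
  using Sym_add[of "g + h" n "- h"] by (auto simp: add.assoc)
lemma Sym_mono: "m \<le> n \<Longrightarrow> Sym m \<subseteq> Sym n"
  by (auto simp: Sym_def intro: permutes_subset)
lemma Sym_app_in [simp]: "g \<in> Sym n \<Longrightarrow> app g i \<in> {1..n} \<longleftrightarrow> i \<in> {1..n}"
  using permutes_in_image[of "app g" "{1..n}" i] by (simp add: Sym_def)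
lemma Sym_app_in_Suc [simp]: "g \<in> Sym n \<Longrightarrow> app g i \<in> {Suc 0..n} \<longleftrightarrow> i \<in> {Suc 0..n}"
  using Sym_app_in[of g n i] by (simp only: One_nat_def)
lemma Sym_app_out: "g \<in> Sym n \<Longrightarrow> i \<notin> {1..n} \<Longrightarrow> app g i = i"
  unfolding Sym_def by (auto dest: permutes_not_in)
lemma Sym_iff: "g \<in> Sym n \<longleftrightarrow> (\<forall>i. i \<notin> {1..n} \<longrightarrow> app g i = i)"
proof -
  have "\<exists>!x. app g x = y" for y
    by (rule ex1I[of _ "app (- g) y"]) auto
  then show ?thesis by (simp add: Sym_def permutes_def)
qed
lemma finite_Sym [simp]: "finite (Sym n)"
proof -
  have "app ` Sym n \<subseteq> {p. p permutes {1..n}}" by (auto simp: Sym_def)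
  then have "finite (app ` Sym n)" using finite_permutations finite_subset by blast
  then show ?thesis by (rule finite_imageD) (simp add: inj_on_def app_inject)
qed
lemma Sym_Suc_fixed:
  assumes g: "g \<in> Sym (Suc n)" "app g (Suc n) = Suc n"
  shows "g \<in> Sym n"
  unfolding Sym_iff
proof (intro allI impI)
  fix i assume "i \<notin> {1..n}"
  then have "i \<notin> {1..Suc n} \<or> i = Suc n" by auto
  then show "app g i = i" using g Sym_app_out by blast
qed
lemma Sym_Fperm: "p permutes {1..n} \<Longrightarrow> Fperm p \<in> Sym n"
  by (simp add: Sym_def app_Fperm)

definition psign :: "fperm \<Rightarrow> int" where "psign g = sign (app g)"

lemma psign_add: "psign (g + h) = psign g * psign h"
  by (simp add: psign_def plus_fperm.rep_eq sign_compose app_permutation)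

section \<open>Group algebras of the finite symmetric groups and their trace form\<close>

abbreviation sym_alg :: "nat \<Rightarrow> ('k::comm_ring_1 perm_alg) set" where "sym_alg n \<equiv> free_on (Sym n)"

lemma scale_mult_left: "scale c a * b = scale c (a * b)"
  for a b :: "'k::comm_ring_1 perm_alg"
  unfolding scale_def mult_map_scale_conv_mult by (simp add: mult.assoc)

text \<open>The ring is not commutative, but the elements supported at the neutral element
  \<open>0\<close> are central; this carries scalars past left factors in
  \<open>scale_mult_right\<close>.\<close>

lemma single_zero_commute: "Poly_Mapping.single 0 c * a = a * Poly_Mapping.single 0 c"
  for a :: "'k::comm_ring_1 perm_alg"
proof -
  have "a * Poly_Mapping.single 0 c = Poly_Mapping.single 0 c * a" if "a \<in> free_on UNIV"
    using that
  proof (induction rule: free_on_induct)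
    case (scaled x d)
    then show ?case by (simp add: mult_single mult.commute)
  qed (simp_all add: distrib_left distrib_right)
  then show ?thesis by (simp add: free_on_iff)
qed

lemma scale_mult_right: "a * scale c b = scale c (a * b)"
  for a b :: "'k::comm_ring_1 perm_alg"
  unfolding scale_def mult_map_scale_conv_mult by (metis single_zero_commute mult.assoc)

lemma lin_mult_left [lin_intros]: "lin F \<Longrightarrow> lin (\<lambda>x. F x * (b :: 'k::comm_ring_1 perm_alg))"
  by (simp add: lin_def distrib_right scale_mult_left)

lemma lin_mult_right [lin_intros]: "lin F \<Longrightarrow> lin (\<lambda>x. (b :: 'k::comm_ring_1 perm_alg) * F x)"
  by (simp add: lin_def distrib_left scale_mult_right)

lemma mon_mult: "mon g * mon h = (mon (g + h) :: 'k::comm_ring_1 perm_alg)"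
  by (simp add: mult_single)

lemma sym_alg_mult [intro]:
  assumes "a \<in> sym_alg n" "b \<in> sym_alg n" shows "a * b \<in> (sym_alg n :: ('k::comm_ring_1 perm_alg) set)"
proof (rule lin_closed[where F = "\<lambda>a. a * b", OF _ assms(1)])
  fix x assume x: "x \<in> Sym n"
  show "mon x * b \<in> sym_alg n"
    by (rule lin_closed[where F = "\<lambda>b. mon x * b", OF _ assms(2)])
      (use x in \<open>auto intro: lin_intros simp: mon_mult\<close>)
qed (intro lin_intros)

lemma sym_alg_one [simp, intro]: "1 \<in> (sym_alg n :: ('k::comm_ring_1 perm_alg) set)"
  using free_on_single[of 0 "Sym n" "1::'k"] by (simp only: single_one) simp

lemma sym_alg_mono: "a \<in> sym_alg m \<Longrightarrow> m \<le> n \<Longrightarrow> a \<in> sym_alg n"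
  using free_on_mono Sym_mono by blast

lemma coef_mult_mon: "coef (a * mon h) g = coef a (g - h)"
  for a :: "'k::comm_ring_1 perm_alg"
proof -
  have "coef (a * mon h) g = coef a (g - h)" if "a \<in> free_on UNIV"
    using that
  proof (induction rule: free_on_induct)
    case (scaled x d)
    show ?case by (auto simp: mult_single lookup_single when_def eq_diff_eq)
  qed (simp_all add: distrib_right lookup_add)
  then show ?thesis by (simp add: free_on_iff)
qed

lemma coef_mon_mult: "coef (mon h * a) g = coef a (- h + g)"
  for a :: "'k::comm_ring_1 perm_alg"
proof -
  have "coef (mon h * a) g = coef a (- h + g)" if "a \<in> free_on UNIV"
    using that
  proof (induction rule: free_on_induct)
    case (scaled x d)
    have "h + x = g \<longleftrightarrow> x = - h + g" by (auto simp: add.assoc[symmetric])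
    then show ?case by (auto simp: mult_single lookup_single when_def)
  qed (simp_all add: distrib_left lookup_add)
  then show ?thesis by (simp add: free_on_iff)
qed

lemma coef_mult_zero: "coef (a * b) 0 = (\<Sum>x\<in>Poly_Mapping.keys a. coef a x * coef b (- x))"
  for a b :: "'k::comm_ring_1 perm_alg"
proof -
  have "a * b = (\<Sum>x\<in>Poly_Mapping.keys a. scale (coef a x) (mon x * b))"
    by (subst sum_monomials[of a]) (simp only: sum_distrib_right scale_mult_left)
  then show ?thesis by (simp add: lookup_sum coef_mon_mult)
qed

text \<open>The coefficient at the neutral element is a trace, because \<open>g + h = 0\<close> if
  and only if \<open>h + g = 0\<close>.\<close>

lemma coef_mult_zero_commute: "coef (a * b) 0 = coef (b * a) 0"
  for a b :: "'k::comm_ring_1 perm_alg"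
proof -
  have "coef (a * b) 0 = coef (b * a) 0" if "a \<in> free_on UNIV"
    using that
  proof (induction rule: free_on_induct)
    case (scaled x d)
    show ?case by (simp only: scale_mult_left scale_mult_right coef_scale coef_mult_mon coef_mon_mult) simp
  qed (simp_all add: distrib_left distrib_right lookup_add)
  then show ?thesis by (simp add: free_on_iff)
qed

text \<open>Multiplication by the inverse of a permutation \<open>g\<close> in the support moves the
  coefficient at \<open>g\<close> to the neutral element.\<close>

lemma trace_form_nondegenerate:
  fixes a :: "'k::comm_ring_1 perm_alg"
  assumes "a \<in> sym_alg n" "a \<noteq> 0"
  obtains b where "b \<in> sym_alg n" "coef (a * b) 0 \<noteq> 0"
proof -
  obtain g where "coef a g \<noteq> 0" using assms(2) by (metis poly_mapping_eqI lookup_zero)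
  moreover from this have "g \<in> Sym n" using assms(1) by (auto simp: free_on_iff)
  ultimately show ?thesis using that[of "mon (- g)"] by (simp add: coef_mult_mon)
qed

text \<open>The anti-involution inverting group elements. It does not conjugate scalars, so its
  positivity is stated for elements with integer coefficients.\<close>

definition star :: "'k::comm_ring_1 perm_alg \<Rightarrow> 'k perm_alg" where
  "star = linear_ext (\<lambda>g. mon (- g))"

lemma lin_star [lin_intros]: "lin F \<Longrightarrow> lin (\<lambda>x. star (F x))"
  unfolding star_def by (rule lin_comp_linear_ext)

lemma star_mon [simp]: "star (Poly_Mapping.single g c) = Poly_Mapping.single (- g) c"
  by (simp add: star_def)

lemma star_mult: "star (a * b) = star b * star a"
  by (rule bilin_eqI[of "\<lambda>a b. star (a * b)" "\<lambda>a b. star b * star a" _ UNIV _ UNIV])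
    (auto intro!: lin_intros simp: mult_single minus_add free_on_iff)

lemma coef_star: "coef (star a) g = coef a (- g)"
proof -
  have "coef (star a) g = coef a (- g)" if "a \<in> free_on UNIV"
    using that
  proof (induction rule: free_on_induct)
    case (scaled x d)
    show ?case by (auto simp: lookup_single when_def)
  qed (simp_all add: lookup_add lin_add[OF lin_star[OF lin_ident]] lin_0[OF lin_star[OF lin_ident]])
  then show ?thesis by (simp add: free_on_iff)
qed

definition integral :: "'k::comm_ring_1 perm_alg \<Rightarrow> bool" where
  "integral a \<longleftrightarrow> (\<forall>g. coef a g \<in> \<int>)"

lemma integral_mult:
  assumes "integral a" "integral b" shows "integral (a * b)"
proof -
  have "a * b = (\<Sum>x\<in>Poly_Mapping.keys a. scale (coef a x) (mon x * b))"
    by (subst sum_monomials[of a]) (simp only: sum_distrib_right scale_mult_left)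
  then show ?thesis using assms by (auto simp: integral_def lookup_sum coef_mon_mult)
qed

text \<open>At the neutral element \<open>a * star a\<close> has the sum of the squares of the
  coefficients of \<open>a\<close>. For integer coefficients, not all zero, this is a positive
  integer, hence nonzero in characteristic zero, while a sum of squares of general field elements
  could vanish.\<close>

lemma star_positive:
  fixes a :: "'k::field_char_0 perm_alg"
  assumes "integral a" "a \<noteq> 0"
  shows "a * star a \<noteq> 0"
proof -
  have "\<exists>k. coef a x = of_int k" for x using assms(1) by (auto simp: integral_def Ints_def)
  then obtain k where k: "\<And>x. coef a x = of_int (k x)" by metis
  obtain g where g: "coef a g \<noteq> 0" using assms(2) by (metis poly_mapping_eqI lookup_zero)
  then have gk: "g \<in> Poly_Mapping.keys a" "k g \<noteq> 0" using k by (auto simp: in_keys_iff)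
  have "coef (a * star a) 0 = of_int (\<Sum>x\<in>Poly_Mapping.keys a. k x * k x)"
    by (simp add: coef_mult_zero coef_star k)
  moreover have "(\<Sum>x\<in>Poly_Mapping.keys a. k x * k x) > 0"
    using gk by (intro sum_pos2[of _ g]) (auto simp: zero_less_mult_iff)
  ultimately show ?thesis by (metis lookup_zero of_int_eq_0_iff less_irrefl)
qed

text \<open>For \<open>T = Sym n\<close> this is the projection onto \<open>sym_alg n\<close> along
  all other permutations. As \<open>Sym n\<close> is a group, it is a bimodule map over
  \<open>sym_alg n\<close>, which makes it the means of comparing neighbouring symmetric
  groups.\<close>

definition restrict_to :: "fperm set \<Rightarrow> 'k::comm_ring_1 perm_alg \<Rightarrow> 'k perm_alg" where
  "restrict_to T = linear_ext (\<lambda>g. if g \<in> T then mon g else 0)"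

lemma lin_restrict_to [lin_intros]: "lin F \<Longrightarrow> lin (\<lambda>x. restrict_to T (F x))"
  unfolding restrict_to_def by (rule lin_comp_linear_ext)

lemma restrict_to_single [simp]:
  "restrict_to T (Poly_Mapping.single g c) = (if g \<in> T then Poly_Mapping.single g c else 0)"
  by (simp add: restrict_to_def)

lemma restrict_to_free [simp]: "restrict_to T a \<in> free_on T"
  by (rule lin_closed[where S = UNIV]) (auto intro: lin_intros simp: free_on_iff lookup_single when_def)

lemma coef_restrict_to: "g \<in> T \<Longrightarrow> coef (restrict_to T a) g = coef a g"
proof -
  assume g: "g \<in> T"
  have "coef (restrict_to T a) g = coef a g" if "a \<in> free_on UNIV"
    using that
  proof (induction rule: free_on_induct)
    case (scaled x d)
    show ?case using g by (auto simp: lookup_single when_def)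
  qed (simp_all add: lookup_add lin_add[OF lin_restrict_to[OF lin_ident]] lin_0[OF lin_restrict_to[OF lin_ident]])
  then show ?thesis by (simp add: free_on_iff)
qed

lemma restrict_to_sym_alg_mult:
  assumes "a \<in> sym_alg n" shows "restrict_to (Sym n) (a * b) = a * restrict_to (Sym n) b"
  by (rule bilin_eqI[of "\<lambda>a b. restrict_to (Sym n) (a * b)" "\<lambda>a b. a * restrict_to (Sym n) b" a "Sym n" b UNIV])
    (use assms in \<open>auto intro!: lin_intros simp: mult_single free_on_iff Sym_add_iff_left\<close>)

lemma restrict_to_mult_sym_alg:
  assumes "b \<in> sym_alg n" shows "restrict_to (Sym n) (a * b) = restrict_to (Sym n) a * b"
  by (rule bilin_eqI[of "\<lambda>a b. restrict_to (Sym n) (a * b)" "\<lambda>a b. restrict_to (Sym n) a * b" a UNIV b "Sym n"])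
    (use assms in \<open>auto intro!: lin_intros simp: mult_single free_on_iff Sym_add_iff_right\<close>)

section \<open>Row and column symmetrizers\<close>

text \<open>With \<open>f\<close> giving the row or the column of each entry, this is the row or the
  column stabilizer of a tableau.\<close>

definition stab :: "nat \<Rightarrow> (nat \<Rightarrow> nat) \<Rightarrow> fperm set" where
  "stab n f = {g \<in> Sym n. \<forall>i\<in>{1..n}. f (app g i) = f i}"

lemma stab_Sym: "g \<in> stab n f \<Longrightarrow> g \<in> Sym n" by (simp add: stab_def)
lemma stab_zero [simp]: "0 \<in> stab n f" by (simp add: stab_def)
lemma stab_add: "g \<in> stab n f \<Longrightarrow> h \<in> stab n f \<Longrightarrow> g + h \<in> stab n f"
  unfolding stab_def by (auto simp del: atLeastAtMost_iff)
lemma stab_uminus: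
  assumes "g \<in> stab n f" shows "- g \<in> stab n f"
proof -
  have "f (app (- g) i) = f i" if "i \<in> {1..n}" for i
  proof -
    have "app (- g) i \<in> {1..n}" using that assms by (simp add: stab_def del: atLeastAtMost_iff)
    then have "f (app g (app (- g) i)) = f (app (- g) i)" using assms unfolding stab_def by blast
    then show ?thesis by simp
  qed
  then show ?thesis using assms by (simp add: stab_def)
qed
lemma stab_uminus_iff [simp]: "- g \<in> stab n f \<longleftrightarrow> g \<in> stab n f"
  using stab_uminus[of "-g"] stab_uminus[of g] by auto
lemma finite_stab [simp]: "finite (stab n f)" by (simp add: stab_def)
lemma stab_add_iff_left: "g \<in> stab n f \<Longrightarrow> g + h \<in> stab n f \<longleftrightarrow> h \<in> stab n f"
  using stab_add[of "- g" n f "g + h"] stab_add[of g n f h] by (auto simp flip: add.assoc)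
lemma stab_add_iff_right: "h \<in> stab n f \<Longrightarrow> g + h \<in> stab n f \<longleftrightarrow> g \<in> stab n f"
  using stab_add[of "g + h" n f "- h"] stab_add[of g n f h] by (auto simp: add.assoc)

text \<open>A character with values 1 and -1. It is instantiated with the trivial character and the
  sign, so that row and column symmetrizers share their lemmas.\<close>

definition multiplicative :: "(fperm \<Rightarrow> int) \<Rightarrow> bool" where
  "multiplicative \<chi> \<longleftrightarrow> (\<forall>g h. \<chi> (g + h) = \<chi> g * \<chi> h) \<and> (\<forall>g. \<chi> g * \<chi> g = 1)"

lemma multiplicative_one: "multiplicative (\<lambda>g. 1)"
  and multiplicative_psign: "multiplicative psign"
  by (auto simp: multiplicative_def psign_add) (simp add: psign_def)

lemma multiplicative_zero: "multiplicative \<chi> \<Longrightarrow> \<chi> 0 = 1"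
  unfolding multiplicative_def by (metis add.left_neutral)

lemma multiplicative_uminus: "multiplicative \<chi> \<Longrightarrow> \<chi> (- g) = \<chi> g"
proof -
  assume \<chi>: "multiplicative \<chi>"
  then have "\<chi> (- g) * \<chi> g = 1" "\<chi> g * \<chi> g = 1"
    using multiplicative_zero[OF \<chi>] by (metis multiplicative_def add.left_inverse, simp add: multiplicative_def)
  then show ?thesis by (metis mult.assoc mult.left_neutral mult.right_neutral)
qed

definition symm :: "(fperm \<Rightarrow> int) \<Rightarrow> nat \<Rightarrow> (nat \<Rightarrow> nat) \<Rightarrow> 'k::comm_ring_1 perm_alg" where
  "symm \<chi> n f = (\<Sum>g\<in>stab n f. Poly_Mapping.single g (of_int (\<chi> g)))"

lemma coef_symm: "coef (symm \<chi> n f) g = (if g \<in> stab n f then of_int (\<chi> g) else 0)"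
  by (simp add: symm_def lookup_sum lookup_single when_def)

lemma symm_sym_alg [simp, intro]: "symm \<chi> n f \<in> sym_alg n"
  by (auto simp: free_on_iff coef_symm stab_def split: if_splits)

lemma symm_integral: "integral (symm \<chi> n f)"
  by (auto simp: integral_def coef_symm)

lemma star_symm: "multiplicative \<chi> \<Longrightarrow> star (symm \<chi> n f) = symm \<chi> n f"
  by (rule poly_mapping_eqI) (simp add: coef_star coef_symm multiplicative_uminus)

lemma mon_symm:
  assumes "multiplicative \<chi>" "s \<in> stab n f"
  shows "mon s * symm \<chi> n f = scale (of_int (\<chi> s)) (symm \<chi> n f)"
proof (rule poly_mapping_eqI)
  fix g
  have "\<chi> (- s + g) = \<chi> s * \<chi> g"
    using assms(1) multiplicative_uminus[OF assms(1)] by (simp add: multiplicative_def)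
  then show "coef (mon s * symm \<chi> n f) g = coef (scale (of_int (\<chi> s)) (symm \<chi> n f)) g"
    using assms(2) by (simp add: coef_mon_mult coef_symm stab_add_iff_left)
qed

lemma symm_mon:
  assumes "multiplicative \<chi>" "s \<in> stab n f"
  shows "symm \<chi> n f * mon s = scale (of_int (\<chi> s)) (symm \<chi> n f)"
proof (rule poly_mapping_eqI)
  fix g
  have "\<chi> (g - s) = \<chi> s * \<chi> g"
    using assms(1) multiplicative_uminus[OF assms(1), of s] unfolding multiplicative_def
    by (metis mult.commute diff_conv_add_uminus)
  moreover have "g - s \<in> stab n f \<longleftrightarrow> g \<in> stab n f"
    using stab_add_iff_right[of "- s" n f g] assms(2) by simp
  ultimately show "coef (symm \<chi> n f * mon s) g = coef (scale (of_int (\<chi> s)) (symm \<chi> n f)) g"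
    by (simp add: coef_mult_mon coef_symm)
qed

lemma sum_const_scale: "(\<Sum>i\<in>I. a) = scale (of_nat (card I)) a"
  by (induction I rule: infinite_finite_induct) (simp_all add: scale.scale_left_distrib del: sum_constant)

lemma symm_square:
  assumes "multiplicative \<chi>"
  shows "symm \<chi> n f * symm \<chi> n f = scale (of_nat (card (stab n f))) (symm \<chi> n f)"
proof -
  have "symm \<chi> n f * symm \<chi> n f = (\<Sum>g\<in>stab n f. scale (of_int (\<chi> g)) (mon g * symm \<chi> n f))"
    by (subst symm_def) (simp add: sum_distrib_right flip: scale_mult_left)
  also have "\<dots> = (\<Sum>g\<in>stab n f. symm \<chi> n f)"
    using assms by (intro sum.cong) (simp_all add: mon_symm multiplicative_def flip: of_int_mult)
  also have "\<dots> = scale (of_nat (card (stab n f))) (symm \<chi> n f)"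
    by (rule sum_const_scale)
  finally show ?thesis .
qed

text \<open>Conjugation by \<open>g\<close> turns the stabilizer of \<open>f\<close> into that of
  \<open>f \<circ> app (- g)\<close>, and \<open>\<chi>\<close> does not change under
  conjugation.\<close>

lemma symm_conj:
  assumes "multiplicative \<chi>" "g \<in> Sym n"
  shows "mon g * symm \<chi> n f = symm \<chi> n (f \<circ> app (- g)) * mon g"
proof (rule poly_mapping_eqI)
  fix x
  have "- g + x \<in> stab n f \<longleftrightarrow> x - g \<in> stab n (f \<circ> app (- g))"
  proof -
    have "- g + x \<in> Sym n \<longleftrightarrow> x - g \<in> Sym n"
      using assms(2) Sym_add_iff_left[of "- g" n x] Sym_add_iff_right[of "- g" n x] by simp
    moreover have "(\<forall>i\<in>{1..n}. f (app (- g + x) i) = f i) \<longleftrightarrow>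
       (\<forall>i\<in>{1..n}. (f \<circ> app (- g)) (app (x - g) i) = (f \<circ> app (- g)) i)" (is "?L \<longleftrightarrow> ?R")
    proof
      assume L: ?L
      show ?R
      proof
        fix i assume "i \<in> {1..n}"
        then have "app (- g) i \<in> {1..n}" using assms(2) by (simp del: atLeastAtMost_iff)
        with L have "f (app (- g + x) (app (- g) i)) = f (app (- g) i)" by blast
        then show "(f \<circ> app (- g)) (app (x - g) i) = (f \<circ> app (- g)) i"
          by (simp only: diff_conv_add_uminus app_add comp_apply)
      qed
    next
      assume R: ?R
      show ?L
      proof
        fix i assume "i \<in> {1..n}"
        then have "app g i \<in> {1..n}" using assms(2) by (simp del: atLeastAtMost_iff)
        with R have "(f \<circ> app (- g)) (app (x - g) (app g i)) = (f \<circ> app (- g)) (app g i)" by blast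
        then show "f (app (- g + x) i) = f i"
          by (simp only: diff_conv_add_uminus app_add comp_apply app_uminus_app)
      qed
    qed
    ultimately show ?thesis by (simp add: stab_def)
  qed
  moreover have "\<chi> (- g + x) = \<chi> (x - g)"
    using assms(1) unfolding multiplicative_def by (metis mult.commute diff_conv_add_uminus)
  ultimately show "coef (mon g * symm \<chi> n f) x = coef (symm \<chi> n (f \<circ> app (- g)) * mon g) x"
    by (simp add: coef_mon_mult coef_mult_mon coef_symm)
qed

abbreviation "row_symm \<equiv> symm (\<lambda>g. 1)"
abbreviation "col_symm \<equiv> symm psign"

text \<open>The transposition \<open>s\<close> of \<open>i\<close> and \<open>j\<close> lies in both
  stabilizers. Inserting \<open>s + s = 0\<close> between the factors, the row symmetrizer absorbs
  one copy with sign 1 and the column symmetrizer the other with sign -1, so the product equals its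
  own negative.\<close>

lemma row_col_symm_eq_zero:
  assumes "i \<in> {1..n}" "j \<in> {1..n}" "i \<noteq> j" "f i = f j" "h i = h j"
  shows "row_symm n f * col_symm n h = (0 :: 'k::field_char_0 perm_alg)"
proof -
  define s where "s = Fperm (transpose i j)"
  have p: "transpose i j permutes {1..n}" using assms by (simp add: permutes_swap_id)
  have a: "app s = transpose i j" unfolding s_def using p by (simp add: app_Fperm)
  have st: "s \<in> stab n k" if "k i = k j" for k :: "nat \<Rightarrow> nat"
    using p that by (auto simp: stab_def Sym_def a transpose_def)
  have "s + s = 0" by (rule fperm_eqI) (simp add: a)
  then have "row_symm n f * col_symm n h = row_symm n f * (mon s * mon s) * (col_symm n h :: 'k perm_alg)"
    by (simp add: mon_mult)
  also have "\<dots> = (row_symm n f * mon s) * (mon s * col_symm n h)" by (simp only: mult.assoc)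
  also have "\<dots> = - (row_symm n f * col_symm n h)"
    using assms by (simp add: symm_mon mon_symm multiplicative_one multiplicative_psign st psign_def a sign_swap_id scale_mult_right)
  finally have "row_symm n f * col_symm n h + row_symm n f * col_symm n h = (0 :: 'k perm_alg)"
    by (metis add.right_inverse)
  then have "scale 2 (row_symm n f * col_symm n h) = (0 :: 'k perm_alg)"
    by (metis scale.scale_left_distrib scale.scale_one one_add_one)
  then show ?thesis
    by (metis coef_scale lookup_zero mult_eq_0_iff poly_mapping_eqI zero_neq_numeral)
qed

section \<open>Young symmetrizers\<close>

lemma young_diagram_Sigma: "young_diagram l = (SIGMA i:{..<length l}. {..<l ! i})"
  by (auto simp: young_diagram_def)

lemma finite_young_diagram [simp]: "finite (young_diagram l)"
  by (simp add: young_diagram_Sigma)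

lemma card_young_diagram: "card (young_diagram l) = sum_list l"
  by (simp add: young_diagram_Sigma sum_list_sum_nth atLeast0LessThan)

lemma young_diagram_down:
  assumes "l \<in> partitions n" "(i, j) \<in> young_diagram l" "i' \<le> i" "j' \<le> j"
  shows "(i', j') \<in> young_diagram l"
proof -
  have "l ! i \<le> l ! i'" if "i' < i"
    using assms that sorted_wrt_nth_less[of "(\<ge>)" l i' i] by (auto simp: partitions_def young_diagram_def)
  then show ?thesis using assms by (cases "i' = i") (auto simp: young_diagram_def)
qed

text \<open>A tableau is given by the map sending each entry to its cell.\<close>

definition tab :: "nat \<Rightarrow> nat list \<Rightarrow> (nat \<Rightarrow> nat \<times> nat) \<Rightarrow> bool" where
  "tab n l T \<longleftrightarrow> bij_betw T {1..n} (young_diagram l)"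

lemma tab_exists:
  assumes "l \<in> partitions n" shows "\<exists>T. tab n l T"
  unfolding tab_def by (rule finite_same_card_bij) (use assms in \<open>auto simp: card_young_diagram partitions_def\<close>)

lemma tab_inj: "tab n l T \<Longrightarrow> i \<in> {1..n} \<Longrightarrow> j \<in> {1..n} \<Longrightarrow> T i = T j \<Longrightarrow> i = j"
  unfolding tab_def bij_betw_def by (blast dest: inj_onD)

lemma tab_in: "tab n l T \<Longrightarrow> i \<in> {1..n} \<Longrightarrow> T i \<in> young_diagram l"
  unfolding tab_def bij_betw_def by blast

lemma Sym_bij_betw: "g \<in> Sym n \<Longrightarrow> bij_betw (app g) {1..n} {1..n}"
  by (simp only: Sym_def mem_Collect_eq permutes_imp_bij)

lemma tab_comp: "tab n l T \<Longrightarrow> g \<in> Sym n \<Longrightarrow> tab n l (T \<circ> app g)"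
  unfolding tab_def by (rule bij_betw_trans[OF Sym_bij_betw])

lemma tab_card: "tab n l T \<Longrightarrow> card {i \<in> {1..n}. P (T i)} = card {c \<in> young_diagram l. P c}"
  unfolding tab_def by (rule bij_betw_same_card[of T]) (rule bij_betw_Collect, simp_all)

text \<open>The permutation is the inverse of \<open>T\<close> composed with \<open>V\<close>,
  extended by the identity outside \<open>{1..n}\<close>.\<close>

lemma tab_transition:
  assumes "tab n l T" "tab n l V"
  obtains g where "g \<in> Sym n" "\<And>i. i \<in> {1..n} \<Longrightarrow> T (app g i) = V i"
proof -
  define r where "r i = (if i \<in> {1..n} then inv_into {1..n} T (V i) else i)" for i
  have "bij_betw (inv_into {1..n} T \<circ> V) {1..n} {1..n}"
    using assms unfolding tab_def by (blast intro: bij_betw_trans bij_betw_inv_into)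
  then have "bij_betw r {1..n} {1..n}"
    by (rule bij_betw_cong[THEN iffD1, rotated]) (simp add: r_def)
  then have r: "r permutes {1..n}"
    by (rule bij_imp_permutes) (auto simp: r_def)
  have "T (r i) = V i" if "i \<in> {1..n}" for i
    using that assms tab_in[OF assms(2) that]
    by (simp add: r_def tab_def bij_betw_def f_inv_into_f del: atLeastAtMost_iff)
  then show ?thesis using that[of "Fperm r"] r by (simp add: Sym_Fperm app_Fperm)
qed

lemma card_fibers:
  assumes "finite A" "finite J" "h ` A \<subseteq> J"
  shows "card A = (\<Sum>j\<in>J. card {i \<in> A. h i = j})"
  using sum.group[OF assms, of "\<lambda>_. 1::nat"] by simp

text \<open>If column \<open>j\<close> of the diagram reaches row \<open>k\<close>, it has
  \<open>k\<close> cells above that row, and the left side is at most \<open>k\<close> because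
  \<open>f\<close> is injective on a column of \<open>V\<close>. Otherwise the whole column lies
  above row \<open>k\<close>, and the right side is the number of all entries of this
  column.\<close>

lemma column_count_le:
  assumes l: "l \<in> partitions n" and V: "tab n l V"
    and inj: "inj_on (\<lambda>i. (f i, snd (V i))) {1..n}"
  shows "card {i \<in> {1..n}. f i < k \<and> snd (V i) = j} \<le> card {c \<in> young_diagram l. fst c < k \<and> snd c = j}"
    (is "card ?L \<le> card ?R")
proof (cases "\<exists>i. (i, j) \<in> young_diagram l \<and> k \<le> i")
  case True
  then obtain i where i: "(i, j) \<in> young_diagram l" "k \<le> i" by blast
  have "inj_on f ?L"
  proof (rule inj_onI)
    fix a b assume ab: "a \<in> ?L" "b \<in> ?L" "f a = f b"
    show "a = b" by (rule inj_onD[OF inj]) (use ab in \<open>simp_all del: atLeastAtMost_iff\<close>)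
  qed
  then have "card ?L = card (f ` ?L)" by (simp add: card_image)
  also have "\<dots> \<le> card {..<k}" by (intro card_mono) auto
  also have "\<dots> = card ((\<lambda>i. (i, j)) ` {..<k})" by (intro card_image[symmetric]) (simp add: inj_on_def)
  also have "\<dots> \<le> card ?R"
    using young_diagram_down[OF l i(1)] i(2) by (intro card_mono) auto
  finally show ?thesis .
next
  case False
  then have "?R = {c \<in> young_diagram l. snd c = j}" by force
  then have "card ?R = card {i \<in> {1..n}. snd (V i) = j}"
    using tab_card[OF V, of "\<lambda>c. snd c = j"] by simp
  moreover have "card ?L \<le> card {i \<in> {1..n}. snd (V i) = j}" by (rule card_mono) auto
  ultimately show ?thesis by simp
qed

text \<open>The dominance order. Counting the cells of the first \<open>k\<close> rows instead of
  adding parts avoids padding partitions of different lengths by zeros.\<close>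

definition dominated :: "nat list \<Rightarrow> nat list \<Rightarrow> bool" where
  "dominated l m \<longleftrightarrow>
    (\<forall>k. card {c \<in> young_diagram l. fst c < k} \<le> card {c \<in> young_diagram m. fst c < k})"

lemma row_count:
  assumes "tab n l T" "finite J" "(\<lambda>i. snd (V i)) ` {1..n} \<subseteq> J"
  shows "card {c \<in> young_diagram l. fst c < k} = (\<Sum>j\<in>J. card {i \<in> {1..n}. fst (T i) < k \<and> snd (V i) = j})"
proof -
  have "card {c \<in> young_diagram l. fst c < k} = card {i \<in> {1..n}. fst (T i) < k}"
    using tab_card[OF assms(1), of "\<lambda>c. fst c < k"] by simp
  also have "\<dots> = (\<Sum>j\<in>J. card {i \<in> {i \<in> {1..n}. fst (T i) < k}. snd (V i) = j})"
    by (rule card_fibers) (use assms in auto)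
  finally show ?thesis by (simp add: conj_assoc)
qed

lemma column_count:
  assumes "finite J" "snd ` young_diagram l \<subseteq> J"
  shows "card {c \<in> young_diagram l. fst c < k} = (\<Sum>j\<in>J. card {c \<in> young_diagram l. fst c < k \<and> snd c = j})"
proof -
  have "card {c \<in> young_diagram l. fst c < k} = (\<Sum>j\<in>J. card {c \<in> {c \<in> young_diagram l. fst c < k}. snd c = j})"
    by (rule card_fibers) (use assms in auto)
  then show ?thesis by (simp add: conj_assoc)
qed

text \<open>The count of entries in the first \<open>k\<close> rows of \<open>T\<close> is split
  according to the columns of \<open>V\<close>; in each column it is bounded by the number of cells
  of \<open>m\<close> in the first \<open>k\<close> rows, and these numbers add up again.\<close>

lemma separated_imp_dominated:
  assumes "l \<in> partitions n" "m \<in> partitions n" "tab n l T" "tab n m V"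
    and inj: "inj_on (\<lambda>i. (fst (T i), snd (V i))) {1..n}"
  shows "dominated l m"
  unfolding dominated_def
proof
  fix k
  let ?J = "(\<lambda>i. snd (V i)) ` {1..n} \<union> snd ` young_diagram m"
  show "card {c \<in> young_diagram l. fst c < k} \<le> card {c \<in> young_diagram m. fst c < k}"
    using row_count[OF assms(3), of ?J V k] column_count[of ?J m k]
      column_count_le[OF assms(2,4) inj] by (simp add: sum_mono)
qed

text \<open>For equal shapes the column-wise inequalities add up to an equality, so each of them is
  one. Passing from the first \<open>k\<close> rows to one more, with \<open>k\<close> the row of
  \<open>i\<close>, increases the count of entries in the column of \<open>i\<close>; hence the
  diagram gains a cell in that row and column.\<close>

lemma separated_imp_in_young_diagram:
  assumes l: "l \<in> partitions n" and T: "tab n l T" and V: "tab n l V"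
    and inj: "inj_on (\<lambda>i. (fst (T i), snd (V i))) {1..n}" and i: "i \<in> {1..n}"
  shows "(fst (T i), snd (V i)) \<in> young_diagram l"
proof -
  let ?J = "(\<lambda>i. snd (V i)) ` {1..n} \<union> snd ` young_diagram l"
  let ?k = "fst (T i)" and ?j = "snd (V i)"
  have eq: "card {i \<in> {1..n}. fst (T i) < k \<and> snd (V i) = ?j} = card {c \<in> young_diagram l. fst c < k \<and> snd c = ?j}" for k
  proof -
    let ?f = "\<lambda>j. card {i \<in> {1..n}. fst (T i) < k \<and> snd (V i) = j}"
    let ?g = "\<lambda>j. card {c \<in> young_diagram l. fst c < k \<and> snd c = j}"
    have "sum ?f ?J = sum ?g ?J"
      using row_count[OF T, of ?J V k] column_count[of ?J l k] by simp
    then have "?f ?j = ?g ?j"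
      by (rule sum_mono_inv) (use column_count_le[OF l V inj] i in auto)
    then show ?thesis .
  qed
  have "card {i \<in> {1..n}. fst (T i) < ?k \<and> snd (V i) = ?j} < card {i \<in> {1..n}. fst (T i) < Suc ?k \<and> snd (V i) = ?j}"
    using i by (intro psubset_card_mono) auto
  then have "card {c \<in> young_diagram l. fst c < ?k \<and> snd c = ?j} < card {c \<in> young_diagram l. fst c < Suc ?k \<and> snd c = ?j}"
    by (simp only: eq)
  moreover have "card {c \<in> young_diagram l. fst c < Suc ?k \<and> snd c = ?j} \<le> card {c \<in> young_diagram l. fst c < ?k \<and> snd c = ?j}"
    if "{c \<in> young_diagram l. fst c < Suc ?k \<and> snd c = ?j} \<subseteq> {c \<in> young_diagram l. fst c < ?k \<and> snd c = ?j}"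
    by (rule card_mono[OF _ that]) simp
  ultimately have "\<not> {c \<in> young_diagram l. fst c < Suc ?k \<and> snd c = ?j} \<subseteq> {c \<in> young_diagram l. fst c < ?k \<and> snd c = ?j}"
    by linarith
  then show ?thesis by (auto simp: less_Suc_eq)
qed

text \<open>Differences of consecutive counts recover the row lengths, and as partitions have no
  zero parts, these also determine the number of rows.\<close>

lemma dominated_antisym:
  assumes "l \<in> partitions n" "m \<in> partitions n'" "dominated l m" "dominated m l"
  shows "l = m"
proof -
  have row: "card {c \<in> young_diagram x. fst c < Suc k} - card {c \<in> young_diagram x. fst c < k} = (if k < length x then x ! k else 0)" for x k
  proof -
    have "{c \<in> young_diagram x. fst c < Suc k} = {c \<in> young_diagram x. fst c < k} \<union> {c \<in> young_diagram x. fst c = k}"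
      by auto
    then have "card {c \<in> young_diagram x. fst c < Suc k} = card {c \<in> young_diagram x. fst c < k} + card {c \<in> young_diagram x. fst c = k}"
      by (simp add: card_Un_disjoint disjoint_iff)
    moreover have "{c \<in> young_diagram x. fst c = k} = (if k < length x then Pair k ` {..<x ! k} else {})"
      by (auto simp: young_diagram_def)
    ultimately show ?thesis by (simp add: card_image inj_on_def)
  qed
  have "card {c \<in> young_diagram l. fst c < k} = card {c \<in> young_diagram m. fst c < k}" for k
    using assms(3,4) by (simp add: dominated_def eq_iff)
  then have eq: "(if k < length l then l ! k else 0) = (if k < length m then m ! k else 0)" for k
    using row[of l k] row[of m k] by simp
  have pos: "x ! k \<noteq> 0" if "x = l \<or> x = m" "k < length x" for x k
    using that assms(1,2) by (force simp: partitions_def in_set_conv_nth)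
  have "length l = length m"
  proof (rule ccontr)
    assume "length l \<noteq> length m"
    then consider "length l < length m" | "length m < length l" by linarith
    then show False using eq[of "length l"] eq[of "length m"] pos by cases fastforce+
  qed
  then show ?thesis using eq by (metis nth_equalityI)
qed

section \<open>Products of row and column symmetrizers\<close>

lemma symm_cong: "(\<And>i. i \<in> {1..n} \<Longrightarrow> f i = h i) \<Longrightarrow> symm \<chi> n f = symm \<chi> n h"
proof -
  assume a: "\<And>i. i \<in> {1..n} \<Longrightarrow> f i = h i"
  have "f (app g i) = f i \<longleftrightarrow> h (app g i) = h i" if "g \<in> Sym n" "i \<in> {1..n}" for g i
    using that a[of i] a[of "app g i"] Sym_app_in[of g n i] by simp
  then have "stab n f = stab n h" unfolding stab_def by blast
  then show ?thesis by (simp add: symm_def)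
qed

definition young :: "nat \<Rightarrow> (nat \<Rightarrow> nat \<times> nat) \<Rightarrow> 'k::comm_ring_1 perm_alg" where
  "young n T = row_symm n (fst \<circ> T) * col_symm n (snd \<circ> T)"

lemma young_sym_alg [simp, intro]: "young n T \<in> sym_alg n"
  by (auto simp: young_def)

lemma young_conj:
  assumes "g \<in> Sym n" "\<And>i. i \<in> {1..n} \<Longrightarrow> V i = T (app g i)"
  shows "mon g * young n V = (young n T * mon g :: 'k::comm_ring_1 perm_alg)"
proof -
  have *: "mon g * symm \<chi> n (p \<circ> V) = (symm \<chi> n (p \<circ> T) * mon g :: 'k perm_alg)" if "multiplicative \<chi>"
    for \<chi> and p :: "nat \<times> nat \<Rightarrow> nat"
  proof -
    have "(symm \<chi> n (p \<circ> T) :: 'k perm_alg) = symm \<chi> n (p \<circ> V \<circ> app (- g))"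
      by (rule symm_cong) (use assms in \<open>simp del: atLeastAtMost_iff\<close>)
    then show ?thesis by (simp add: symm_conj[OF that assms(1)])
  qed
  show ?thesis
    unfolding young_def mult.assoc[symmetric] *[OF multiplicative_one]
    unfolding mult.assoc *[OF multiplicative_psign] by (rule refl)
qed

text \<open>Moving \<open>g\<close> to the right replaces \<open>V\<close> by
  \<open>V \<circ> app (- g)\<close> in the column symmetrizer; two entries sharing a row of
  \<open>T\<close> and a column of this tableau would make the product vanish.\<close>

lemma row_mon_col_nonzero_imp_inj:
  assumes V: "tab n m V" and g: "g \<in> Sym n"
    and nz: "row_symm n (fst \<circ> T) * mon g * col_symm n (snd \<circ> V) \<noteq> (0 :: 'k::field_char_0 perm_alg)"
  shows "inj_on (\<lambda>i. (fst (T i), snd ((V \<circ> app (- g)) i))) {1..n}"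
proof (rule ccontr)
  assume "\<not> ?thesis"
  then obtain i j where ij: "i \<in> {1..n}" "j \<in> {1..n}" "i \<noteq> j"
    "(fst \<circ> T) i = (fst \<circ> T) j" "(snd \<circ> V \<circ> app (- g)) i = (snd \<circ> V \<circ> app (- g)) j"
    unfolding inj_on_def by auto
  have "row_symm n (fst \<circ> T) * mon g * col_symm n (snd \<circ> V)
      = row_symm n (fst \<circ> T) * col_symm n (snd \<circ> V \<circ> app (- g)) * (mon g :: 'k perm_alg)"
    by (simp only: mult.assoc symm_conj[OF multiplicative_psign g, of "snd \<circ> V"])
  also have "\<dots> = 0" by (simp only: row_col_symm_eq_zero[OF ij]) simp
  finally show False using nz by simp
qed

lemma row_mon_col_nonzero_imp_dominated:
  assumes "l \<in> partitions n" "m \<in> partitions n" "tab n l T" "tab n m V" "g \<in> Sym n"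
    and "row_symm n (fst \<circ> T) * mon g * col_symm n (snd \<circ> V) \<noteq> (0 :: 'k::field_char_0 perm_alg)"
  shows "dominated l m"
  using separated_imp_dominated[OF assms(1-3) tab_comp[OF assms(4) Sym_uminus[OF assms(5)]]]
    row_mon_col_nonzero_imp_inj[OF assms(4-6)] by blast

text \<open>Combining the rows of \<open>T\<close> with the columns of
  \<open>T \<circ> app (- g)\<close> gives a tableau again. The permutation \<open>r\<close> that
  carries it to \<open>T\<close> preserves the rows of \<open>T\<close>, and \<open>- g + r\<close>
  preserves its columns, so \<open>c\<close> is the inverse of the latter.\<close>

lemma row_col_factorization:
  assumes l: "l \<in> partitions n" and T: "tab n l T" and g: "g \<in> Sym n"
    and inj: "inj_on (\<lambda>i. (fst (T i), snd ((T \<circ> app (- g)) i))) {1..n}"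
  obtains r c where "r \<in> stab n (fst \<circ> T)" "c \<in> stab n (snd \<circ> T)" "g = r + c"
proof -
  let ?S = "\<lambda>i. (fst (T i), snd ((T \<circ> app (- g)) i))"
  have "?S ` {1..n} \<subseteq> young_diagram l"
    using separated_imp_in_young_diagram[OF l T tab_comp[OF T Sym_uminus[OF g]] inj] by blast
  moreover have "card (?S ` {1..n}) = card (young_diagram l)"
    using card_image[OF inj] l by (simp add: card_young_diagram partitions_def)
  ultimately have "tab n l ?S"
    using inj unfolding tab_def bij_betw_def by (simp add: card_subset_eq)
  then obtain r where r: "r \<in> Sym n" "\<And>i. i \<in> {1..n} \<Longrightarrow> ?S (app r i) = T i"
    using tab_transition[OF _ T] by blast
  have "r \<in> stab n (fst \<circ> T)"
    unfolding stab_def using r by (auto simp: prod_eq_iff simp del: atLeastAtMost_iff)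
  have "- g + r \<in> stab n (snd \<circ> T)"
    unfolding stab_def using r g by (auto simp: prod_eq_iff simp del: atLeastAtMost_iff)
  then have "- (- g + r) \<in> stab n (snd \<circ> T)" by (rule stab_uminus)
  moreover have "g = r + - (- g + r)" by (simp add: minus_add add.assoc[symmetric])
  ultimately show ?thesis using that \<open>r \<in> stab n (fst \<circ> T)\<close> by blast
qed

lemma row_mon_col_scale_young:
  assumes l: "l \<in> partitions n" and T: "tab n l T" and g: "g \<in> Sym n"
  shows "\<exists>d. row_symm n (fst \<circ> T) * mon g * col_symm n (snd \<circ> T) = scale d (young n T :: 'k::field_char_0 perm_alg)"
proof (cases "row_symm n (fst \<circ> T) * mon g * col_symm n (snd \<circ> T) = (0 :: 'k perm_alg)")
  case True
  then show ?thesis by (metis scale.scale_zero_left)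
next
  case False
  from row_col_factorization[OF l T g row_mon_col_nonzero_imp_inj[OF T g False]]
  obtain r c where rc: "r \<in> stab n (fst \<circ> T)" "c \<in> stab n (snd \<circ> T)" "g = r + c" .
  have "row_symm n (fst \<circ> T) * mon g * col_symm n (snd \<circ> T)
     = (row_symm n (fst \<circ> T) * mon r) * (mon c * (col_symm n (snd \<circ> T) :: 'k perm_alg))"
    by (simp only: rc(3) mult.assoc mon_mult[symmetric])
  also have "\<dots> = scale (of_int (psign c)) (young n T)"
    by (simp add: symm_mon[OF multiplicative_one rc(1)] mon_symm[OF multiplicative_psign rc(2)] young_def scale_mult_right)
  finally show ?thesis by blast
qed

lemma row_sym_alg_col_scale_young:
  assumes l: "l \<in> partitions n" and T: "tab n l T" and a: "a \<in> sym_alg n"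
  shows "\<exists>d. row_symm n (fst \<circ> T) * a * col_symm n (snd \<circ> T) = scale d (young n T :: 'k::field_char_0 perm_alg)"
  using a
proof (induction rule: free_on_induct)
  case (scaled g c)
  obtain d where "row_symm n (fst \<circ> T) * mon g * col_symm n (snd \<circ> T) = scale d (young n T :: 'k perm_alg)"
    using row_mon_col_scale_young[OF l T scaled] by blast
  then have "row_symm n (fst \<circ> T) * scale c (mon g) * col_symm n (snd \<circ> T) = scale (c * d) (young n T :: 'k perm_alg)"
    by (simp only: scale_mult_left scale_mult_right scale.scale_scale)
  then show ?case by blast
next
  case (add a b)
  then show ?case by (auto simp: distrib_left distrib_right simp flip: scale.scale_left_distrib)
next
  show "\<exists>d. row_symm n (fst \<circ> T) * 0 * col_symm n (snd \<circ> T) = scale d (young n T)"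
    by (metis mult_zero_left mult_zero_right scale.scale_zero_left)
qed

lemma row_sym_alg_col_eq_zero:
  assumes "l \<in> partitions n" "m \<in> partitions n" "tab n l T" "tab n m V" "\<not> dominated l m" "a \<in> sym_alg n"
  shows "row_symm n (fst \<circ> T) * a * col_symm n (snd \<circ> V) = (0 :: 'k::field_char_0 perm_alg)"
proof (rule lin_eqI[where F = "\<lambda>a. row_symm n (fst \<circ> T) * a * col_symm n (snd \<circ> V)" and G = "\<lambda>a. 0", OF _ _ assms(6)])
  show "row_symm n (fst \<circ> T) * mon g * col_symm n (snd \<circ> V) = (0 :: 'k perm_alg)" if "g \<in> Sym n" for g
    using row_mon_col_nonzero_imp_dominated[OF assms(1-4) that, where 'k = 'k] assms(5) by blast
qed (intro lin_intros)+

text \<open>A permutation preserving the row and the column of every entry fixes every cell, so the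
  identity arises from the pair of trivial factors alone.\<close>

lemma coef_young_zero:
  assumes T: "tab n l T" shows "coef (young n T) 0 = (1 :: 'k::field_char_0)"
proof -
  have z: "x = 0" if "x \<in> stab n (fst \<circ> T)" "- x \<in> stab n (snd \<circ> T)" for x
  proof (rule fperm_eqI)
    fix i
    have x: "x \<in> Sym n" "x \<in> stab n (snd \<circ> T)" using that by (simp_all add: stab_Sym)
    show "app x i = app 0 i"
    proof (cases "i \<in> {1..n}")
      case True
      then have "T (app x i) = T i" using that x(2) by (auto simp: stab_def prod_eq_iff)
      then show ?thesis using tab_inj[OF T] True x(1) by (simp del: atLeastAtMost_iff)
    qed (simp add: Sym_app_out[OF x(1)] del: atLeastAtMost_iff)
  qed
  have "coef (young n T :: 'k perm_alg) 0 = (\<Sum>x\<in>Poly_Mapping.keys (row_symm n (fst \<circ> T) :: 'k perm_alg). if x = 0 then 1 else 0)"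
    unfolding young_def coef_mult_zero
  proof (rule sum.cong)
    fix x assume "x \<in> Poly_Mapping.keys (row_symm n (fst \<circ> T) :: 'k perm_alg)"
    then have x: "x \<in> stab n (fst \<circ> T)" by (simp add: in_keys_iff coef_symm split: if_splits)
    show "coef (row_symm n (fst \<circ> T)) x * coef (col_symm n (snd \<circ> T)) (- x) = (if x = 0 then 1 else 0 :: 'k)"
      using x z[OF x] multiplicative_zero[OF multiplicative_psign] by (auto simp: coef_symm)
  qed simp
  also have "\<dots> = 1" by (simp add: in_keys_iff coef_symm)
  finally show ?thesis .
qed

lemma young_nonzero: "tab n l T \<Longrightarrow> young n T \<noteq> (0 :: 'k::field_char_0 perm_alg)"
  using coef_young_zero[of n l T, where 'k = 'k] by auto

text \<open>The scalar is nonzero because \<open>a * star a\<close> has a positive coefficient at the identity for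
  every nonzero integral \<open>a\<close>; this is applied to \<open>\<rho>\<kappa>\<close> and then to \<open>\<rho>\<kappa>\<rho>\<close>.\<close>

lemma young_square:
  assumes l: "l \<in> partitions n" and T: "tab n l T"
  shows "\<exists>d. d \<noteq> 0 \<and> young n T * young n T = scale d (young n T :: 'k::field_char_0 perm_alg)"
proof -
  let ?r = "row_symm n (fst \<circ> T) :: 'k perm_alg" and ?c = "col_symm n (snd \<circ> T) :: 'k perm_alg"
  obtain d where d: "young n T * young n T = scale d (young n T :: 'k perm_alg)"
    using row_sym_alg_col_scale_young[OF l T, of "?c * ?r"] by (auto simp: young_def mult.assoc)
  have st: "star ?r = ?r" "star ?c = ?c"
    by (simp_all add: star_symm multiplicative_one multiplicative_psign)
  have "young n T * star (young n T) \<noteq> (0 :: 'k perm_alg)"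
    using young_nonzero[OF T] by (intro star_positive) (auto simp: young_def integral_mult symm_integral)
  moreover have "young n T * star (young n T) = ?r * (?c * ?c) * ?r"
    by (simp add: young_def star_mult st mult.assoc)
  moreover have "\<dots> = scale (of_nat (card (stab n (snd \<circ> T)))) (?r * ?c * ?r)"
    by (simp add: symm_square multiplicative_psign scale_mult_left scale_mult_right)
  ultimately have w: "?r * ?c * ?r \<noteq> 0" by auto
  have "?r * ?c * ?r * star (?r * ?c * ?r) \<noteq> 0"
    by (intro star_positive w) (auto simp: integral_mult symm_integral)
  moreover have "?r * ?c * ?r * star (?r * ?c * ?r) = ?r * ?c * (?r * ?r) * ?c * ?r"
    by (simp add: star_mult st mult.assoc)
  moreover have "\<dots> = scale (of_nat (card (stab n (fst \<circ> T)))) (?r * ?c * ?r * ?c * ?r)"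
    by (simp add: symm_square multiplicative_one scale_mult_left scale_mult_right)
  moreover have "?r * ?c * ?r * ?c * ?r = young n T * young n T * ?r"
    by (simp add: young_def mult.assoc)
  ultimately have "young n T * young n T \<noteq> (0 :: 'k perm_alg)" by auto
  then have "d \<noteq> 0" using d by (metis scale.scale_zero_left)
  then show ?thesis using d by blast
qed

text \<open>Suppose that the product of a row permutation \<open>r\<close> and a column permutation
  \<open>q\<close> fixes \<open>Suc n\<close>, and let \<open>m\<close> be the image of
  \<open>Suc n\<close> under \<open>q\<close>. Then \<open>m\<close> lies in the column of the new
  cell \<open>c\<close>, and in its row because \<open>r\<close> sends \<open>m\<close> back to
  \<open>Suc n\<close>. Hence \<open>m = Suc n\<close>, both factors fix \<open>Suc n\<close>, and
  what remains is the symmetrizer of the smaller tableau.\<close>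

lemma restrict_young:
  assumes c: "c \<notin> young_diagram l" and T: "tab n l T"
  shows "restrict_to (Sym n) (young (Suc n) (T(Suc n := c))) = (young n T :: 'k::comm_ring_1 perm_alg)"
proof -
  let ?T = "T(Suc n := c)"
  have sub: "stab n (p \<circ> T) = stab (Suc n) (p \<circ> ?T) \<inter> Sym n" for p :: "nat \<times> nat \<Rightarrow> nat"
  proof -
    have "(\<forall>i\<in>{1..n}. p (T (app g i)) = p (T i)) \<longleftrightarrow> (\<forall>i\<in>{1..Suc n}. p (?T (app g i)) = p (?T i))" if g: "g \<in> Sym n" for g
    proof -
      have "app g (Suc n) = Suc n" using Sym_app_out[OF g] by simp
      moreover have "app g i \<noteq> Suc n" if "i \<in> {1..n}" for i
        using that g Sym_app_in[of g n i] by auto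
      moreover have "{1..Suc n} = insert (Suc n) {1..n}" by auto
      ultimately show ?thesis by (auto simp del: atLeastAtMost_iff)
    qed
    moreover have "Sym n \<subseteq> Sym (Suc n)" by (rule Sym_mono) simp
    ultimately show ?thesis unfolding stab_def comp_def by blast
  qed
  have inS: "r \<in> Sym n" "q \<in> Sym n"
    if r: "r \<in> stab (Suc n) (fst \<circ> ?T)" and q: "q \<in> stab (Suc n) (snd \<circ> ?T)" and rq: "r + q \<in> Sym n" for r q
  proof -
    let ?m = "app q (Suc n)"
    have rm: "app r ?m = Suc n" using Sym_app_out[OF rq, of "Suc n"] by simp
    have m: "?m \<in> {1..Suc n}" using Sym_app_in[OF stab_Sym[OF q], of "Suc n"] by simp
    have "(fst \<circ> ?T) (app r ?m) = (fst \<circ> ?T) ?m" using r m unfolding stab_def by blast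
    then have "fst (?T ?m) = fst c" by (simp only: rm comp_apply fun_upd_same)
    moreover have "snd (?T ?m) = snd c" using q unfolding stab_def by auto
    ultimately have "?T ?m = c" by (simp add: prod_eq_iff)
    then have "?m = Suc n" using m c tab_in[OF T, of ?m] by (auto split: if_splits simp: le_Suc_eq)
    then have fx: "app q (Suc n) = Suc n" "app r (Suc n) = Suc n" using rm by auto
    then show "r \<in> Sym n" "q \<in> Sym n"
      using Sym_Suc_fixed stab_Sym[OF r] stab_Sym[OF q] by auto
  qed
  have "restrict_to (Sym n) (young (Suc n) ?T) = (\<Sum>r\<in>stab (Suc n) (fst \<circ> ?T). \<Sum>q\<in>stab (Suc n) (snd \<circ> ?T).
      restrict_to (Sym n) (Poly_Mapping.single (r + q) (of_int (psign q))) :: 'k perm_alg)"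
    by (simp add: young_def symm_def sum_product mult_single lin_sum[OF lin_restrict_to[OF lin_ident]])
  also have "\<dots> = (\<Sum>r\<in>stab (Suc n) (fst \<circ> ?T). \<Sum>q\<in>stab n (snd \<circ> T).
      restrict_to (Sym n) (Poly_Mapping.single (r + q) (of_int (psign q))))"
  proof (rule sum.cong[OF refl], rule sum.mono_neutral_right)
    fix r assume "r \<in> stab (Suc n) (fst \<circ> ?T)"
    then show "\<forall>q\<in>stab (Suc n) (snd \<circ> ?T) - stab n (snd \<circ> T).
        restrict_to (Sym n) (Poly_Mapping.single (r + q) (of_int (psign q))) = (0 :: 'k perm_alg)"
      using inS(2)[of r] unfolding sub by (simp del: fun_upd_apply comp_def) blast
  qed (simp_all add: sub)
  also have "\<dots> = (\<Sum>r\<in>stab n (fst \<circ> T). \<Sum>q\<in>stab n (snd \<circ> T).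
      restrict_to (Sym n) (Poly_Mapping.single (r + q) (of_int (psign q))))"
    by (rule sum.mono_neutral_right) (auto simp: sub Sym_add_iff_right intro!: sum.neutral)
  also have "\<dots> = young n T"
    unfolding young_def symm_def sum_product mult_single
    by (intro sum.cong refl) (simp add: stab_Sym)
  finally show ?thesis .
qed

section \<open>Young idempotents\<close>

text \<open>An arbitrary but fixed tableau, so that the idempotent below depends on the shape
  alone.\<close>

definition ptab :: "nat list \<Rightarrow> (nat \<Rightarrow> nat \<times> nat)" where
  "ptab l = (SOME T. tab (sum_list l) l T)"

text \<open>The scalar in the square of the Young symmetrizer; classically it is the product of the
  hook lengths.\<close>

definition young_scalar :: "'k itself \<Rightarrow> nat list \<Rightarrow> 'k::field_char_0" where
  "young_scalar _ l = (SOME d. d \<noteq> 0 \<and>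
     young (sum_list l) (ptab l) * young (sum_list l) (ptab l) = scale d (young (sum_list l) (ptab l) :: 'k perm_alg))"

definition idem :: "nat list \<Rightarrow> 'k::field_char_0 perm_alg" where
  "idem l = scale (inverse (young_scalar TYPE('k) l)) (young (sum_list l) (ptab l))"

lemma partitions_sum_list: "l \<in> partitions n \<Longrightarrow> sum_list l = n"
  by (simp add: partitions_def)

lemma tab_ptab: "l \<in> partitions n \<Longrightarrow> tab n l (ptab l)"
  unfolding ptab_def using tab_exists[of l n] by (simp add: partitions_sum_list) (metis someI_ex)

lemma young_scalar:
  assumes "l \<in> partitions n"
  shows "young_scalar TYPE('k::field_char_0) l \<noteq> 0"
    and "young n (ptab l) * young n (ptab l) = scale (young_scalar TYPE('k) l) (young n (ptab l) :: 'k perm_alg)"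
  using someI_ex[OF young_square[OF assms tab_ptab[OF assms], where 'k = 'k]] assms
  unfolding young_scalar_def by (simp_all add: partitions_sum_list)

lemma idem_young:
  assumes "l \<in> partitions n"
  obtains d :: "'k::field_char_0" where "d \<noteq> 0" "idem l = scale d (young n (ptab l))"
  using that[of "inverse (young_scalar TYPE('k) l)"] young_scalar(1)[OF assms, where 'k = 'k] assms
  by (simp add: idem_def partitions_sum_list)

lemma idem_sym_alg: "l \<in> partitions n \<Longrightarrow> idem l \<in> sym_alg n"
  by (auto simp: idem_def partitions_sum_list)

lemma idem_idem: "l \<in> partitions n \<Longrightarrow> idem l * idem l = (idem l :: 'k::field_char_0 perm_alg)"
  using young_scalar[of l n, where 'k = 'k]
  by (simp add: idem_def partitions_sum_list scale_mult_left scale_mult_right)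

lemma idem_nonzero: 
  assumes "l \<in> partitions n" shows "idem l \<noteq> (0 :: 'k::field_char_0 perm_alg)"
proof -
  obtain d where "d \<noteq> 0" "(idem l :: 'k perm_alg) = scale d (young n (ptab l))" by (rule idem_young[OF assms])
  then have "scale (inverse d) (idem l :: 'k perm_alg) = young n (ptab l)" by simp
  then show ?thesis using young_nonzero[OF tab_ptab[OF assms]] by (metis scale.scale_zero_right)
qed

lemma coef_idem_zero:
  assumes "l \<in> partitions n" shows "coef (idem l) 0 \<noteq> (0 :: 'k::field_char_0)"
proof -
  obtain d where "d \<noteq> 0" "(idem l :: 'k perm_alg) = scale d (young n (ptab l))" by (rule idem_young[OF assms])
  then show ?thesis using coef_young_zero[OF tab_ptab[OF assms], where 'k = 'k] by simp
qed

text \<open>Primitivity of the idempotent: between the outer row and column symmetrizers stands a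
  single element of \<open>sym_alg n\<close>, and such a sandwich is a multiple of the Young
  symmetrizer.\<close>

lemma idem_sym_alg_idem:
  assumes "l \<in> partitions n" "a \<in> sym_alg n"
  shows "\<exists>d. idem l * a * idem l = scale d (idem l :: 'k::field_char_0 perm_alg)"
proof -
  obtain c where c: "c \<noteq> 0" "(idem l :: 'k perm_alg) = scale c (young n (ptab l))" by (rule idem_young[OF assms(1)])
  let ?T = "ptab l"
  obtain d where d: "row_symm n (fst \<circ> ?T) * (col_symm n (snd \<circ> ?T) * a * row_symm n (fst \<circ> ?T)) * col_symm n (snd \<circ> ?T)
     = scale d (young n ?T :: 'k perm_alg)"
    using row_sym_alg_col_scale_young[OF assms(1) tab_ptab[OF assms(1)], of "col_symm n (snd \<circ> ?T) * a * row_symm n (fst \<circ> ?T)"] assms(2)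
    by auto
  have "idem l * a * idem l = scale (c * c) (young n ?T * a * young n ?T)"
    by (simp add: c(2) scale_mult_left scale_mult_right)
  also have "young n ?T * a * young n ?T = scale d (young n ?T)"
    using d by (simp add: young_def mult.assoc)
  also have "scale (c * c) (scale d (young n ?T)) = scale (c * d) (idem l)"
    by (simp add: c(2) mult.commute mult.left_commute)
  finally show ?thesis by blast
qed

lemma idem_sym_alg_idem_nonzero_imp_dominated:
  assumes "l \<in> partitions n" "m \<in> partitions n" "a \<in> sym_alg n" "idem l * a * idem m \<noteq> (0 :: 'k::field_char_0 perm_alg)"
  shows "dominated l m"
proof (rule ccontr)
  assume nd: "\<not> dominated l m"
  obtain c where c: "(idem l :: 'k perm_alg) = scale c (young n (ptab l))" by (rule idem_young[OF assms(1)])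
  obtain d where d: "(idem m :: 'k perm_alg) = scale d (young n (ptab m))" by (rule idem_young[OF assms(2)])
  have "row_symm n (fst \<circ> ptab l) * (col_symm n (snd \<circ> ptab l) * a * row_symm n (fst \<circ> ptab m)) * col_symm n (snd \<circ> ptab m) = (0 :: 'k perm_alg)"
    by (rule row_sym_alg_col_eq_zero[OF assms(1,2) tab_ptab[OF assms(1)] tab_ptab[OF assms(2)] nd]) (use assms(3) in auto)
  then have "young n (ptab l) * a * young n (ptab m) = 0" by (simp add: young_def mult.assoc)
  then show False using assms(4) by (simp add: c d scale_mult_left scale_mult_right)
qed

text \<open>The trace form pairs the elements of the shape \<open>idem l * a * idem m\<close> with
  those of the shape \<open>idem m * b * idem l\<close> without degeneration. The degrees of
  \<open>l\<close> and \<open>m\<close> may differ, as is the case for neighbouring shapes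
  later.\<close>

lemma idem_sym_alg_idem_swap:
  assumes "l \<in> partitions n" "m \<in> partitions n'" "n \<le> k" "n' \<le> k" "a \<in> sym_alg k"
    and "idem l * a * idem m \<noteq> (0 :: 'k::field_char_0 perm_alg)"
  obtains b where "b \<in> sym_alg k" "coef ((idem l * a * idem m) * (idem m * b * idem l)) 0 \<noteq> (0::'k)"
proof -
  have "idem l * a * idem m \<in> (sym_alg k :: ('k perm_alg) set)"
    using assms idem_sym_alg sym_alg_mono by blast
  then obtain b where b: "b \<in> sym_alg k" "coef ((idem l * a * idem m) * b) 0 \<noteq> (0::'k)"
    using trace_form_nondegenerate assms(6) by blast
  have "coef ((idem l * a * idem m) * (idem m * b * idem l)) 0 = coef (idem l * (idem l * a * (idem m * idem m) * b)) (0::fperm)"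
    by (subst (2) coef_mult_zero_commute) (simp only: mult.assoc)
  also have "\<dots> = coef ((idem l * idem l) * a * (idem m * idem m) * b) (0::fperm)" by (simp only: mult.assoc)
  also have "\<dots> = coef ((idem l * a * idem m) * b) (0::fperm)"
    by (simp only: idem_idem[OF assms(1)] idem_idem[OF assms(2)])
  finally show ?thesis using b that by metis
qed

text \<open>A nonzero element would give one in the opposite direction by the trace form, so
  \<open>l\<close> and \<open>m\<close> would dominate each other.\<close>

lemma idem_sym_alg_idem_eq_zero:
  assumes "l \<in> partitions n" "m \<in> partitions n" "l \<noteq> m" "a \<in> sym_alg n"
  shows "idem l * a * idem m = (0 :: 'k::field_char_0 perm_alg)"
proof (rule ccontr)
  assume nz: "idem l * a * idem m \<noteq> (0 :: 'k perm_alg)"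
  obtain b where b: "b \<in> sym_alg n" "coef ((idem l * a * idem m) * (idem m * b * idem l)) 0 \<noteq> (0::'k)"
    by (rule idem_sym_alg_idem_swap[OF assms(1,2) order.refl order.refl assms(4) nz])
  have "idem m * b * idem l \<noteq> (0 :: 'k perm_alg)" using b(2) by fastforce
  then show False
    using assms dominated_antisym idem_sym_alg_idem_nonzero_imp_dominated[OF assms(1,2,4) nz]
      idem_sym_alg_idem_nonzero_imp_dominated[OF assms(2,1) b(1)] by blast
qed

text \<open>Extend the tableau of \<open>l\<close> by the entry \<open>Suc n\<close> in the new
  cell. The symmetrizer of this tableau of shape \<open>m\<close>, multiplied on both sides by the
  symmetrizer \<open>y\<close> of \<open>l\<close>, is projected by \<open>restrict_to\<close> to
  the cube of \<open>y\<close>, which is not zero. Conjugation then replaces the extended tableau by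
  \<open>ptab m\<close>.\<close>

lemma idem_add_cell:
  assumes l: "l \<in> partitions n" and m: "m \<in> partitions (Suc n)"
    and c: "c \<notin> young_diagram l" "young_diagram m = insert c (young_diagram l)"
  shows "\<exists>a\<in>sym_alg (Suc n). idem l * a * idem m \<noteq> (0 :: 'k::field_char_0 perm_alg)"
proof -
  let ?T = "(ptab l)(Suc n := c)"
  have T: "tab n l (ptab l)" by (rule tab_ptab[OF l])
  have "tab (Suc n) m ?T"
  proof -
    have "bij_betw ?T {1..n} (young_diagram l)"
      using T unfolding tab_def by (rule bij_betw_cong[THEN iffD1, rotated]) auto
    then have "bij_betw ?T ({1..n} \<union> {Suc n}) (young_diagram l \<union> {c})"
      by (rule bij_betw_combine) (use c in \<open>auto simp: bij_betw_def\<close>)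
    moreover have "{1..n} \<union> {Suc n} = {1..Suc n}" by auto
    ultimately show ?thesis using c(2) by (simp add: tab_def)
  qed
  from tab_transition[OF tab_ptab[OF m] this]
  obtain g where g: "g \<in> Sym (Suc n)" "\<And>i. i \<in> {1..Suc n} \<Longrightarrow> ptab m (app g i) = ?T i" by metis
  have conj: "mon g * young (Suc n) ?T = young (Suc n) (ptab m) * (mon g :: 'k perm_alg)"
    by (rule young_conj[OF g(1)]) (simp only: g(2))
  have "mon (- g) * mon g = (1 :: 'k perm_alg)" by (simp add: mon_mult)
  then have conj': "young (Suc n) ?T = mon (- g) * young (Suc n) (ptab m) * (mon g :: 'k perm_alg)"
  proof -
    assume "mon (- g) * mon g = (1 :: 'k perm_alg)"
    then have "young (Suc n) ?T = mon (- g) * (mon g * young (Suc n) ?T :: 'k perm_alg)"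
      by (simp only: mult.assoc[symmetric] mult_1)
    then show ?thesis by (simp only: conj mult.assoc)
  qed
  let ?y = "young n (ptab l) :: 'k perm_alg"
  obtain d :: 'k where d: "d \<noteq> 0" "?y * ?y = scale d ?y" using young_square[OF l T] by blast
  have "restrict_to (Sym n) (?y * young (Suc n) ?T * ?y) = ?y * ?y * ?y"
    by (simp add: restrict_to_sym_alg_mult restrict_to_mult_sym_alg restrict_young[OF c(1) T] mult.assoc)
  also have "\<dots> = scale (d * d) ?y" by (simp add: d(2) scale_mult_left scale_mult_right)
  also have "\<dots> \<noteq> 0" using d young_nonzero[OF T, where 'k = 'k]
    by (simp add: scale_eq_0_iff)
  finally have "restrict_to (Sym n) (?y * young (Suc n) ?T * ?y) \<noteq> 0" .
  then have "?y * young (Suc n) ?T * ?y \<noteq> 0"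
    by (rule contrapos_nn) (simp only: lin_0[OF lin_restrict_to[OF lin_ident]])
  then have "?y * mon (- g) * young (Suc n) (ptab m) \<noteq> 0"
    by (rule contrapos_nn) (simp add: conj' flip: mult.assoc)
  moreover obtain c1 :: 'k where c1: "c1 \<noteq> 0" "idem l = scale c1 (young n (ptab l))" by (rule idem_young[OF l])
  moreover obtain c2 :: 'k where c2: "c2 \<noteq> 0" "idem m = scale c2 (young (Suc n) (ptab m))" by (rule idem_young[OF m])
  ultimately have "scale (inverse c1 * inverse c2) (idem l * mon (- g) * idem m) \<noteq> 0"
    by (simp add: scale_mult_left scale_mult_right mult.assoc scale_eq_0_iff)
  then show ?thesis using g(1) by (intro bexI[of _ "mon (- g)"]) auto
qed

section \<open>Adding and removing cells\<close>

definition adds :: "nat list \<Rightarrow> nat list set" where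
  "adds l = {m \<in> \<Union>(range partitions). \<exists>c. c \<notin> young_diagram l \<and> young_diagram m = insert c (young_diagram l)}"

definition rems :: "nat list \<Rightarrow> nat list set" where
  "rems l = {m \<in> \<Union>(range partitions). \<exists>c. c \<notin> young_diagram m \<and> young_diagram l = insert c (young_diagram m)}"

lemma add_remove_cell_eq: "add_remove_cell l = adds l \<union> rems l"
  by (auto simp: add_remove_cell_def adds_def rems_def)

lemma adds_partitions: "l \<in> partitions n \<Longrightarrow> m \<in> adds l \<Longrightarrow> m \<in> partitions (Suc n)"
  using card_young_diagram[of l] card_young_diagram[of m]
  by (auto simp: adds_def partitions_def)

lemma rems_partitions: "l \<in> partitions (Suc n) \<Longrightarrow> m \<in> rems l \<Longrightarrow> m \<in> partitions n"
  using card_young_diagram[of l] card_young_diagram[of m]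
  by (auto simp: rems_def partitions_def)

lemma rems_empty: "l \<in> partitions 0 \<Longrightarrow> rems l = {}"
  using card_young_diagram[of l] by (cases l) (auto simp: rems_def partitions_def young_diagram_def)

lemma adds_iff_rems: "l \<in> partitions n \<Longrightarrow> m \<in> partitions n' \<Longrightarrow> m \<in> adds l \<longleftrightarrow> l \<in> rems m"
  by (auto simp: adds_def rems_def)

lemma adds_rems_disjoint: "adds l \<inter> rems l = {}"
  by (auto simp: adds_def rems_def)

lemma finite_partitions: "finite (partitions n)"
proof (rule finite_subset)
  show "partitions n \<subseteq> {xs. set xs \<subseteq> {..n} \<and> length xs \<le> n}"
  proof
    fix l assume "l \<in> partitions n"
    then have l: "0 \<notin> set l" "sum_list l = n" by (auto simp: partitions_def)
    then have "set l \<subseteq> {..n}" using member_le_sum_list by fastforce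
    moreover have "length l \<le> sum_list l"
      using l(1) by (induction l) (auto simp: Suc_le_eq)
    ultimately show "l \<in> {xs. set xs \<subseteq> {..n} \<and> length xs \<le> n}" using l by simp
  qed
  show "finite {xs. set xs \<subseteq> {..n} \<and> length xs \<le> n}"
    by (rule finite_lists_length_le) simp
qed

lemma young_diagram_inj:
  "l \<in> partitions n \<Longrightarrow> m \<in> partitions n' \<Longrightarrow> young_diagram l = young_diagram m \<Longrightarrow> l = m"
  by (rule dominated_antisym[of l n m n']) (simp_all add: dominated_def)

lemma finite_adds: "l \<in> partitions n \<Longrightarrow> finite (adds l)"
  using finite_subset[OF _ finite_partitions[of "Suc n"], of "adds l"] adds_partitions by blast

lemma finite_rems: "finite (rems l)"
proof -
  have "m \<in> partitions (sum_list l - 1)" if "m \<in> rems l" for m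
    using that card_young_diagram[of l] card_young_diagram[of m] by (auto simp: rems_def partitions_def)
  then have "rems l \<subseteq> partitions (sum_list l - 1)" by blast
  then show ?thesis using finite_partitions finite_subset by blast
qed

section \<open>Addable and removable cells\<close>

definition incr :: "nat list \<Rightarrow> nat \<Rightarrow> nat list" where
  "incr l k = (if k < length l then l[k := Suc (l ! k)] else l @ [1])"

definition new_cell :: "nat list \<Rightarrow> nat \<Rightarrow> nat \<times> nat" where
  "new_cell l k = (k, if k < length l then l ! k else 0)"

lemma young_diagram_incr:
  "k \<le> length l \<Longrightarrow> young_diagram (incr l k) = insert (new_cell l k) (young_diagram l)"
  "new_cell l k \<notin> young_diagram l"
  by (auto simp: young_diagram_def incr_def new_cell_def nth_list_update nth_append less_Suc_eq split: if_splits)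

lemma incr_in_adds:
  assumes l: "l \<in> partitions n" and k: "k \<le> length l" "k < length l \<Longrightarrow> 0 < k \<Longrightarrow> l ! k < l ! (k - 1)"
  shows "incr l k \<in> adds l"
proof -
  have s: "l ! j \<le> l ! i" if "i < j" "j < length l" for i j
    using l that by (auto simp: partitions_def sorted_wrt_iff_nth_less)
  have p: "l ! i > 0" if "i < length l" for i
    using l nth_mem[OF that] by (cases "l ! i") (auto simp: partitions_def)
  have s': "l ! k < l ! i" if "i < k" "k < length l" for i
  proof -
    have "l ! (k - 1) \<le> l ! i" using that s[of i "k - 1"] by (cases "i = k - 1") auto
    then show ?thesis using k(2) that by force
  qed
  have "sorted_wrt (\<ge>) (incr l k)"
    unfolding sorted_wrt_iff_nth_less
  proof (intro allI impI)
    fix i j assume ij: "i < j" "j < length (incr l k)"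
    show "incr l k ! j \<le> incr l k ! i"
    proof (cases "k < length l")
      case True
      then show ?thesis using ij s[of i j] s'[of i] by (auto simp: incr_def nth_list_update)
    next
      case False
      then show ?thesis using ij s[of i j] p[of i] k(1) by (auto simp: incr_def nth_append)
    qed
  qed
  moreover have "0 \<notin> set (incr l k)"
    using l set_update_subset_insert[of l k "Suc (l ! k)"] by (auto simp: incr_def partitions_def)
  ultimately have "incr l k \<in> partitions (sum_list (incr l k))" by (simp add: partitions_def)
  then show ?thesis using young_diagram_incr(1)[OF k(1)] young_diagram_incr(2)[of l k] unfolding adds_def by blast
qed

text \<open>A right or lower neighbour of the removed cell in \<open>l\<close> would still belong to
  \<open>v\<close>, and then so would the removed cell, because \<open>v\<close> is a Young diagram.
  The cell is thus the end of a row that is longer than the next one.\<close>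

lemma rems_row:
  assumes l: "l \<in> partitions n" and v: "v \<in> rems l"
  obtains i where "i < length l" "young_diagram v = young_diagram l - {(i, l ! i - 1)}" "Suc i < length l \<Longrightarrow> l ! Suc i < l ! i"
proof -
  obtain n' i j where v: "v \<in> partitions n'" "(i, j) \<notin> young_diagram v" "young_diagram l = insert (i, j) (young_diagram v)"
    using v by (auto simp: rems_def)
  have "(i, Suc j) \<notin> young_diagram l" "(Suc i, j) \<notin> young_diagram l"
    using young_diagram_down[OF v(1), of i "Suc j" i j] young_diagram_down[OF v(1), of "Suc i" j i j] v(2,3) by auto
  moreover have "(i, j) \<in> young_diagram l" using v(3) by blast
  ultimately have i: "i < length l" "j = l ! i - 1" "Suc i < length l \<Longrightarrow> l ! Suc i < l ! i"
    by (auto simp: young_diagram_def)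
  moreover have "young_diagram v = young_diagram l - {(i, j)}" using v(2,3) by auto
  ultimately show ?thesis using that by blast
qed

text \<open>If a cell can be removed from row \<open>i\<close>, a cell can be added to row
  \<open>i + 1\<close>. The first row can always be extended, and this extension is not of the
  preceding kind.\<close>

lemma card_rems_less_card_adds:
  assumes l: "l \<in> partitions n"
  shows "card (rems l) < card (adds l)"
proof -
  have "\<forall>v\<in>rems l. \<exists>i. i < length l \<and> young_diagram v = young_diagram l - {(i, l ! i - 1)} \<and> (Suc i < length l \<longrightarrow> l ! Suc i < l ! i)"
    using rems_row[OF l] by metis
  then obtain r where r: "\<And>v. v \<in> rems l \<Longrightarrow> r v < length l"
     "\<And>v. v \<in> rems l \<Longrightarrow> young_diagram v = young_diagram l - {(r v, l ! r v - 1)}"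
     "\<And>v. v \<in> rems l \<Longrightarrow> Suc (r v) < length l \<Longrightarrow> l ! Suc (r v) < l ! r v"
    by metis
  define \<phi> where "\<phi> v = incr l (Suc (r v))" for v
  have cell: "k = k'" if "incr l k = incr l k'" "k \<le> length l" "k' \<le> length l" for k k'
  proof -
    have "new_cell l k = new_cell l k'"
      using young_diagram_incr(1)[of k l] young_diagram_incr(1)[of k' l] young_diagram_incr(2)[of l k] young_diagram_incr(2)[of l k'] that
      by auto
    then show ?thesis by (simp add: new_cell_def)
  qed
  have in_adds: "\<phi> v \<in> adds l" if "v \<in> rems l" for v
    unfolding \<phi>_def using r(1,3)[OF that] by (intro incr_in_adds[OF l]) auto
  have "inj_on \<phi> (rems l)"
  proof (rule inj_onI)
    fix v w assume vw: "v \<in> rems l" "w \<in> rems l" "\<phi> v = \<phi> w"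
    then have "r v = r w" using cell[of "Suc (r v)" "Suc (r w)"] r(1) by (simp add: \<phi>_def Suc_le_eq)
    then have "young_diagram v = young_diagram w" using r(2) vw by simp
    then show "v = w" using vw young_diagram_inj by (auto simp: rems_def)
  qed
  moreover have "incr l 0 \<notin> \<phi> ` rems l"
    using cell[of 0] r(1) by (fastforce simp: \<phi>_def Suc_le_eq)
  moreover have "incr l 0 \<in> adds l" by (rule incr_in_adds[OF l]) auto
  ultimately have "card (rems l) < card (insert (incr l 0) (\<phi> ` rems l))"
    by (simp add: card_image finite_rems)
  also have "\<dots> \<le> card (adds l)"
    using in_adds \<open>incr l 0 \<in> adds l\<close> by (intro card_mono finite_adds[OF l]) auto
  finally show ?thesis .
qed

section \<open>The branching rule in the group algebra\<close>

interpretation scale_vs: vector_space "scale :: 'k::field \<Rightarrow> ('b \<Rightarrow>\<^sub>0 'k) \<Rightarrow> _"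
  by unfold_locales (auto simp: scale.scale_right_distrib scale.scale_left_distrib)

text \<open>Take a nonzero \<open>x\<close> between the two idempotents and an element
  \<open>y\<close> in the opposite direction. By primitivity of \<open>idem m\<close> their product
  in one order is a multiple of \<open>idem m\<close>, and the choice of \<open>y\<close> by the
  trace form makes the multiple nonzero. In the other order the rescaled elements give an idempotent
  below \<open>idem l\<close> that is equivalent to \<open>idem m\<close>.\<close>

lemma link_exists:
  assumes l: "l \<in> partitions n" and m: "m \<in> adds l"
  shows "\<exists>x y. x \<in> sym_alg (Suc n) \<and> y \<in> sym_alg (Suc n) \<and> idem l * x = x \<and> x * idem m = x \<and>
    idem m * y = y \<and> y * idem l = y \<and> y * x = (idem m :: 'k::field_char_0 perm_alg)"
proof -
  have mp: "m \<in> partitions (Suc n)" using adds_partitions[OF l m] .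
  obtain c where c: "c \<notin> young_diagram l" "young_diagram m = insert c (young_diagram l)"
    using m by (auto simp: adds_def)
  obtain a :: "'k perm_alg" where a: "a \<in> sym_alg (Suc n)" "idem l * a * idem m \<noteq> 0"
    using idem_add_cell[OF l mp c] by blast
  obtain b :: "'k perm_alg" where b: "b \<in> sym_alg (Suc n)" "coef ((idem l * a * idem m) * (idem m * b * idem l)) 0 \<noteq> 0"
    by (rule idem_sym_alg_idem_swap[OF l mp _ _ a]) auto
  have il: "idem l \<in> (sym_alg (Suc n) :: ('k perm_alg) set)" using idem_sym_alg[OF l] sym_alg_mono[of _ n "Suc n"] by auto
  have im: "idem m \<in> (sym_alg (Suc n) :: ('k perm_alg) set)" using idem_sym_alg[OF mp] .
  let ?x = "idem l * a * idem m" and ?y = "idem m * b * idem l"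
  have lx: "idem l * ?x = ?x" "?x * idem m = ?x" "idem m * ?y = ?y" "?y * idem l = ?y"
    using idem_idem[OF l, where 'k = 'k] idem_idem[OF mp, where 'k = 'k] by (metis mult.assoc)+
  obtain d where d: "?y * ?x = scale d (idem m)"
  proof -
    have "?y * ?x = idem m * (b * idem l * idem l * a) * idem m" by (simp only: mult.assoc)
    moreover have "b * idem l * idem l * a \<in> sym_alg (Suc n)" using a(1) b(1) il by blast
    ultimately show ?thesis using that idem_sym_alg_idem[OF mp] by metis
  qed
  \<comment> \<open>The trace of \<open>?y * ?x\<close> is that of \<open>?x * ?y\<close>, which is
    nonzero by the choice of \<open>b\<close>.\<close>
  have "d \<noteq> 0"
  proof
    assume "d = 0"
    then have "coef (?x * ?y) 0 = 0" by (subst coef_mult_zero_commute) (simp add: d)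
    then show False using b(2) by simp
  qed
  let ?y' = "scale (inverse d) ?y"
  have "?y' * ?x = idem m" using \<open>d \<noteq> 0\<close> by (simp add: scale_mult_left d)
  moreover have "idem m * ?y' = ?y'" "?y' * idem l = ?y'"
    using lx by (simp_all add: scale_mult_left scale_mult_right)
  moreover have "?x \<in> sym_alg (Suc n)" "?y' \<in> sym_alg (Suc n)" using a(1) b(1) il im by blast+
  ultimately show ?thesis using lx by blast
qed

definition link :: "nat list \<Rightarrow> nat list \<Rightarrow> 'k::field_char_0 perm_alg \<times> 'k perm_alg" where
  "link l m = (SOME p. fst p \<in> sym_alg (Suc (sum_list l)) \<and> snd p \<in> sym_alg (Suc (sum_list l)) \<and>
    idem l * fst p = fst p \<and> fst p * idem m = fst p \<and> idem m * snd p = snd p \<and>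
    snd p * idem l = snd p \<and> snd p * fst p = idem m)"

text \<open>Left multiplication by \<open>up l m\<close> embeds the right ideal of
  \<open>idem m\<close> into that of \<open>idem l\<close>, and left multiplication by
  \<open>dn l m\<close> is a projection back onto it.\<close>

definition up :: "nat list \<Rightarrow> nat list \<Rightarrow> 'k::field_char_0 perm_alg" where "up l m = fst (link l m)"
definition dn :: "nat list \<Rightarrow> nat list \<Rightarrow> 'k::field_char_0 perm_alg" where "dn l m = snd (link l m)"

context
  fixes n l m
  assumes l: "l \<in> partitions n" and m: "m \<in> adds l"
begin

lemma up_sym_alg: "(up l m :: 'k::field_char_0 perm_alg) \<in> sym_alg (Suc n)"
  and dn_sym_alg: "(dn l m :: 'k::field_char_0 perm_alg) \<in> sym_alg (Suc n)"
  and idem_up: "idem l * up l m = (up l m :: 'k::field_char_0 perm_alg)"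
  and up_idem: "up l m * idem m = (up l m :: 'k::field_char_0 perm_alg)"
  and idem_dn: "idem m * dn l m = (dn l m :: 'k::field_char_0 perm_alg)"
  and dn_idem: "dn l m * idem l = (dn l m :: 'k::field_char_0 perm_alg)"
  and dn_up: "dn l m * up l m = (idem m :: 'k::field_char_0 perm_alg)"
proof -
  let ?P = "\<lambda>p :: 'k perm_alg \<times> ('k perm_alg). fst p \<in> sym_alg (Suc (sum_list l)) \<and> snd p \<in> sym_alg (Suc (sum_list l)) \<and>
    idem l * fst p = fst p \<and> fst p * idem m = fst p \<and> idem m * snd p = snd p \<and>
    snd p * idem l = snd p \<and> snd p * fst p = idem m"
  have "Ex ?P" using link_exists[OF l m, where 'k = 'k] partitions_sum_list[OF l] by simp
  then have "?P (link l m)" unfolding link_def by (rule someI_ex)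
  then show "(up l m :: 'k perm_alg) \<in> sym_alg (Suc n)" "(dn l m :: 'k perm_alg) \<in> sym_alg (Suc n)"
    "idem l * up l m = (up l m :: 'k perm_alg)" "up l m * idem m = (up l m :: 'k perm_alg)"
    "idem m * dn l m = (dn l m :: 'k perm_alg)" "dn l m * idem l = (dn l m :: 'k perm_alg)"
    "dn l m * up l m = (idem m :: 'k perm_alg)"
    using partitions_sum_list[OF l] by (simp_all add: up_def dn_def)
qed

end

lemma dn_mult_up_eq_zero:
  assumes l: "l \<in> partitions n" "m \<in> adds l" and l': "l' \<in> partitions n" "m' \<in> adds l'" and "m \<noteq> m'" and a: "a \<in> sym_alg (Suc n)"
  shows "dn l m * a * up l' m' = (0 :: 'k::field_char_0 perm_alg)"
proof -
  have "dn l m * a * up l' m' = idem m * (dn l m * a * up l' m') * (idem m' :: 'k perm_alg)"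
    unfolding mult.assoc up_idem[OF l'] unfolding mult.assoc[symmetric] idem_dn[OF l] by (rule refl)
  also have "\<dots> = 0"
    using adds_partitions[OF l] adds_partitions[OF l'] assms dn_sym_alg[OF l] up_sym_alg[OF l'] by (intro idem_sym_alg_idem_eq_zero) auto
  finally show ?thesis .
qed

text \<open>The induction rule at the level of idempotents: it splits the right ideal of
  \<open>idem l\<close> in \<open>sym_alg (Suc n)\<close> into copies of those of the
  \<open>idem m\<close>.\<close>

definition ind_rule :: "'k::field_char_0 itself \<Rightarrow> nat \<Rightarrow> bool" where
  "ind_rule _ n \<longleftrightarrow> (\<forall>l\<in>partitions n. idem l = (\<Sum>m\<in>adds l. up l m * dn l m :: 'k perm_alg))"

text \<open>The two-sided ideal of \<open>sym_alg n\<close> generated by the Young idempotents. That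
  it contains \<open>1\<close> means that no nonzero module is annihilated by all of them, that is,
  that the list of Specht modules is complete.\<close>

definition idem_ideal :: "nat \<Rightarrow> ('k::field_char_0 perm_alg) set" where
  "idem_ideal n = scale.span {a * idem l * b | a l b. a \<in> sym_alg n \<and> b \<in> sym_alg n \<and> l \<in> partitions n}"

lemma lin_idem_ideal:
  assumes "lin F" "x \<in> idem_ideal n"
    and "\<And>a l b. a \<in> sym_alg n \<Longrightarrow> b \<in> sym_alg n \<Longrightarrow> l \<in> partitions n \<Longrightarrow> F (a * idem l * b) \<in> scale.span S"
  shows "F x \<in> scale.span S"
  using assms(2) unfolding idem_ideal_def
proof (induction rule: scale.span_induct_alt)
  case base
  show ?case by (simp add: lin_0[OF assms(1)] scale.span_zero)
next
  case (step c x y)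
  then show ?case using assms(3)
    by (auto simp: lin_add[OF assms(1)] lin_scale[OF assms(1)] intro!: scale.span_add scale.span_scale)
qed

text \<open>The induction rule rewrites each generator of degree \<open>n\<close> as a sum of
  elements \<open>(a * up l m) * idem m * (dn l m * b)\<close>, which are generators of degree
  \<open>Suc n\<close>.\<close>

lemma idem_ideal_step:
  assumes ind: "ind_rule TYPE('k::field_char_0) n" and one: "(1 :: 'k perm_alg) \<in> idem_ideal n"
  shows "(1 :: 'k perm_alg) \<in> idem_ideal (Suc n)"
  unfolding idem_ideal_def
proof (rule lin_idem_ideal[OF lin_ident one])
  fix a b :: "'k perm_alg" and l assume a: "a \<in> sym_alg n" "b \<in> sym_alg n" and l: "l \<in> partitions n"
  have "a * idem l * b = a * (\<Sum>m\<in>adds l. up l m * dn l m) * b"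
    using ind l by (simp add: ind_rule_def)
  also have "\<dots> = (\<Sum>m\<in>adds l. a * (up l m * dn l m) * b)"
    by (simp add: sum_distrib_left sum_distrib_right)
  also have "\<dots> = (\<Sum>m\<in>adds l. (a * up l m) * idem m * (dn l m * b))"
  proof (rule sum.cong[OF refl])
    fix m assume "m \<in> adds l"
    then show "a * (up l m * dn l m) * b = (a * up l m) * idem m * (dn l m * b)"
      using up_idem[OF l, of m, where 'k = 'k] by (simp add: mult.assoc)
  qed
  also have "\<dots> \<in> scale.span {a * idem l * b | a l b. a \<in> sym_alg (Suc n) \<and> b \<in> sym_alg (Suc n) \<and> l \<in> partitions (Suc n)}"
  proof (intro scale.span_sum scale.span_base)
    fix m assume m: "m \<in> adds l"
    then have "a * up l m \<in> sym_alg (Suc n)" "dn l m * b \<in> sym_alg (Suc n)"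
      using a sym_alg_mono[of _ n "Suc n"] up_sym_alg[OF l m] dn_sym_alg[OF l m] by (auto intro!: sym_alg_mult)
    then show "a * up l m * idem m * (dn l m * b) \<in> {a * idem l * b | a l b. a \<in> sym_alg (Suc n) \<and> b \<in> sym_alg (Suc n) \<and> l \<in> partitions (Suc n)}"
      using adds_partitions[OF l m] by blast
  qed
  finally show "a * idem l * b \<in> scale.span {a * idem l * b | a l b. a \<in> sym_alg (Suc n) \<and> b \<in> sym_alg (Suc n) \<and> l \<in> partitions (Suc n)}" .
qed

section \<open>The restriction rule and the corner algebra of an idempotent\<close>

lemma span_dn_sum:
  fixes f :: "'i \<Rightarrow> 'k::comm_ring_1 perm_alg"
  assumes "z \<in> scale.span {f v * b | v b. v \<in> I \<and> b \<in> sym_alg n}" "finite I"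
  shows "\<exists>b. (\<forall>v. b v \<in> sym_alg n) \<and> z = (\<Sum>v\<in>I. f v * b v)"
  using assms(1)
proof (induction rule: scale.span_induct_alt)
  case base
  show ?case by (rule exI[of _ "\<lambda>_. 0"]) simp
next
  case (step c x y)
  obtain v b where x: "x = f v * b" "v \<in> I" "b \<in> sym_alg n" using step(1) by blast
  obtain b' where b': "\<forall>v. b' v \<in> sym_alg n" "y = (\<Sum>v\<in>I. f v * b' v)" using step(2) by blast
  have "scale c x + y = (\<Sum>w\<in>I. f w * ((if w = v then scale c b else 0) + b' w))"
    using x(2) assms(2) by (simp add: x(1) b'(2) distrib_left sum.distrib scale_mult_right if_distrib[of "(*) _"] cong: if_cong)
  then show ?case using x(3) b'(1) by (intro exI[of _ "\<lambda>w. (if w = v then scale c b else 0) + b' w"]) auto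
qed

lemma span_up_sum:
  fixes f :: "'i \<Rightarrow> 'k::comm_ring_1 perm_alg"
  assumes "z \<in> scale.span {b * f v | v b. v \<in> I \<and> b \<in> sym_alg n}" "finite I"
  shows "\<exists>b. (\<forall>v. b v \<in> sym_alg n) \<and> z = (\<Sum>v\<in>I. b v * f v)"
  using assms(1)
proof (induction rule: scale.span_induct_alt)
  case base
  show ?case by (rule exI[of _ "\<lambda>_. 0"]) simp
next
  case (step c x y)
  obtain v b where x: "x = b * f v" "v \<in> I" "b \<in> sym_alg n" using step(1) by blast
  obtain b' where b': "\<forall>v. b' v \<in> sym_alg n" "y = (\<Sum>v\<in>I. b' v * f v)" using step(2) by blast
  have "scale c x + y = (\<Sum>w\<in>I. ((if w = v then scale c b else 0) + b' w) * f w)"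
    using x(2) assms(2) by (simp add: x(1) b'(2) distrib_right sum.distrib scale_mult_left if_distrib[of "\<lambda>x. x * _"] cong: if_cong)
  then show ?case using x(3) b'(1) by (intro exI[of _ "\<lambda>w. (if w = v then scale c b else 0) + b' w"]) auto
qed

text \<open>Restriction follows from induction by reciprocity. Write \<open>1\<close> through the
  idempotents \<open>idem v\<close> of degree \<open>n\<close> and expand these by the induction
  rule. In front of \<open>dn v m\<close> stands an element between \<open>idem l\<close> and
  \<open>idem m\<close>, which is zero unless \<open>m = l\<close> and otherwise a multiple of
  \<open>idem l\<close>; so multiples of \<open>dn v l * b\<close> with
  \<open>v \<in> rems l\<close> remain.\<close>

lemma res_rule_right:
  assumes ind: "ind_rule TYPE('k::field_char_0) n" and one: "(1 :: 'k perm_alg) \<in> idem_ideal n"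
    and l: "l \<in> partitions (Suc n)" and c: "c \<in> sym_alg (Suc n)"
  shows "\<exists>b. (\<forall>v. b v \<in> sym_alg n) \<and> idem l * c = (\<Sum>v\<in>rems l. dn v l * b v :: 'k perm_alg)"
proof (rule span_dn_sum[OF _ finite_rems])
  have "idem l * c * 1 \<in> scale.span {dn v l * b | v b :: 'k perm_alg. v \<in> rems l \<and> b \<in> sym_alg n}" (is "_ \<in> ?S")
  proof (rule lin_idem_ideal[OF _ one, where F = "\<lambda>x. idem l * c * x"])
    fix a b :: "'k perm_alg" and v assume a: "a \<in> sym_alg n" "b \<in> sym_alg n" and v: "v \<in> partitions n"
    have "idem l * c * (a * idem v * b) = idem l * c * a * (\<Sum>m\<in>adds v. up v m * dn v m) * b"
      using ind v by (simp add: ind_rule_def mult.assoc)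
    also have "\<dots> = (\<Sum>m\<in>adds v. (idem l * (c * a * up v m)) * dn v m * b)"
      by (simp add: sum_distrib_left sum_distrib_right mult.assoc)
    also have "\<dots> \<in> ?S"
    proof (rule scale.span_sum)
      fix m assume m: "m \<in> adds v"
      have caup: "c * a * up v m \<in> sym_alg (Suc n)" using a(1) c up_sym_alg[OF v m] sym_alg_mono[of a n "Suc n"] by auto
      have "idem l * (c * a * up v m) = idem l * (c * a * up v m) * idem m"
        by (simp add: mult.assoc up_idem[OF v m])
      moreover have "\<dots> * dn v m * b \<in> ?S"
      proof (cases "m = l")
        case True
        obtain d where "idem l * (c * a * up v m) * idem m = scale d (idem l)"
          using idem_sym_alg_idem[OF l caup] True by blast
        moreover have "scale d (idem l) * dn v m * b = scale d (dn v l * b)"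
          using idem_dn[OF v m, where 'k = 'k] True by (simp add: scale_mult_left)
        moreover have "v \<in> rems l" using m True adds_iff_rems[OF v l] by simp
        ultimately show ?thesis using a(2) by (simp only:) (intro scale.span_scale scale.span_base, blast)
      next
        case False
        then show ?thesis
          using idem_sym_alg_idem_eq_zero[OF l adds_partitions[OF v m] _ caup] by (auto simp: scale.span_zero)
      qed
      ultimately show "idem l * (c * a * up v m) * dn v m * b \<in> ?S" by simp
    qed
    finally show "idem l * c * (a * idem v * b) \<in> ?S" .
  qed (intro lin_intros)
  then show "idem l * c \<in> ?S" by simp
qed

text \<open>The mirror image of the preceding rule, in which \<open>up v l\<close> takes the place
  of \<open>dn v l\<close> because the idempotent now stands on the right.\<close>

lemma res_rule_left:
  assumes ind: "ind_rule TYPE('k::field_char_0) n" and one: "(1 :: 'k perm_alg) \<in> idem_ideal n"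
    and l: "l \<in> partitions (Suc n)" and c: "c \<in> sym_alg (Suc n)"
  shows "\<exists>b. (\<forall>v. b v \<in> sym_alg n) \<and> c * idem l = (\<Sum>v\<in>rems l. b v * up v l :: 'k perm_alg)"
proof (rule span_up_sum[OF _ finite_rems])
  have "1 * (c * idem l) \<in> scale.span {b * up v l | v b :: 'k perm_alg. v \<in> rems l \<and> b \<in> sym_alg n}" (is "_ \<in> ?S")
  proof (rule lin_idem_ideal[OF _ one, where F = "\<lambda>x. x * (c * idem l)"])
    fix a b :: "'k perm_alg" and v assume a: "a \<in> sym_alg n" "b \<in> sym_alg n" and v: "v \<in> partitions n"
    have "a * idem v * b * (c * idem l) = a * (\<Sum>m\<in>adds v. up v m * dn v m) * b * (c * idem l)"
      using ind v by (simp add: ind_rule_def mult.assoc)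
    also have "\<dots> = (\<Sum>m\<in>adds v. a * up v m * (dn v m * b * c * idem l))"
      by (simp add: sum_distrib_left sum_distrib_right mult.assoc)
    also have "\<dots> \<in> ?S"
    proof (rule scale.span_sum)
      fix m assume m: "m \<in> adds v"
      have dnbc: "dn v m * b * c \<in> sym_alg (Suc n)" using a(2) c dn_sym_alg[OF v m] sym_alg_mono[of b n "Suc n"] by auto
      have "dn v m * b * c * idem l = idem m * (dn v m * b * c) * idem l"
        by (simp add: idem_dn[OF v m] flip: mult.assoc)
      moreover have "a * up v m * (idem m * (dn v m * b * c) * idem l) \<in> ?S"
      proof (cases "m = l")
        case True
        obtain d where "idem m * (dn v m * b * c) * idem l = scale d (idem l)"
          using idem_sym_alg_idem[OF l dnbc] True by blast
        moreover have "a * up v m * scale d (idem l) = scale d (a * up v l)"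
          using up_idem[OF v m, where 'k = 'k] True by (simp add: scale_mult_right mult.assoc)
        moreover have "v \<in> rems l" using m True adds_iff_rems[OF v l] by simp
        ultimately show ?thesis using a(1) by (simp only:) (intro scale.span_scale scale.span_base, blast)
      next
        case False
        then show ?thesis
          using idem_sym_alg_idem_eq_zero[OF adds_partitions[OF v m] l _ dnbc] by (auto simp: scale.span_zero)
      qed
      ultimately show "a * up v m * (dn v m * b * c * idem l) \<in> ?S" by simp
    qed
    finally show "a * idem v * b * (c * idem l) \<in> ?S" .
  qed (intro lin_intros)
  then show "c * idem l \<in> ?S" by simp
qed

text \<open>Two double cosets: if \<open>g\<close> sends the last point to another point
  \<open>j\<close>, let \<open>h\<close> exchange \<open>j\<close> with the last point but one. Then
  \<open>h + s\<close> also sends the last point to \<open>j\<close>, so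
  \<open>k = - (h + s) + g\<close> fixes the last point.\<close>

lemma Sym_Suc_decomposition:
  assumes g: "g \<in> Sym (Suc (Suc n))" "g \<notin> Sym (Suc n)"
  defines "s \<equiv> Fperm (transpose (Suc n) (Suc (Suc n)))"
  obtains h k where "h \<in> Sym (Suc n)" "k \<in> Sym (Suc n)" "g = h + s + k"
proof -
  let ?N = "Suc n"
  have ap: "app (Fperm (transpose a b)) = transpose a b" if "a \<in> {1..Suc ?N}" "b \<in> {1..Suc ?N}" for a b :: nat
    using app_Fperm[OF permutes_swap_id[OF that]] by simp
  let ?j = "app g (Suc ?N)"
  have j: "?j \<in> {1..Suc ?N}" using Sym_app_in[OF g(1), of "Suc ?N"] by simp
  have "?j \<noteq> Suc ?N" using Sym_Suc_fixed[OF g(1)] g(2) by blast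
  then have j': "?j \<in> {1..?N}" using j by auto
  define h where "h = Fperm (transpose ?j ?N)"
  have h: "h \<in> Sym ?N" unfolding h_def using j' by (intro Sym_Fperm permutes_swap_id) auto
  have s: "s \<in> Sym (Suc ?N)" unfolding s_def by (intro Sym_Fperm permutes_swap_id) auto
  have ah: "app h = transpose ?j ?N" unfolding h_def using j' by (intro ap) auto
  have as: "app s = transpose ?N (Suc ?N)" unfolding s_def by (intro ap) auto
  define k where "k = - (h + s) + g"
  have "app (h + s) (Suc ?N) = ?j" by (simp add: ah as)
  then have "app (- (h + s)) ?j = Suc ?N" by (metis app_uminus_app)
  then have "app k (Suc ?N) = Suc ?N" by (simp add: k_def)
  moreover have "h \<in> Sym (Suc ?N)" using h Sym_mono[of ?N "Suc ?N"] by auto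
  then have "k \<in> Sym (Suc ?N)" unfolding k_def using s g by (intro Sym_add Sym_uminus)
  ultimately have "k \<in> Sym ?N" using Sym_Suc_fixed by blast
  moreover have "g = h + s + k" unfolding k_def by (simp only: add.assoc[symmetric] add.right_inverse add.left_neutral)
  ultimately show ?thesis using that h by blast
qed

text \<open>A permutation in \<open>Sym n\<close> contributes a multiple of \<open>idem l\<close>.
  Any other one is \<open>h + s + k\<close>; the two restriction rules turn
  \<open>idem l * mon h\<close> and \<open>mon k * idem l\<close> into sums with factors
  \<open>dn v l\<close> and \<open>up w l\<close>. Since \<open>s\<close> commutes with what lies
  between them in degree \<open>n - 1\<close>, a factor between \<open>idem v\<close> and
  \<open>idem w\<close> forms, leaving one element \<open>dn v l * s * up v l\<close> for each
  removable cell.\<close>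

lemma idem_corner_span:
  assumes ind: "n > 0 \<Longrightarrow> ind_rule TYPE('k::field_char_0) (n - 1)" and one: "n > 0 \<Longrightarrow> (1 :: 'k perm_alg) \<in> idem_ideal (n - 1)"
    and l: "l \<in> partitions n"
  shows "\<exists>F. finite F \<and> card F \<le> Suc (card (rems l)) \<and>
    (\<forall>a\<in>sym_alg (Suc n). idem l * a * idem l \<in> scale.span (F :: ('k perm_alg) set))"
proof (cases n)
  case 0
  \<comment> \<open>There is no smaller degree to restrict to, but the group on one point is trivial
    and \<open>idem l\<close> alone spans the corner.\<close>
  have "Sym (Suc 0) = {0}"
  proof -
    have "g = 0" if "g \<in> Sym (Suc 0)" for g
    proof (rule fperm_eqI)
      fix i show "app g i = app 0 i"
        using Sym_app_in[OF that, of 1] Sym_app_out[OF that, of i] by (cases "i = 1") auto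
    qed
    then show ?thesis by auto
  qed
  then have A: "sym_alg (Suc 0) = (free_on {0} :: ('k perm_alg) set)" by simp
  have "idem l * a * idem l \<in> scale.span {idem l}" if "a \<in> free_on {0}" for a :: "'k perm_alg"
    using that
  proof (induction rule: free_on_induct)
    case (scaled g c)
    then have "idem l * scale c (mon g) * idem l = scale c (idem l :: 'k perm_alg)"
      by (simp only: scale_mult_left scale_mult_right) (simp add: idem_idem[OF l])
    then show ?case by (simp only: scale.span_scale scale.span_base insertI1)
  qed (auto simp: distrib_left distrib_right intro: scale.span_add scale.span_zero)
  then show ?thesis using 0 A by (intro exI[of _ "{idem l}"]) auto
next
  case (Suc n')
  let ?s = "mon (Fperm (transpose (Suc n') (Suc (Suc n')))) :: 'k perm_alg"
  have ind': "ind_rule TYPE('k) n'" and one': "(1 :: 'k perm_alg) \<in> idem_ideal n'" using ind one Suc by auto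
  have l': "l \<in> partitions (Suc n')" using l Suc by simp
  let ?F = "insert (idem l) ((\<lambda>v. dn v l * ?s * up v l) ` rems l)"
  have commute: "?s * b = b * ?s" if "b \<in> sym_alg n'" for b
  proof (rule lin_eqI[where F = "\<lambda>b. ?s * b" and G = "\<lambda>b. b * ?s", OF _ _ that])
    fix g assume g: "g \<in> Sym n'"
    have "Fperm (transpose (Suc n') (Suc (Suc n'))) + g = g + Fperm (transpose (Suc n') (Suc (Suc n')))"
    proof (rule fperm_eqI)
      fix i
      have a: "app (Fperm (transpose (Suc n') (Suc (Suc n')))) = transpose (Suc n') (Suc (Suc n'))"
        by (rule app_Fperm[OF permutes_swap_id[of _ "{Suc n', Suc (Suc n')}"]]) auto
      have o: "app g (Suc n') = Suc n'" "app g (Suc (Suc n')) = Suc (Suc n')" using Sym_app_out[OF g] by auto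
      have "app g i \<noteq> Suc n'" "app g i \<noteq> Suc (Suc n')" if "i \<noteq> Suc n'" "i \<noteq> Suc (Suc n')"
        using that o by (metis app_inject_iff)+
      then show "app (Fperm (transpose (Suc n') (Suc (Suc n'))) + g) i = app (g + Fperm (transpose (Suc n') (Suc (Suc n')))) i"
        using o by (simp add: a transpose_def)
    qed
    then show "?s * mon g = mon g * ?s" by (simp add: mon_mult)
  qed (intro lin_intros)+
  have rp: "v \<in> partitions n'" "l \<in> adds v" if "v \<in> rems l" for v
    using that rems_partitions[OF l'] adds_iff_rems[OF _ l'] by auto
  have "idem l * a * idem l \<in> scale.span ?F" if "a \<in> sym_alg (Suc n)" for a
    using that
  proof (induction rule: free_on_induct)
    case (scaled g c)
    have "idem l * mon g * idem l \<in> scale.span ?F"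
    proof (cases "g \<in> Sym n")
      case True
      then obtain d where "idem l * mon g * idem l = scale d (idem l :: 'k perm_alg)"
        using idem_sym_alg_idem[OF l, of "mon g"] by auto
      then show ?thesis by (simp add: scale.span_scale scale.span_base)
    next
      case False
      obtain h k where hk: "h \<in> Sym (Suc n')" "k \<in> Sym (Suc n')" "g = h + Fperm (transpose (Suc n') (Suc (Suc n'))) + k"
        using Sym_Suc_decomposition[of g n'] scaled False Suc by metis
      obtain b where b: "\<forall>v. b v \<in> sym_alg n'" "idem l * mon h = (\<Sum>v\<in>rems l. dn v l * b v :: 'k perm_alg)"
        using res_rule_right[OF ind' one' l', of "mon h"] hk(1) by auto
      obtain b' where b': "\<forall>v. b' v \<in> sym_alg n'" "mon k * idem l = (\<Sum>v\<in>rems l. b' v * up v l :: 'k perm_alg)"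
        using res_rule_left[OF ind' one' l', of "mon k"] hk(2) by auto
      have "idem l * mon g * idem l = (idem l * mon h) * ?s * (mon k * (idem l :: 'k perm_alg))"
        by (simp only: hk(3) mult.assoc mon_mult[symmetric])
      also have "\<dots> = (\<Sum>v\<in>rems l. \<Sum>w\<in>rems l. dn v l * b v * ?s * (b' w * up w l))"
        unfolding b(2) b'(2) by (simp only: sum_distrib_right[of _ _ ?s] sum_product)
      also have "\<dots> \<in> scale.span ?F"
      proof (intro scale.span_sum)
        fix v w assume v: "v \<in> rems l" and w: "w \<in> rems l"
        have vp: "v \<in> partitions n'" "l \<in> adds v" and wp: "w \<in> partitions n'" "l \<in> adds w" using rp v w by auto
        have "dn v l * b v * ?s * (b' w * up w l) = dn v l * idem v * b v * (?s * (b' w * idem w)) * up w l"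
          using dn_idem[OF vp, where 'k = 'k] idem_up[OF wp, where 'k = 'k] by (simp add: mult.assoc)
        \<comment> \<open>The factor \<open>b' w * idem w\<close> lies in \<open>sym_alg n'\<close>,
          whose permutations fix both points exchanged by the transposition.\<close>
        also have "?s * (b' w * idem w) = (b' w * idem w) * ?s"
          using b'(1) idem_sym_alg[OF wp(1)] by (intro commute) auto
        also have "dn v l * idem v * b v * (b' w * idem w * ?s) * up w l = dn v l * (idem v * (b v * b' w) * idem w) * ?s * up w l"
          by (simp only: mult.assoc)
        also have "\<dots> \<in> scale.span ?F"
        proof (cases "v = w")
          case True
          obtain d where "idem v * (b v * b' w) * idem w = scale d (idem v)"
            using idem_sym_alg_idem[OF vp(1), of "b v * b' w"] b(1) b'(1) True by blast
          moreover have "dn v l * scale d (idem v) * ?s * up w l = scale d (dn v l * ?s * up v l)"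
            using True dn_idem[OF vp, where 'k = 'k] by (simp add: scale_mult_left scale_mult_right)
          ultimately show ?thesis using v by (simp add: scale.span_scale scale.span_base)
        next
          case False
          then have "idem v * (b v * b' w) * idem w = 0"
            using b(1) b'(1) by (intro idem_sym_alg_idem_eq_zero[OF vp(1) wp(1)]) auto
          then show ?thesis by (simp add: scale.span_zero)
        qed
        finally show "dn v l * b v * ?s * (b' w * up w l) \<in> scale.span ?F" .
      qed
      finally show ?thesis .
    qed
    then show ?case by (simp only: scale_mult_left scale_mult_right scale.span_scale)
  qed (auto simp: distrib_left distrib_right intro: scale.span_add scale.span_zero)
  moreover have "card ?F \<le> Suc (card (rems l))"
    using card_image_le[OF finite_rems, of "\<lambda>v. dn v l * ?s * up v l" l]
    by (simp add: card_insert_if finite_rems)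
  ultimately show ?thesis by (intro exI[of _ ?F]) (simp add: finite_rems)
qed

text \<open>The elements \<open>E m\<close> are nonzero orthogonal idempotents, hence linearly
  independent, and there are at least as many of them as elements in the spanning set
  \<open>F\<close> of the corner algebra.\<close>

lemma ind_rule_step:
  assumes ind: "n > 0 \<Longrightarrow> ind_rule TYPE('k::field_char_0) (n - 1)" and one: "n > 0 \<Longrightarrow> (1 :: 'k perm_alg) \<in> idem_ideal (n - 1)"
  shows "ind_rule TYPE('k) n"
  unfolding ind_rule_def
proof
  fix l assume l: "l \<in> partitions n"
  obtain F :: "('k perm_alg) set" where F: "finite F" "card F \<le> Suc (card (rems l))"
    "\<And>a. a \<in> sym_alg (Suc n) \<Longrightarrow> idem l * a * idem l \<in> scale.span F"
    using idem_corner_span[OF ind one l] by blast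
  define E where "E m = (up l m * dn l m :: 'k perm_alg)" for m
  let ?B = "E ` adds l"
  have EE: "E m * E m' = (if m = m' then E m else 0)" if "m \<in> adds l" "m' \<in> adds l" for m m'
  proof -
    have "E m * E m' = up l m * (dn l m * 1 * up l m') * dn l m'" by (simp add: E_def mult.assoc)
    also have "\<dots> = (if m = m' then E m else 0)"
    proof (cases "m = m'")
      case True
      then show ?thesis by (simp add: dn_up[OF l that(2)] up_idem[OF l that(2)] E_def)
    next
      case False
      then have "dn l m * 1 * up l m' = (0 :: 'k perm_alg)"
        by (rule dn_mult_up_eq_zero[OF l that(1) l that(2)]) (rule sym_alg_one)
      then show ?thesis using False by (simp only: mult_zero_left mult_zero_right if_False)
    qed
    finally show ?thesis .
  qed
  have E0: "E m \<noteq> 0" if "m \<in> adds l" for m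
  proof
    assume "E m = 0"
    have "dn l m * E m * up l m = (dn l m * up l m) * (dn l m * up l m)" by (simp add: E_def mult.assoc)
    also have "\<dots> = idem m" by (simp add: dn_up[OF l that] idem_idem[OF adds_partitions[OF l that]])
    finally show False using \<open>E m = 0\<close> idem_nonzero[OF adds_partitions[OF l that], where 'k = 'k] by simp
  qed
  have El: "idem l * E m = E m" "E m * idem l = E m" if "m \<in> adds l" for m
    using idem_up[OF l that, where 'k = 'k] dn_idem[OF l that, where 'k = 'k] by (simp_all add: E_def mult.assoc) (metis mult.assoc)
  have EA: "E m \<in> sym_alg (Suc n)" if "m \<in> adds l" for m
    unfolding E_def using up_sym_alg[OF l that] dn_sym_alg[OF l that] by blast
  have inj: "inj_on E (adds l)"
    by (rule inj_onI) (metis EE E0)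
  have kill: "x * z = 0" if "z \<in> scale.span S" "\<And>y. y \<in> S \<Longrightarrow> x * y = 0" for x z :: "'k perm_alg" and S
    using that(1) by (induction rule: scale.span_induct_alt) (simp_all add: distrib_left scale_mult_right that(2))
  have indep: "\<not> scale.dependent ?B"
    unfolding scale_vs.dependent_def
  proof safe
    fix m assume m: "m \<in> adds l" and s: "E m \<in> scale.span (?B - {E m})"
    have "E m * E m = 0" by (rule kill[OF s]) (use EE m in auto)
    then show False using EE[OF m m] E0[OF m] by simp
  qed
  have BF: "?B \<subseteq> scale.span F"
  proof safe
    fix m assume m: "m \<in> adds l"
    have "idem l * E m * idem l \<in> scale.span F" by (rule F(3)[OF EA[OF m]])
    then show "E m \<in> scale.span F" by (simp add: El[OF m])
  qed
  \<comment> \<open>Here the two bounds meet. An element of the span of \<open>F\<close> outside the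
    span of \<open>?B\<close> would enlarge \<open>?B\<close> to an independent set with more
    elements than \<open>F\<close>.\<close>
  have cB: "card F \<le> card ?B" using F(2) card_rems_less_card_adds[OF l] by (simp add: card_image[OF inj])
  have span: "x \<in> scale.span ?B" if "x \<in> scale.span F" for x
  proof (rule ccontr)
    assume x: "x \<notin> scale.span ?B"
    then have "\<not> scale.dependent (insert x ?B)"
      using indep by (simp add: scale_vs.independent_insert)
    then have "card (insert x ?B) \<le> card F"
      using scale_vs.independent_span_bound[OF F(1), of "insert x ?B"] BF that by auto
    moreover have "x \<notin> ?B" using x scale.span_base by blast
    ultimately show False using cB finite_adds[OF l] by simp
  qed
  \<comment> \<open>The part of \<open>idem l\<close> not accounted for. It annihilates every
    \<open>E m\<close> from the left and lies in their span, so its square vanishes; but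
    \<open>q\<close> is also idempotent.\<close>
  define q where "q = idem l - (\<Sum>m\<in>adds l. E m)"
  have "idem l * 1 * idem l \<in> scale.span F" by (rule F(3)) simp
  then have "idem l \<in> scale.span ?B" using span by (simp add: idem_idem[OF l])
  then have qB: "q \<in> scale.span ?B" unfolding q_def by (auto intro!: scale.span_diff scale.span_sum intro: scale.span_base)
  have qE: "q * E m = 0" if m: "m \<in> adds l" for m
  proof -
    have "(\<Sum>m'\<in>adds l. E m' * E m) = (\<Sum>m'\<in>adds l. if m' = m then E m else 0)"
      by (rule sum.cong) (auto simp: EE m)
    then show ?thesis using m finite_adds[OF l] by (simp add: q_def left_diff_distrib El sum_distrib_right)
  qed
  have "q * q = 0" by (rule kill[OF qB]) (use qE in auto)
  moreover have "q * q = q"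
  proof -
    have "q * q = q * idem l - (\<Sum>m\<in>adds l. q * E m)" by (subst (2) q_def) (simp add: right_diff_distrib sum_distrib_left)
    also have "\<dots> = q * idem l" by (simp add: qE)
    also have "\<dots> = q" by (simp add: q_def left_diff_distrib sum_distrib_right El idem_idem[OF l])
    finally show ?thesis .
  qed
  ultimately show "idem l = (\<Sum>m\<in>adds l. up l m * dn l m :: 'k perm_alg)" by (simp add: q_def E_def)
qed

lemma one_idem_ideal_zero: "(1 :: 'k::field_char_0 perm_alg) \<in> idem_ideal 0"
proof -
  have l: "[] \<in> partitions 0" by (simp add: partitions_def)
  have "Sym 0 = {0}"
  proof -
    have "g = 0" if "g \<in> Sym 0" for g
      by (rule fperm_eqI) (use Sym_app_out[OF that] in auto)
    then show ?thesis by auto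
  qed
  then have "coef (idem [] :: 'k perm_alg) g = 0" if "g \<noteq> 0" for g
    using idem_sym_alg[OF l, where 'a = 'k] that by (auto simp: free_on_iff)
  then have e: "(idem [] :: 'k perm_alg) = scale (coef (idem []) 0) 1"
    by (intro poly_mapping_eqI) (simp add: lookup_one when_def)
  then have "coef (idem [] :: 'k perm_alg) 0 \<noteq> 0" using idem_nonzero[OF l, where 'k = 'k] by (metis scale.scale_zero_left)
  then have "1 = scale (inverse (coef (idem []) 0)) (1 * idem [] * (1 :: 'k perm_alg))"
    using e by (metis mult_1 mult_1_right scale.scale_scale scale.scale_one left_inverse)
  moreover have "scale (inverse (coef (idem []) 0)) (1 * idem [] * (1 :: 'k perm_alg)) \<in> idem_ideal 0"
    unfolding idem_ideal_def using l by (intro scale.span_scale scale.span_base) blast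
  ultimately show ?thesis by metis
qed

lemma ind_rule_and_idem_ideal: "ind_rule TYPE('k::field_char_0) n \<and> (1 :: 'k perm_alg) \<in> idem_ideal n"
proof (induction n)
  case 0
  have "ind_rule TYPE('k) 0" by (rule ind_rule_step) simp_all
  moreover have "(1 :: 'k perm_alg) \<in> idem_ideal 0" by (rule one_idem_ideal_zero)
  ultimately show ?case by blast
next
  case (Suc n)
  have "ind_rule TYPE('k) (Suc n)" by (rule ind_rule_step) (use Suc in simp_all)
  moreover have "(1 :: 'k perm_alg) \<in> idem_ideal (Suc n)" by (rule idem_ideal_step) (use Suc in simp_all)
  ultimately show ?case by blast
qed

lemma idem_eq_sum_up_dn:
  "l \<in> partitions n \<Longrightarrow> idem l = (\<Sum>m\<in>adds l. up l m * dn l m :: 'k::field_char_0 perm_alg)"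
  using ind_rule_and_idem_ideal[of n, where 'k = 'k] by (simp add: ind_rule_def)

lemma idem_mult_eq_sum_dn:
  assumes "l \<in> partitions (Suc n)" "c \<in> sym_alg (Suc n)"
  shows "\<exists>b. (\<forall>v. b v \<in> sym_alg n) \<and> idem l * c = (\<Sum>v\<in>rems l. dn v l * b v :: 'k::field_char_0 perm_alg)"
  using res_rule_right[OF _ _ assms] ind_rule_and_idem_ideal[of n, where 'k = 'k] by blast

section \<open>Counting colourings of diagrams\<close>

text \<open>A two-colouring of the points of a diagram is encoded by the set of points of the first
  colour. Diagrams and numbers of loops are determined by the numbers of compatible colourings of
  the middle points of a stack, which reduces identities between composites to counting.\<close>

definition saturated :: "'v set set \<Rightarrow> 'v set \<Rightarrow> bool" where
  "saturated P Z \<longleftrightarrow> (\<forall>e\<in>P. e \<subseteq> Z \<or> e \<inter> Z = {})"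

lemma saturated_image: "saturated ((`) f ` P) Z \<longleftrightarrow> saturated P (f -` Z)"
  by (auto simp: saturated_def)

lemma saturated_Un: "saturated (P \<union> Q) Z \<longleftrightarrow> saturated P Z \<and> saturated Q Z"
  by (auto simp: saturated_def)

lemma saturated_insert: "saturated (insert e P) Z \<longleftrightarrow> (e \<subseteq> Z \<or> e \<inter> Z = {}) \<and> saturated P Z"
  by (auto simp: saturated_def)

lemma saturated_restrict:
  assumes "partition_on V P" "Z \<inter> V = Z' \<inter> V"
  shows "saturated P Z \<longleftrightarrow> saturated P Z'"
proof -
  have "(e \<subseteq> Z \<or> e \<inter> Z = {}) \<longleftrightarrow> (e \<subseteq> Z' \<or> e \<inter> Z' = {})" if "e \<in> P" for e
  proof -
    have "e \<subseteq> V" using assms(1) that by (auto simp: partition_on_def)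
    then have "e \<inter> Z = e \<inter> Z'" using assms(2) by auto
    then show ?thesis by auto
  qed
  then show ?thesis by (simp add: saturated_def)
qed

text \<open>A saturated set is a union of blocks. Its trace \<open>Q\<close> on \<open>X\<close>
  decides about every block meeting \<open>X\<close>, provided that \<open>Q\<close> does not cut
  such a block, while each block avoiding \<open>X\<close> can be chosen freely.\<close>

lemma card_saturated:
  assumes V: "finite V" "partition_on V P" and Q: "Q \<subseteq> X"
    and XV: "X \<subseteq> V"
  shows "card {Z. Z \<subseteq> V \<and> saturated P Z \<and> Z \<inter> X = Q} =
    (if \<forall>C\<in>P. C \<inter> X \<subseteq> Q \<or> C \<inter> Q = {} then 2 ^ card {C \<in> P. C \<inter> X = {}} else 0)"
proof (cases "\<forall>C\<in>P. C \<inter> X \<subseteq> Q \<or> C \<inter> Q = {}")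
  case False
  then obtain C where C: "C \<in> P" "\<not> C \<inter> X \<subseteq> Q" "C \<inter> Q \<noteq> {}" by blast
  have "\<not> (saturated P Z \<and> Z \<inter> X = Q)" for Z
  proof
    assume Z: "saturated P Z \<and> Z \<inter> X = Q"
    then have "C \<subseteq> Z \<or> C \<inter> Z = {}" using C(1) by (simp add: saturated_def)
    then show False using C(2,3) Z by blast
  qed
  then have e: "{Z. Z \<subseteq> V \<and> saturated P Z \<and> Z \<inter> X = Q} = {}" by blast
  show ?thesis using False by (simp only: e card.empty if_False)
next
  case True
  have P: "\<Union>P = V" "\<And>C D. C \<in> P \<Longrightarrow> D \<in> P \<Longrightarrow> C \<inter> D \<noteq> {} \<Longrightarrow> C = D"
    using V(2) by (auto simp: partition_on_def disjoint_def)
  let ?I = "{C \<in> P. C \<inter> X = {}}"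
  \<comment> \<open>The forced part: every block meeting \<open>Q\<close> is contained in each
    admissible \<open>Z\<close>, and the rest of \<open>Z\<close> is an arbitrary set of blocks
    avoiding \<open>X\<close>.\<close>
  define b where "b = \<Union>{C \<in> P. C \<inter> Q \<noteq> {}}"
  have "bij_betw (\<lambda>S. b \<union> \<Union>S) (Pow ?I) {Z. Z \<subseteq> V \<and> saturated P Z \<and> Z \<inter> X = Q}"
  proof (rule bij_betw_byWitness[where f' = "\<lambda>Z. {C \<in> ?I. C \<subseteq> Z}"])
    have disj: "C \<inter> b = {}" if "C \<in> P" "C \<inter> Q = {}" for C
      using P(2) that unfolding b_def by blast
    have bQ: "b \<inter> X = Q"
    proof
      show "b \<inter> X \<subseteq> Q" using True unfolding b_def by blast
      show "Q \<subseteq> b \<inter> X" using Q XV P(1) unfolding b_def by blast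
    qed
    have bV: "b \<subseteq> V" using P(1) unfolding b_def by blast
    have nonempty: "C \<noteq> {}" if "C \<in> P" for C using V(2) that by (auto simp: partition_on_def)
    have mem: "C \<subseteq> b \<union> \<Union>S \<longleftrightarrow> C \<in> S" if m: "S \<subseteq> ?I" "C \<in> ?I" for S C
    proof
      assume s: "C \<subseteq> b \<union> \<Union>S"
      have "C \<inter> Q = {}" using m(2) Q by auto
      then have "C \<inter> b = {}" using disj m(2) by blast
      then have "C \<subseteq> \<Union>S" using s by blast
      then obtain D where "D \<in> S" "C \<inter> D \<noteq> {}" using nonempty[of C] m(2) by blast
      then show "C \<in> S" using P(2)[of C D] m by blast
    qed auto
    show "\<forall>S\<in>Pow ?I. {C \<in> ?I. C \<subseteq> b \<union> \<Union>S} = S" using mem by auto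
    show "(\<lambda>S. b \<union> \<Union>S) ` Pow ?I \<subseteq> {Z. Z \<subseteq> V \<and> saturated P Z \<and> Z \<inter> X = Q}"
    proof
      fix Z assume "Z \<in> (\<lambda>S. b \<union> \<Union>S) ` Pow ?I"
      then obtain S where S: "S \<subseteq> ?I" and Z: "Z = b \<union> \<Union>S" by blast
      have "Z \<subseteq> V" unfolding Z using S P(1) bV by blast
      moreover have "saturated P Z"
        unfolding saturated_def
      proof
        fix C assume C: "C \<in> P"
        show "C \<subseteq> Z \<or> C \<inter> Z = {}"
        proof (cases "C \<inter> Q \<noteq> {} \<or> C \<in> S")
          case True
          then show ?thesis using C unfolding Z b_def by blast
        next
          case False
          then have "C \<inter> b = {}" using disj C by blast
          moreover have "C \<inter> D = {}" if "D \<in> S" for D using that False P(2)[OF C, of D] S by blast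
          ultimately show ?thesis unfolding Z by blast
        qed
      qed
      moreover have "\<Union>S \<inter> X = {}" using S by blast
      then have "Z \<inter> X = Q" unfolding Z using bQ by blast
      ultimately show "Z \<in> {Z. Z \<subseteq> V \<and> saturated P Z \<and> Z \<inter> X = Q}" by blast
    qed
    show "(\<lambda>Z. {C \<in> ?I. C \<subseteq> Z}) ` {Z. Z \<subseteq> V \<and> saturated P Z \<and> Z \<inter> X = Q} \<subseteq> Pow ?I" by blast
    show "\<forall>Z\<in>{Z. Z \<subseteq> V \<and> saturated P Z \<and> Z \<inter> X = Q}. b \<union> \<Union>{C \<in> ?I. C \<subseteq> Z} = Z"
    proof
      fix Z assume "Z \<in> {Z. Z \<subseteq> V \<and> saturated P Z \<and> Z \<inter> X = Q}"
      then have Z: "Z \<subseteq> V" "saturated P Z" "Z \<inter> X = Q" by auto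
      have s: "C \<subseteq> Z \<or> C \<inter> Z = {}" if "C \<in> P" for C using Z(2) that by (simp add: saturated_def)
      show "b \<union> \<Union>{C \<in> ?I. C \<subseteq> Z} = Z"
      proof
        show "b \<union> \<Union>{C \<in> ?I. C \<subseteq> Z} \<subseteq> Z" using s Z(3) unfolding b_def by blast
        show "Z \<subseteq> b \<union> \<Union>{C \<in> ?I. C \<subseteq> Z}"
        proof
          fix v assume v: "v \<in> Z"
          then obtain C where C: "C \<in> P" "v \<in> C" using Z(1) P(1) by blast
          then have CZ: "C \<subseteq> Z" using s v by blast
          show "v \<in> b \<union> \<Union>{C \<in> ?I. C \<subseteq> Z}"
          proof (cases "C \<inter> X = {}")
            case True
            then show ?thesis using C CZ by blast
          next
            case False
            then have "C \<inter> Q \<noteq> {}" using CZ Z(3) by blast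
            then show ?thesis using C unfolding b_def by blast
          qed
        qed
      qed
    qed
  qed
  then have "card {Z. Z \<subseteq> V \<and> saturated P Z \<and> Z \<inter> X = Q} = card (Pow ?I)"
    by (rule bij_betw_same_card[symmetric])
  moreover have "finite ?I" using finite_elements[OF V] by simp
  ultimately show ?thesis using True by (simp add: card_Pow)
qed

section \<open>Connected components of a graph\<close>

lemma sym_edges: "sym {(v, w). {v, w} \<in> E}"
  by (auto simp: sym_def insert_commute)

lemma saturated_components:
  assumes E: "\<And>e. e \<in> E \<Longrightarrow> \<exists>v w. e = {v, w}"
  shows "saturated (components E) Z \<longleftrightarrow> saturated E Z"
proof
  assume s: "saturated E Z"
  have step: "v \<in> Z \<longleftrightarrow> w \<in> Z" if "{v, w} \<in> E" for v w
    using s that by (force simp: saturated_def)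
  have path: "u \<in> Z \<longleftrightarrow> v \<in> Z" if "(u, v) \<in> {(v, w). {v, w} \<in> E}\<^sup>*" for u v
    using that by (induction rule: rtrancl_induct) (use step in auto)
  show "saturated (components E) Z"
    unfolding saturated_def
  proof
    fix C assume "C \<in> components E"
    then obtain u where C: "C = {(v, w). {v, w} \<in> E}\<^sup>* `` {u}" by (auto simp: components_def)
    show "C \<subseteq> Z \<or> C \<inter> Z = {}"
      by (cases "u \<in> Z") (use path[of u] in \<open>auto simp: C\<close>)
  qed
next
  assume s: "saturated (components E) Z"
  show "saturated E Z"
    unfolding saturated_def
  proof
    fix e assume e: "e \<in> E"
    then obtain v w where vw: "e = {v, w}" using E by blast
    let ?C = "{(v, w). {v, w} \<in> E}\<^sup>* `` {v}"
    have "v \<in> ?C" "w \<in> ?C" using e vw by (auto intro: r_into_rtrancl)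
    moreover have "?C \<in> components E" using e vw by (auto simp: components_def)
    then have "?C \<subseteq> Z \<or> ?C \<inter> Z = {}" using s unfolding saturated_def by blast
    ultimately show "e \<subseteq> Z \<or> e \<inter> Z = {}" using vw by blast
  qed
qed

lemma components_partition:
  assumes E: "\<And>e. e \<in> E \<Longrightarrow> \<exists>v w. e = {v, w}"
  shows "partition_on (\<Union>E) (components E)"
proof -
  let ?R = "{(v, w). {v, w} \<in> E}\<^sup>*"
  have sym: "sym ?R" by (intro sym_rtrancl sym_edges)
  have reach: "v \<in> \<Union>E" if "(u, v) \<in> ?R" "u \<in> \<Union>E" for u v
    using that by (induction rule: rtrancl_induct) auto
  have eq: "?R `` {u} = ?R `` {v}" if "(u, v) \<in> ?R" for u v
    using that symD[OF sym that] by (auto intro: rtrancl_trans)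
  show ?thesis
  proof (rule partition_onI)
    show "\<Union>(components E) = \<Union>E"
    proof
      show "\<Union>(components E) \<subseteq> \<Union>E" unfolding components_def using reach by blast
      show "\<Union>E \<subseteq> \<Union>(components E)" unfolding components_def by blast
    qed
    fix C D assume C: "C \<in> components E" and D: "D \<in> components E" and ne: "C \<noteq> D"
    obtain u v where uv: "C = ?R `` {u}" "D = ?R `` {v}" using C D unfolding components_def by blast
    show "disjnt C D"
    proof (rule ccontr)
      assume "\<not> disjnt C D"
      then obtain w where "(u, w) \<in> ?R" "(v, w) \<in> ?R" using uv by (auto simp: disjnt_def)
      then have "C = D" using eq uv by metis
      then show False using ne by simp
    qed
  next
    show "{} \<notin> components E" by (auto simp: components_def)
  qed
qed

text \<open>A connected graph has at least one edge fewer than vertices: grow a set from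
  \<open>u\<close> one vertex at a time, each time gaining an edge inside the set.\<close>

lemma component_card_le:
  assumes C: "C \<in> components E" "finite C" and E: "finite E"
  shows "card C \<le> Suc (card {e \<in> E. e \<subseteq> C})"
proof -
  obtain u where u: "C = {(v, w). {v, w} \<in> E}\<^sup>* `` {u}" using C(1) by (auto simp: components_def)
  have "\<exists>S\<subseteq>C. u \<in> S \<and> card S = Suc n \<and> n \<le> card {e \<in> E. e \<subseteq> S}" if "n < card C" for n
    using that
  proof (induction n)
    case 0
    show ?case by (rule exI[of _ "{u}"]) (use u in auto)
  next
    case (Suc n)
    then obtain S where S: "S \<subseteq> C" "u \<in> S" "card S = Suc n" "n \<le> card {e \<in> E. e \<subseteq> S}" by auto
    \<comment> \<open>If no edge left \<open>S\<close>, everything reachable from \<open>u\<close>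
      would be in \<open>S\<close>, but \<open>S\<close> is still smaller than the
      component.\<close>
    have "\<exists>a b. a \<in> S \<and> b \<notin> S \<and> {a, b} \<in> E"
    proof (rule ccontr)
      assume "\<not> ?thesis"
      then have step: "b \<in> S" if "a \<in> S" "{a, b} \<in> E" for a b using that by blast
      have "v \<in> S" if "(u, v) \<in> {(v, w). {v, w} \<in> E}\<^sup>*" for v
        using that by (induction rule: rtrancl_induct) (use step S(2) in auto)
      then have "C \<subseteq> S" using u by auto
      then show False using S Suc.prems by auto
    qed
    then obtain a b where ab: "a \<in> S" "b \<notin> S" "{a, b} \<in> E" by blast
    have "b \<in> C" using ab S(1) u by (auto intro: rtrancl_into_rtrancl)
    have fS: "finite S" using S(1) C(2) finite_subset by blast
    have "card {e \<in> E. e \<subseteq> S} < card {e \<in> E. e \<subseteq> insert b S}"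
    proof (rule psubset_card_mono)
      show "{e \<in> E. e \<subseteq> S} \<subset> {e \<in> E. e \<subseteq> insert b S}"
      proof (rule psubsetI)
        show "{e \<in> E. e \<subseteq> S} \<noteq> {e \<in> E. e \<subseteq> insert b S}"
          using ab by (intro notI) (drule equalityD2, auto)
      qed auto
    qed (use E in simp)
    then show ?case using S \<open>b \<in> C\<close> ab(2) fS by (intro exI[of _ "insert b S"]) auto
  qed
  moreover have pos: "0 < card C" using u C(2) card_gt_0_iff by blast
  ultimately have "\<exists>S\<subseteq>C. u \<in> S \<and> card S = Suc (card C - 1) \<and> card C - 1 \<le> card {e \<in> E. e \<subseteq> S}"
    by (meson diff_Suc_less less_imp_diff_less diff_less zero_less_one)
  then obtain S where S: "S \<subseteq> C" "card S = card C" "card C - 1 \<le> card {e \<in> E. e \<subseteq> S}"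
    using pos by auto
  then have "S = C" using C(2) card_subset_eq by blast
  then show ?thesis using S(3) by simp
qed

section \<open>Diagrams as perfect matchings, and their stacks\<close>

definition seg :: "nat \<Rightarrow> nat set" where "seg n = {1..n}"

lemma finite_seg [simp]: "finite (seg n)" by (simp add: seg_def)
lemma seg_Suc: "seg (Suc n) = insert (Suc n) (seg n)" by (auto simp: seg_def)
lemma Suc_notin_seg [simp]: "Suc n \<notin> seg n" by (simp add: seg_def)
lemma card_seg [simp]: "card (seg n) = n" by (simp add: seg_def)

lemma diagrams_iff: "x \<in> diagrams r s \<longleftrightarrow> partition_on (seg r <+> seg s) x \<and> (\<forall>e\<in>x. card e = 2)"
  by (simp add: diagrams_def seg_def)

lemma diagrams_finite: "x \<in> diagrams r s \<Longrightarrow> finite x"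
  unfolding diagrams_iff using finite_elements[of "seg r <+> seg s"] by simp

lemma diagrams_edge: "x \<in> diagrams r s \<Longrightarrow> e \<in> x \<Longrightarrow> \<exists>v w. e = {v, w} \<and> v \<noteq> w"
  by (auto simp: diagrams_iff card_2_iff)

lemma diagrams_Union: "x \<in> diagrams r s \<Longrightarrow> \<Union>x = seg r <+> seg s"
  by (auto simp: diagrams_iff partition_on_def)

lemma diagrams_disjoint: "x \<in> diagrams r s \<Longrightarrow> e \<in> x \<Longrightarrow> e' \<in> x \<Longrightarrow> v \<in> e \<Longrightarrow> v \<in> e' \<Longrightarrow> e = e'"
  unfolding diagrams_iff partition_on_def disjoint_def by blast

lemma diagrams_subset: "x \<in> diagrams r s \<Longrightarrow> e \<in> x \<Longrightarrow> e \<subseteq> seg r <+> seg s"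
  using diagrams_Union by blast

lemma diagrams_saturated_self: "x \<in> diagrams r s \<Longrightarrow> e \<in> x \<Longrightarrow> saturated x e"
  unfolding saturated_def using diagrams_disjoint by blast

lemma saturated_diagram_cong:
  assumes "x \<in> diagrams r s" "A \<inter> seg r = A' \<inter> seg r" "B \<inter> seg s = B' \<inter> seg s"
  shows "saturated x (A <+> B) \<longleftrightarrow> saturated x (A' <+> B')"
proof (rule saturated_restrict)
  show "partition_on (seg r <+> seg s) x" using assms(1) by (simp add: diagrams_iff)
  show "(A <+> B) \<inter> (seg r <+> seg s) = (A' <+> B') \<inter> (seg r <+> seg s)" using assms(2,3) by (auto simp: set_eq_iff)
qed

lemma card_saturated_points:
  assumes x: "x \<in> diagrams r s" and Z: "saturated x Z"
  shows "card (Z \<inter> (seg r <+> seg s)) = 2 * card {e \<in> x. e \<subseteq> Z}"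
proof -
  have "Z \<inter> (seg r <+> seg s) = \<Union>{e \<in> x. e \<subseteq> Z}"
    using Z unfolding diagrams_Union[OF x, symmetric] saturated_def by blast
  moreover have "card (\<Union>{e \<in> x. e \<subseteq> Z}) = (\<Sum>e\<in>{e \<in> x. e \<subseteq> Z}. card e)"
    by (rule card_Union_disjoint) (use x diagrams_disjoint[OF x] in \<open>auto simp: pairwise_def disjnt_def diagrams_iff card_2_iff\<close>)
  moreover have "\<dots> = (\<Sum>e\<in>{e \<in> x. e \<subseteq> Z}. 2)" using x by (intro sum.cong) (auto simp: diagrams_iff)
  ultimately show ?thesis by simp
qed

text \<open>Read the compatibility of a diagram with colourings of its two edges as a 0-1 matrix.
  The number of elements of this set is then an entry of the product of the matrices of
  \<open>x\<close> and \<open>y\<close>. This is the action of diagrams on tensor powers of a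
  two-dimensional orthogonal space, where a loop has the value 2.\<close>

definition middle :: "nat \<Rightarrow> diagram \<Rightarrow> diagram \<Rightarrow> nat set \<Rightarrow> nat set \<Rightarrow> nat set set" where
  "middle s x y A C = {B \<in> Pow (seg s). saturated x (A <+> B) \<and> saturated y (B <+> C)}"

context
  fixes x y r s t
  assumes x: "x \<in> diagrams r s" and y: "y \<in> diagrams s t"
begin

lemma stack_edge: "e \<in> stack x y \<Longrightarrow> \<exists>v w. e = {v, w}"
  using diagrams_edge[OF x] diagrams_edge[OF y] unfolding stack_def by (elim UnE imageE) fastforce+

lemma stack_partition: "partition_on (\<Union>(stack x y)) (components (stack x y))"
  by (rule components_partition) (rule stack_edge)

lemma saturated_stack_components: "saturated (components (stack x y)) Z \<longleftrightarrow> saturated (stack x y) Z"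
  by (rule saturated_components) (rule stack_edge)

lemma Union_stack: "\<Union>(stack x y) = Inl ` seg r \<union> Inr ` (Inl ` seg s \<union> Inr ` seg t)"
proof -
  have "\<Union>(stack x y) = map_sum id Inl ` \<Union>x \<union> Inr ` \<Union>y" unfolding stack_def by blast
  also have "\<dots> = Inl ` seg r \<union> Inr ` (Inl ` seg s \<union> Inr ` seg t)"
    unfolding diagrams_Union[OF x] diagrams_Union[OF y] Plus_def image_Un image_image by auto
  finally show ?thesis .
qed

lemma finite_Union_stack: "finite (\<Union>(stack x y))"
  unfolding Union_stack by simp

lemma finite_stack: "finite (stack x y)"
  using diagrams_finite[OF x] diagrams_finite[OF y] by (simp add: stack_def)

lemma saturated_stack: "saturated (stack x y) Z \<longleftrightarrow> saturated x (map_sum id Inl -` Z) \<and> saturated y (Inr -` Z)"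
  by (simp add: stack_def saturated_Un saturated_image)

lemma component_subset: "K \<in> components (stack x y) \<Longrightarrow> K \<subseteq> \<Union>(stack x y)"
  using stack_partition by (auto simp: partition_on_def)

text \<open>Let \<open>K\<close> have \<open>T\<close> top, \<open>M\<close> middle and
  \<open>B\<close> bottom points. Its edges match the \<open>T + M\<close> points of
  \<open>x\<close> and the \<open>M + B\<close> points of \<open>y\<close>, so there are half of
  \<open>T + 2 M + B\<close> of them and \<open>T + B\<close> is even. Connectedness bounds
  \<open>T + M + B\<close> by one more than the number of edges, which gives
  \<open>T + B \<le> 2\<close>.\<close>

lemma card_outer_points_component:
  assumes K: "K \<in> components (stack x y)" and ne: "outer_points K \<noteq> {}"
  shows "card (outer_points K) = 2"
proof -
  have fK: "finite K" using component_subset[OF K] finite_Union_stack finite_subset by blast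
  have "saturated (components (stack x y)) K"
  proof -
    have "partition_on (\<Union>(stack x y)) (components (stack x y))" by (rule stack_partition)
    then show ?thesis using K unfolding saturated_def partition_on_def disjoint_def by blast
  qed
  then have s: "saturated x (map_sum id Inl -` K)" "saturated y (Inr -` K)"
    using saturated_stack_components saturated_stack by auto
  define T where "T = Inl -` K"
  define M where "M = Inl -` (Inr -` K)"
  define B where "B = Inr -` (Inr -` K)"
  have sub: "T \<subseteq> seg r" "M \<subseteq> seg s" "B \<subseteq> seg t"
    using component_subset[OF K] unfolding Union_stack T_def M_def B_def by auto
  have fin: "finite T" "finite M" "finite B"
    using sub(1)[THEN finite_subset] sub(2)[THEN finite_subset] sub(3)[THEN finite_subset] by simp_all
  have e1: "(map_sum id Inl -` K) \<inter> (seg r <+> seg s) = T <+> M" "(Inr -` K) \<inter> (seg s <+> seg t) = M <+> B"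
    using sub unfolding T_def M_def B_def by auto
  have o: "outer_points K = T <+> B"
  proof (rule Set.set_eqI)
    fix v show "v \<in> outer_points K \<longleftrightarrow> v \<in> T <+> B"
      unfolding outer_points_def T_def B_def by (cases v) auto
  qed
  have cx: "card T + card M = 2 * card {e \<in> x. e \<subseteq> map_sum id Inl -` K}"
    using card_saturated_points[OF x s(1)] fin by (simp add: e1 card_Plus)
  have cy: "card M + card B = 2 * card {e \<in> y. e \<subseteq> Inr -` K}"
    using card_saturated_points[OF y s(2)] fin by (simp add: e1 card_Plus)
  have "K = Inl ` T \<union> (Inr ` (Inl ` M) \<union> Inr ` (Inr ` B))"
  proof (rule Set.set_eqI)
    fix v show "v \<in> K \<longleftrightarrow> v \<in> Inl ` T \<union> (Inr ` (Inl ` M) \<union> Inr ` (Inr ` B))"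
      unfolding T_def M_def B_def by (cases v; cases "projr v") auto
  qed
  then have "K = T <+> (M <+> B)" by (simp add: Plus_def image_Un)
  then have cK: "card K = card T + (card M + card B)" using fin by (simp add: card_Plus)
  have "{e \<in> stack x y. e \<subseteq> K} \<subseteq> (`) (map_sum id Inl) ` {e \<in> x. e \<subseteq> map_sum id Inl -` K} \<union> (`) Inr ` {e \<in> y. e \<subseteq> Inr -` K}"
  proof
    fix e assume "e \<in> {e \<in> stack x y. e \<subseteq> K}"
    then have e: "e \<in> stack x y" "e \<subseteq> K" by auto
    from e(1) consider e' where "e' \<in> x" "e = map_sum id Inl ` e'" | e' where "e' \<in> y" "e = Inr ` e'"
      unfolding stack_def by blast
    then show "e \<in> (`) (map_sum id Inl) ` {e \<in> x. e \<subseteq> map_sum id Inl -` K} \<union> (`) Inr ` {e \<in> y. e \<subseteq> Inr -` K}"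
    proof cases
      case (1 e')
      then have "e' \<subseteq> map_sum id Inl -` K" using e(2) by (simp add: image_subset_iff_subset_vimage)
      then show ?thesis using 1 by (intro UnI1 image_eqI[of _ _ e']) simp_all
    next
      case (2 e')
      then have "e' \<subseteq> Inr -` K" using e(2) by (simp add: image_subset_iff_subset_vimage)
      then show ?thesis using 2 by (intro UnI2 image_eqI[of _ _ e']) simp_all
    qed
  qed
  then have "card {e \<in> stack x y. e \<subseteq> K} \<le> card ((`) (map_sum id Inl) ` {e \<in> x. e \<subseteq> map_sum id Inl -` K} \<union> (`) Inr ` {e \<in> y. e \<subseteq> Inr -` K})"
    using diagrams_finite[OF x] diagrams_finite[OF y] by (intro card_mono) auto
  also have "\<dots> \<le> card ((`) (map_sum id (Inl :: nat \<Rightarrow> nat + nat) :: nat + nat \<Rightarrow> nat + (nat + nat)) ` {e \<in> x. e \<subseteq> map_sum id Inl -` K}) + card ((`) (Inr :: nat + nat \<Rightarrow> nat + (nat + nat)) ` {e \<in> y. e \<subseteq> Inr -` K})"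
    by (rule card_Un_le)
  also have "\<dots> \<le> card {e \<in> x. e \<subseteq> map_sum id Inl -` K} + card {e \<in> y. e \<subseteq> Inr -` K}"
    using diagrams_finite[OF x] diagrams_finite[OF y] by (intro add_mono card_image_le) auto
  finally have "card K \<le> Suc (card {e \<in> x. e \<subseteq> map_sum id Inl -` K} + card {e \<in> y. e \<subseteq> Inr -` K})"
    using component_card_le[OF K fK finite_stack] by linarith
  moreover have co: "card (outer_points K) = card T + card B" using o fin by (simp add: card_Plus)
  moreover have "card T + card B > 0" using ne o fin by (auto simp: card_gt_0_iff)
  ultimately show ?thesis using cx cy cK by presburger
qed

lemma compose_in_diagrams: "compose_diagrams x y \<in> diagrams r t"
  unfolding diagrams_iff
proof
  have "partition_on (map_sum id Inr -` \<Union>(stack x y)) ((-`) (map_sum id Inr) ` components (stack x y) - {{}})"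
    by (rule partition_on_vimage) (rule stack_partition)
  moreover have "map_sum id Inr -` \<Union>(stack x y) = seg r <+> seg t"
  proof (rule Set.set_eqI)
    fix v :: "nat + nat" show "v \<in> map_sum id Inr -` \<Union>(stack x y) \<longleftrightarrow> v \<in> seg r <+> seg t"
      unfolding Union_stack by (cases v) auto
  qed
  moreover have "(-`) (map_sum id Inr) ` components (stack x y) - {{}} = compose_diagrams x y"
    by (auto simp: compose_diagrams_def outer_points_def)
  ultimately show "partition_on (seg r <+> seg t) (compose_diagrams x y)" by simp
  show "\<forall>e\<in>compose_diagrams x y. card e = 2"
    using card_outer_points_component by (auto simp: compose_diagrams_def)
qed

text \<open>A compatible middle colouring is the same as a saturated set of the stack with
  prescribed outer points. The components without outer points are the loops and can be coloured
  freely; the traces of the others on the outer points are the edges of the composite.\<close>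

lemma card_middle_aux:
  assumes A: "A \<subseteq> seg r" and C: "C \<subseteq> seg t"
  shows "card (middle s x y A C) = (if saturated (compose_diagrams x y) (A <+> C) then 2 ^ loops x y else 0)"
proof -
  let ?V = "\<Union>(stack x y)" and ?K = "components (stack x y)"
  let ?X = "Inl ` seg r \<union> Inr ` Inr ` seg t :: (nat + (nat + nat)) set"
  let ?Q = "Inl ` A \<union> Inr ` Inr ` C :: (nat + (nat + nat)) set"
  let ?f = "\<lambda>B. Inl ` A \<union> Inr ` (B <+> C) :: (nat + (nat + nat)) set"
  have vim1: "map_sum id Inl -` ?f B = A <+> B" for B
  proof (rule Set.set_eqI)
    fix v show "v \<in> map_sum id Inl -` ?f B \<longleftrightarrow> v \<in> A <+> B" by (cases v) auto
  qed
  have vim2: "Inr -` ?f B = B <+> C" for B by auto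
  note vim = vim1 vim2
  have "bij_betw ?f (middle s x y A C) {Z. Z \<subseteq> ?V \<and> saturated ?K Z \<and> Z \<inter> ?X = ?Q}"
  proof (rule bij_betw_byWitness[where f' = "\<lambda>Z. Inl -` (Inr -` Z)"])
    show "\<forall>B\<in>middle s x y A C. Inl -` (Inr -` ?f B) = B" by auto
    have rec: "?f (Inl -` (Inr -` Z)) = Z" if "Z \<subseteq> ?V" "Z \<inter> ?X = ?Q" for Z :: "(nat + (nat + nat)) set"
    proof (rule Set.set_eqI)
      fix v :: "nat + (nat + nat)"
      consider a where "v = Inl a" | b where "v = Inr (Inl b)" | c where "v = Inr (Inr c)" by (metis old.sum.exhaust)
      then show "v \<in> ?f (Inl -` (Inr -` Z)) \<longleftrightarrow> v \<in> Z"
      proof cases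
        case (1 a)
        have "Inl a \<in> Z \<longleftrightarrow> Inl a \<in> Z \<inter> ?X" using that(1) unfolding Union_stack by blast
        then show ?thesis unfolding that(2) using 1 by auto
      next
        case (3 c)
        have "Inr (Inr c) \<in> Z \<longleftrightarrow> Inr (Inr c) \<in> Z \<inter> ?X" using that(1) unfolding Union_stack by blast
        then show ?thesis unfolding that(2) using 3 by auto
      qed auto
    qed
    then show "\<forall>Z\<in>{Z. Z \<subseteq> ?V \<and> saturated ?K Z \<and> Z \<inter> ?X = ?Q}. ?f (Inl -` (Inr -` Z)) = Z"
      by (intro ballI) (rule rec, simp_all)
    show "?f ` middle s x y A C \<subseteq> {Z. Z \<subseteq> ?V \<and> saturated ?K Z \<and> Z \<inter> ?X = ?Q}"
    proof
      fix Z assume "Z \<in> ?f ` middle s x y A C"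
      then obtain B where B: "Z = ?f B" "B \<in> middle s x y A C" by blast
      have "saturated ?K Z"
        using B(2) unfolding saturated_stack_components saturated_stack B(1) vim middle_def by blast
      moreover have Bs: "B \<subseteq> seg s" using B(2) unfolding middle_def by simp
      have "Z \<subseteq> ?V" unfolding B(1) Union_stack using A C Bs by auto
      moreover have "Z \<inter> ?X = ?Q" unfolding B(1) using A C by auto
      ultimately show "Z \<in> {Z. Z \<subseteq> ?V \<and> saturated ?K Z \<and> Z \<inter> ?X = ?Q}" by blast
    qed
    show "(\<lambda>Z. Inl -` (Inr -` Z)) ` {Z. Z \<subseteq> ?V \<and> saturated ?K Z \<and> Z \<inter> ?X = ?Q} \<subseteq> middle s x y A C"
    proof (rule image_subsetI)
      fix Z assume "Z \<in> {Z. Z \<subseteq> ?V \<and> saturated ?K Z \<and> Z \<inter> ?X = ?Q}"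
      then have Z: "Z \<subseteq> ?V" "saturated ?K Z" "Z \<inter> ?X = ?Q" by simp_all
      let ?B = "Inl -` (Inr -` Z)"
      have "saturated (stack x y) (?f ?B)"
        using Z(2) unfolding rec[OF Z(1,3)] saturated_stack_components .
      then have "saturated x (A <+> ?B)" "saturated y (?B <+> C)" unfolding saturated_stack vim by auto
      moreover have "?B \<subseteq> seg s" using Z(1) unfolding Union_stack by auto
      ultimately show "?B \<in> middle s x y A C" by (simp add: middle_def)
    qed
  qed
  then have "card (middle s x y A C) = card {Z. Z \<subseteq> ?V \<and> saturated ?K Z \<and> Z \<inter> ?X = ?Q}"
    by (rule bij_betw_same_card)
  also have "\<dots> = (if \<forall>K\<in>?K. K \<inter> ?X \<subseteq> ?Q \<or> K \<inter> ?Q = {} then 2 ^ card {K \<in> ?K. K \<inter> ?X = {}} else 0)"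
    by (rule card_saturated[OF finite_Union_stack stack_partition])
      (use A C in \<open>auto simp: Union_stack\<close>)
  also have "{K \<in> ?K. K \<inter> ?X = {}} = {K \<in> ?K. outer_points K = {}}"
  proof (rule Collect_cong, rule conj_cong[OF refl])
    fix K assume K: "K \<in> ?K"
    let ?m = "map_sum id Inr :: nat + nat \<Rightarrow> nat + (nat + nat)"
    have "K \<inter> ?X = ?m ` outer_points K"
    proof (rule Set.set_eqI)
      fix v :: "nat + (nat + nat)"
      consider a where "v = Inl a" | b where "v = Inr (Inl b)" | c where "v = Inr (Inr c)" by (metis old.sum.exhaust)
      then show "v \<in> K \<inter> ?X \<longleftrightarrow> v \<in> ?m ` outer_points K"
      proof cases
        case (1 a)
        have "Inl a \<in> ?m ` outer_points K \<longleftrightarrow> Inl a \<in> K"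
        proof
          assume "Inl a \<in> ?m ` outer_points K"
          then show "Inl a \<in> K" by (rule imageE) (simp add: outer_points_def)
        next
          assume "Inl a \<in> K"
          then have "Inl a \<in> outer_points K" by (simp add: outer_points_def)
          then show "Inl a \<in> ?m ` outer_points K" by (rule rev_image_eqI) simp
        qed
        moreover have "Inl a \<in> K \<Longrightarrow> a \<in> seg r" using component_subset[OF K] unfolding Union_stack by blast
        ultimately show ?thesis using 1 by auto
      next
        case (2 b)
        have "Inr (Inl b) \<notin> ?m ` outer_points K"
        proof
          assume "Inr (Inl b) \<in> ?m ` outer_points K"
          then show False by (rule imageE) (metis Inl_Inr_False Inr_inject map_sum.simps old.sum.exhaust)
        qed
        then show ?thesis using 2 by auto
      next
        case (3 c)
        have "Inr (Inr c) \<in> ?m ` outer_points K \<longleftrightarrow> Inr (Inr c) \<in> K"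
        proof
          assume "Inr (Inr c) \<in> ?m ` outer_points K"
          then show "Inr (Inr c) \<in> K" by (rule imageE) (simp add: outer_points_def)
        next
          assume "Inr (Inr c) \<in> K"
          then have "Inr c \<in> outer_points K" by (simp add: outer_points_def)
          then show "Inr (Inr c) \<in> ?m ` outer_points K" by (rule rev_image_eqI) simp
        qed
        moreover have "Inr (Inr c) \<in> K \<Longrightarrow> c \<in> seg t" using component_subset[OF K] unfolding Union_stack by blast
        ultimately show ?thesis using 3 by auto
      qed
    qed
    then show "K \<inter> ?X = {} \<longleftrightarrow> outer_points K = {}" by simp
  qed
  also have "(\<forall>K\<in>?K. K \<inter> ?X \<subseteq> ?Q \<or> K \<inter> ?Q = {}) \<longleftrightarrow> saturated (compose_diagrams x y) (A <+> C)"
  proof -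
    have 1: "K \<inter> ?X \<subseteq> ?Q \<longleftrightarrow> outer_points K \<subseteq> A <+> C" if K: "K \<in> ?K" for K
    proof -
      have sub: "K \<subseteq> Inl ` seg r \<union> Inr ` (Inl ` seg s \<union> Inr ` seg t)" using component_subset[OF K] unfolding Union_stack .
      have "K \<inter> ?X \<subseteq> ?Q \<longleftrightarrow> (\<forall>a. Inl a \<in> K \<longrightarrow> a \<in> A) \<and> (\<forall>c. Inr (Inr c) \<in> K \<longrightarrow> c \<in> C)"
      proof
        assume L: "K \<inter> ?X \<subseteq> ?Q"
        have "a \<in> A" if "Inl a \<in> K" for a
        proof -
          have "Inl a \<in> K \<inter> ?X" using that sub by auto
          then show ?thesis using L by auto
        qed
        moreover have "c \<in> C" if "Inr (Inr c) \<in> K" for c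
        proof -
          have "Inr (Inr c) \<in> K \<inter> ?X" using that sub by auto
          then show ?thesis using L by auto
        qed
        ultimately show "(\<forall>a. Inl a \<in> K \<longrightarrow> a \<in> A) \<and> (\<forall>c. Inr (Inr c) \<in> K \<longrightarrow> c \<in> C)" by blast
      next
        assume R: "(\<forall>a. Inl a \<in> K \<longrightarrow> a \<in> A) \<and> (\<forall>c. Inr (Inr c) \<in> K \<longrightarrow> c \<in> C)"
        then show "K \<inter> ?X \<subseteq> ?Q" by blast
      qed
      also have "\<dots> \<longleftrightarrow> outer_points K \<subseteq> A <+> C" unfolding outer_points_def subset_iff split_sum_all by auto
      finally show ?thesis .
    qed
    have 2: "K \<inter> ?Q = {} \<longleftrightarrow> outer_points K \<inter> (A <+> C) = {}" for K
      unfolding outer_points_def set_eq_iff split_sum_all by auto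
    show ?thesis unfolding saturated_def compose_diagrams_def using 1 2 by auto
  qed
  finally show ?thesis by (simp add: loops_def)
qed

lemma card_middle:
  "card (middle s x y A C) = (if saturated (compose_diagrams x y) (A <+> C) then 2 ^ loops x y else 0)"
proof -
  have "middle s x y A C = middle s x y (A \<inter> seg r) (C \<inter> seg t)"
    unfolding middle_def
    using saturated_diagram_cong[OF x, of A "A \<inter> seg r"] saturated_diagram_cong[OF y, of _ _ C "C \<inter> seg t"] by auto
  moreover have "saturated (compose_diagrams x y) (A <+> C) = saturated (compose_diagrams x y) ((A \<inter> seg r) <+> (C \<inter> seg t))"
    by (rule saturated_diagram_cong[OF compose_in_diagrams]) auto
  ultimately show ?thesis using card_middle_aux[of "A \<inter> seg r" "C \<inter> seg t"] by simp
qed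

end

text \<open>The empty colouring is compatible with every diagram, which gives \<open>c = d\<close>.
  Colouring just one edge of \<open>z\<close> is compatible with \<open>z\<close>, hence with
  \<open>w\<close>; so this edge contains an edge of \<open>w\<close>, and both have two
  points.\<close>

lemma diagram_eqI:
  assumes z: "z \<in> diagrams r t" and w: "w \<in> diagrams r t"
    and eq: "\<And>A C. A \<subseteq> seg r \<Longrightarrow> C \<subseteq> seg t \<Longrightarrow>
      (if saturated z (A <+> C) then 2 ^ c else 0) = (if saturated w (A <+> C) then 2 ^ d else (0::nat))"
  shows "z = w" "c = d"
proof -
  have "saturated z ({} <+> {})" "saturated w ({} <+> {})" by (auto simp: saturated_def)
  then have "(2::nat) ^ c = 2 ^ d" using eq[of "{}" "{}"] by simp
  then show "c = d" by simp
  have sub: "u \<subseteq> v" if uv: "u \<in> diagrams r t" "v \<in> diagrams r t"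
    and imp: "\<And>A C. A \<subseteq> seg r \<Longrightarrow> C \<subseteq> seg t \<Longrightarrow> saturated u (A <+> C) \<Longrightarrow> saturated v (A <+> C)" for u v
  proof
    fix e assume e: "e \<in> u"
    have es: "e \<subseteq> seg r <+> seg t" by (rule diagrams_subset[OF uv(1) e])
    have eq: "e = (Inl -` e) <+> (Inr -` e)"
    proof (rule Set.set_eqI)
      fix v show "v \<in> e \<longleftrightarrow> v \<in> (Inl -` e) <+> (Inr -` e)" by (cases v) auto
    qed
    have sv: "saturated v e"
      using imp[of "Inl -` e" "Inr -` e"] diagrams_saturated_self[OF uv(1) e] es unfolding eq[symmetric] by auto
    have ce: "card e = 2" using uv(1) e by (auto simp: diagrams_iff)
    then obtain a where a: "a \<in> e" by fastforce
    then obtain e' where e': "e' \<in> v" "a \<in> e'" using es diagrams_Union[OF uv(2)] by blast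
    then have "e' \<subseteq> e" using sv a unfolding saturated_def by blast
    moreover have "card e' = 2" using uv(2) e'(1) by (auto simp: diagrams_iff)
    ultimately have "e' = e" using ce by (metis card_subset_eq card.infinite zero_neq_numeral)
    then show "e \<in> v" using e'(1) by simp
  qed
  have "saturated z (A <+> C) \<longleftrightarrow> saturated w (A <+> C)" if "A \<subseteq> seg r" "C \<subseteq> seg t" for A C
    using eq[OF that] by (auto split: if_splits)
  then show "z = w" using sub[OF z w] sub[OF w z] by blast
qed

text \<open>The form in which composites are computed below: a candidate diagram and a candidate
  number of loops are verified by their counts.\<close>

lemma composeI:
  assumes x: "x \<in> diagrams r s" and y: "y \<in> diagrams s t" and z: "z \<in> diagrams r t"
    and eq: "\<And>A C. A \<subseteq> seg r \<Longrightarrow> C \<subseteq> seg t \<Longrightarrow>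
      card (middle s x y A C) = (if saturated z (A <+> C) then 2 ^ c else 0)"
  shows "compose_diagrams x y = z" "loops x y = c"
  using diagram_eqI[OF compose_in_diagrams[OF x y] z, of "loops x y" c] eq
  unfolding card_middle[OF x y] by blast+

lemma card_middle_sum:
  "card (middle s x y A C) = (\<Sum>B\<in>Pow (seg s). if saturated x (A <+> B) \<and> saturated y (B <+> C) then 1 else 0)"
  unfolding middle_def by (subst sum.inter_filter[symmetric]) simp_all

text \<open>Both sides count the pairs of colourings of the two middle rows, summed in different
  orders, as for a product of three matrices.\<close>

lemma compose_assoc:
  assumes x: "x \<in> diagrams q r" and y: "y \<in> diagrams r s" and z: "z \<in> diagrams s t"
  shows "compose_diagrams (compose_diagrams x y) z = compose_diagrams x (compose_diagrams y z)"
    and "loops x y + loops (compose_diagrams x y) z = loops y z + loops x (compose_diagrams y z)"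
proof -
  let ?xy = "compose_diagrams x y" and ?yz = "compose_diagrams y z"
  have xy: "?xy \<in> diagrams q s" and yz: "?yz \<in> diagrams r t" using compose_in_diagrams x y z by auto
  have eq: "(if saturated (compose_diagrams ?xy z) (A <+> D) then 2 ^ (loops x y + loops ?xy z) else 0) =
      (if saturated (compose_diagrams x ?yz) (A <+> D) then 2 ^ (loops y z + loops x ?yz) else (0::nat))" for A D
  proof -
    let ?N = "\<lambda>B C. if saturated x (A <+> B) \<and> saturated y (B <+> C) \<and> saturated z (C <+> D) then 1 else (0::nat)"
    have "(\<Sum>C\<in>Pow (seg s). \<Sum>B\<in>Pow (seg r). ?N B C) = (\<Sum>C\<in>Pow (seg s). if saturated z (C <+> D) then card (middle r x y A C) else 0)"
      by (intro sum.cong refl) (simp add: card_middle_sum)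
    also have "\<dots> = (\<Sum>C\<in>Pow (seg s). 2 ^ loops x y * (if saturated ?xy (A <+> C) \<and> saturated z (C <+> D) then 1 else 0))"
      by (intro sum.cong refl) (simp add: card_middle[OF x y])
    also have "\<dots> = 2 ^ loops x y * card (middle s ?xy z A D)"
      by (simp only: sum_distrib_left[symmetric] card_middle_sum)
    also have "\<dots> = (if saturated (compose_diagrams ?xy z) (A <+> D) then 2 ^ (loops x y + loops ?xy z) else 0)"
      by (simp add: card_middle[OF xy z] power_add)
    finally have L: "(\<Sum>C\<in>Pow (seg s). \<Sum>B\<in>Pow (seg r). ?N B C) = \<dots>" .
    have "(\<Sum>B\<in>Pow (seg r). \<Sum>C\<in>Pow (seg s). ?N B C) = (\<Sum>B\<in>Pow (seg r). if saturated x (A <+> B) then card (middle s y z B D) else 0)"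
      by (intro sum.cong refl) (simp add: card_middle_sum)
    also have "\<dots> = (\<Sum>B\<in>Pow (seg r). 2 ^ loops y z * (if saturated x (A <+> B) \<and> saturated ?yz (B <+> D) then 1 else 0))"
      by (intro sum.cong refl) (simp add: card_middle[OF y z])
    also have "\<dots> = 2 ^ loops y z * card (middle r x ?yz A D)"
      by (simp only: sum_distrib_left[symmetric] card_middle_sum)
    also have "\<dots> = (if saturated (compose_diagrams x ?yz) (A <+> D) then 2 ^ (loops y z + loops x ?yz) else 0)"
      by (simp add: card_middle[OF x yz] power_add)
    finally show ?thesis using L sum.swap[of "\<lambda>B C. ?N B C" "Pow (seg s)" "Pow (seg r)"] by simp
  qed
  show "compose_diagrams ?xy z = compose_diagrams x ?yz" "loops x y + loops ?xy z = loops y z + loops x ?yz"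
    using diagram_eqI[OF compose_in_diagrams[OF xy z] compose_in_diagrams[OF x yz] eq] by blast+
qed

section \<open>Relabelling, strands and bending\<close>

lemma vimage_map_sum_Plus: "map_sum f id -` (A <+> B) = (f -` A) <+> B"
proof (rule Set.set_eqI)
  fix v show "v \<in> map_sum f id -` (A <+> B) \<longleftrightarrow> v \<in> (f -` A) <+> B" by (cases v) auto
qed

lemma image_map_sum_Plus: "map_sum f id ` (A <+> B) = (f ` A) <+> B"
  by (simp add: Plus_def image_Un image_image)

lemma image_id_on: "(\<And>v. v \<in> A \<Longrightarrow> f v = v) \<Longrightarrow> f ` A = A"
  by simp

lemma diagrams_image:
  assumes x: "x \<in> diagrams r s" and f: "inj_on f (seg r <+> seg s)" "f ` (seg r <+> seg s) = seg r' <+> seg s'"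
  shows "(`) f ` x \<in> diagrams r' s'"
  unfolding diagrams_iff
proof
  have "partition_on (f ` (seg r <+> seg s)) ((`) f ` x - {{}})"
    by (rule partition_on_inj_image) (use x f in \<open>auto simp: diagrams_iff\<close>)
  moreover have "{} \<notin> (`) f ` x" using x by (auto simp: diagrams_iff partition_on_def)
  ultimately show "partition_on (seg r' <+> seg s') ((`) f ` x)" using f(2) by simp
  show "\<forall>e\<in>(`) f ` x. card e = 2"
  proof
    fix e assume "e \<in> (`) f ` x"
    then obtain e' where e': "e' \<in> x" "e = f ` e'" by blast
    have "inj_on f e'" using f(1) diagrams_subset[OF x e'(1)] inj_on_subset by blast
    then show "card e = 2" using x e' by (simp add: card_image diagrams_iff)
  qed
qed

text \<open>The left action of permutations on diagrams, moving the top points directly instead of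
  stacking a permutation diagram on top; \<open>compose_permutation_diagram\<close> shows that both
  agree and that no loops arise.\<close>

definition relab :: "fperm \<Rightarrow> diagram \<Rightarrow> diagram" where
  "relab g d = (`) (map_sum (app g) id) ` d"

lemma relab_add: "relab (g + h) d = relab g (relab h d)"
proof -
  have "map_sum (app (g + h)) id = map_sum (app g) id \<circ> map_sum (app h) (id :: nat \<Rightarrow> nat)"
    by (simp add: map_sum.comp plus_fperm.rep_eq)
  then show ?thesis by (simp add: relab_def image_image image_comp)
qed

lemma relab_zero [simp]: "relab 0 d = d"
  by (simp add: relab_def zero_fperm.rep_eq map_sum.id)

lemma relab_uminus [simp]: "relab (- g) (relab g d) = d" "relab g (relab (- g) d) = d"
  by (simp_all add: relab_add[symmetric])

lemma saturated_relab: "saturated (relab g d) (A <+> B) \<longleftrightarrow> saturated d ((app g -` A) <+> B)"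
  by (simp add: relab_def saturated_image vimage_map_sum_Plus)

lemma relab_diagrams [intro]:
  assumes "g \<in> Sym p" "d \<in> diagrams p r" shows "relab g d \<in> diagrams p r"
  unfolding relab_def
proof (rule diagrams_image[OF assms(2)])
  have "app g ` seg p = seg p"
    using Sym_bij_betw[OF assms(1)] by (simp add: seg_def bij_betw_def)
  then show "map_sum (app g) id ` (seg p <+> seg r) = seg p <+> seg r" by (simp add: image_map_sum_Plus)
  show "inj_on (map_sum (app g) id) (seg p <+> seg r)"
    by (auto simp: inj_on_def)
qed

lemma identity_diagram_image: "identity_diagram r = (\<lambda>i. {Inl i, Inr i}) ` {1..r}"
  unfolding identity_diagram_def by blast

lemma identity_diagram_diagrams [simp, intro]: "identity_diagram r \<in> diagrams r r"
  unfolding diagrams_iff partition_on_def disjoint_def identity_diagram_image seg_def by auto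

lemma saturated_identity: "saturated (identity_diagram r) (A <+> B) \<longleftrightarrow> A \<inter> seg r = B \<inter> seg r"
  unfolding saturated_def identity_diagram_def seg_def[symmetric] by auto

lemma compose_identity_left:
  assumes x: "x \<in> diagrams p r"
  shows "compose_diagrams (identity_diagram p) x = x" "loops (identity_diagram p) x = 0"
proof -
  have eq: "card (middle p (identity_diagram p) x A C) = (if saturated x (A <+> C) then 2 ^ 0 else 0)"
    if "A \<subseteq> seg p" "C \<subseteq> seg r" for A C
  proof -
    have "middle p (identity_diagram p) x A C = (if saturated x (A <+> C) then {A} else {})"
      using that by (auto simp: middle_def saturated_identity Int_absorb2)
    then show ?thesis by simp
  qed
  show "compose_diagrams (identity_diagram p) x = x"
    by (rule composeI(1)[OF identity_diagram_diagrams x x]) (rule eq; assumption)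
  show "loops (identity_diagram p) x = 0"
    by (rule composeI(2)[OF identity_diagram_diagrams x x]) (rule eq; assumption)
qed

lemma compose_identity_right:
  assumes x: "x \<in> diagrams p r"
  shows "compose_diagrams x (identity_diagram r) = x" "loops x (identity_diagram r) = 0"
proof -
  have eq: "card (middle r x (identity_diagram r) A C) = (if saturated x (A <+> C) then 2 ^ 0 else 0)"
    if "A \<subseteq> seg p" "C \<subseteq> seg r" for A C
  proof -
    have "middle r x (identity_diagram r) A C = (if saturated x (A <+> C) then {C} else {})"
      using that by (auto simp: middle_def saturated_identity Int_absorb2)
    then show ?thesis by simp
  qed
  show "compose_diagrams x (identity_diagram r) = x"
    by (rule composeI(1)[OF x identity_diagram_diagrams x]) (rule eq; assumption)
  show "loops x (identity_diagram r) = 0"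
    by (rule composeI(2)[OF x identity_diagram_diagrams x]) (rule eq; assumption)
qed

lemma compose_relab:
  assumes g: "g \<in> Sym p" and x: "x \<in> diagrams p r" and y: "y \<in> diagrams r t"
  shows "compose_diagrams (relab g x) y = relab g (compose_diagrams x y)" "loops (relab g x) y = loops x y"
proof -
  have "middle r (relab g x) y A C = middle r x y (app g -` A) C" for A C
    by (simp add: middle_def saturated_relab)
  then have eq: "card (middle r (relab g x) y A C) =
      (if saturated (relab g (compose_diagrams x y)) (A <+> C) then 2 ^ loops x y else 0)" for A C
    by (simp add: card_middle[OF x y] saturated_relab)
  show "compose_diagrams (relab g x) y = relab g (compose_diagrams x y)"
    by (rule composeI(1)[OF relab_diagrams[OF g x] y relab_diagrams[OF g compose_in_diagrams[OF x y]]]) (rule eq)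
  show "loops (relab g x) y = loops x y"
    by (rule composeI(2)[OF relab_diagrams[OF g x] y relab_diagrams[OF g compose_in_diagrams[OF x y]]]) (rule eq)
qed

lemma permutation_diagram_relab: "permutation_diagram p (app g) = relab g (identity_diagram p)"
proof -
  have "permutation_diagram p (app g) = (\<lambda>i. {Inl (app g i), Inr i}) ` {1..p}"
    unfolding permutation_diagram_def by blast
  then show ?thesis by (simp add: relab_def identity_diagram_image image_image)
qed

lemma compose_permutation_diagram:
  assumes g: "g \<in> Sym p" and x: "x \<in> diagrams p r"
  shows "compose_diagrams (permutation_diagram p (app g)) x = relab g x" "loops (permutation_diagram p (app g)) x = 0"
  using compose_relab[OF g identity_diagram_diagrams x] compose_identity_left[OF x]
  by (simp_all add: permutation_diagram_relab)

text \<open>For stacks with an extra middle point \<open>Suc s\<close> whose colour is forced to be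
  \<open>b\<close> by the remaining colouring.\<close>

lemma card_extend:
  "card {B \<in> Pow (seg (Suc s)). (Suc s \<in> B \<longleftrightarrow> b) \<and> P (B \<inter> seg s)} = card {B \<in> Pow (seg s). P B}"
proof (rule bij_betw_same_card[where f = "\<lambda>B. B \<inter> seg s"], rule bij_betw_byWitness[where f' = "\<lambda>B. if b then insert (Suc s) B else B"])
  show "\<forall>B\<in>{B \<in> Pow (seg (Suc s)). (Suc s \<in> B \<longleftrightarrow> b) \<and> P (B \<inter> seg s)}. (if b then insert (Suc s) (B \<inter> seg s) else B \<inter> seg s) = B"
    by (auto simp: seg_Suc)
  show "\<forall>B\<in>{B \<in> Pow (seg s). P B}. (if b then insert (Suc s) B else B) \<inter> seg s = B"
    by auto
  show "(\<lambda>B. B \<inter> seg s) ` {B \<in> Pow (seg (Suc s)). (Suc s \<in> B \<longleftrightarrow> b) \<and> P (B \<inter> seg s)} \<subseteq> {B \<in> Pow (seg s). P B}"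
    by auto
  have "insert (Suc s) B \<inter> seg s = B" "B \<inter> seg s = B" "Suc s \<notin> B" if "B \<subseteq> seg s" for B
    using that by auto
  then show "(\<lambda>B. if b then insert (Suc s) B else B) ` {B \<in> Pow (seg s). P B} \<subseteq> {B \<in> Pow (seg (Suc s)). (Suc s \<in> B \<longleftrightarrow> b) \<and> P (B \<inter> seg s)}"
    by (auto simp: seg_Suc)
qed

text \<open>For \<open>q = r\<close> this is the inclusion of one Brauer algebra in the next; the
  general form embeds the diagrams that describe the summands of the restriction.\<close>

definition strand :: "nat \<Rightarrow> nat \<Rightarrow> diagram \<Rightarrow> diagram" where
  "strand q r d = insert {Inl (Suc q), Inr (Suc r)} d"

lemma strand_notin: "d \<in> diagrams q r \<Longrightarrow> {Inl (Suc q), Inr (Suc r)} \<notin> d"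
  using diagrams_subset[of d q r] by force

lemma strand_diagrams [intro]:
  assumes d: "d \<in> diagrams q r" shows "strand q r d \<in> diagrams (Suc q) (Suc r)"
proof -
  have e: "e \<inter> {Inl (Suc q), Inr (Suc r)} = {}" if "e \<in> d" for e
  proof -
    have "e \<subseteq> seg q <+> seg r" using diagrams_subset[OF d that] .
    then show ?thesis by auto
  qed
  show ?thesis
    unfolding diagrams_iff
  proof
    have "\<Union>(strand q r d) = seg (Suc q) <+> seg (Suc r)"
      unfolding strand_def Union_insert diagrams_Union[OF d] seg_Suc by auto
    moreover have "disjoint (strand q r d)"
      using e d unfolding strand_def diagrams_iff partition_on_def
      by (auto simp: disjoint_def Int_commute)
    moreover have "{} \<notin> strand q r d" using d by (auto simp: strand_def diagrams_iff partition_on_def)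
    ultimately show "partition_on (seg (Suc q) <+> seg (Suc r)) (strand q r d)" by (simp add: partition_on_def)
    show "\<forall>e\<in>strand q r d. card e = 2" using d by (auto simp: strand_def diagrams_iff)
  qed
qed

lemma saturated_strand:
  "saturated (strand q r d) (A <+> B) \<longleftrightarrow> (Suc q \<in> A \<longleftrightarrow> Suc r \<in> B) \<and> saturated d (A <+> B)"
  by (auto simp: strand_def saturated_insert)

lemma compose_strand:
  assumes x: "x \<in> diagrams q s" and y: "y \<in> diagrams s t"
  shows "compose_diagrams (strand q s x) (strand s t y) = strand q t (compose_diagrams x y)"
    and "loops (strand q s x) (strand s t y) = loops x y"
proof -
  have eq: "card (middle (Suc s) (strand q s x) (strand s t y) A C) =
    (if saturated (strand q t (compose_diagrams x y)) (A <+> C) then 2 ^ loops x y else 0)" for A C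
  proof (cases "Suc q \<in> A \<longleftrightarrow> Suc t \<in> C")
    case True
    have "middle (Suc s) (strand q s x) (strand s t y) A C =
        {B \<in> Pow (seg (Suc s)). (Suc s \<in> B \<longleftrightarrow> Suc q \<in> A) \<and> (saturated x (A <+> (B \<inter> seg s)) \<and> saturated y ((B \<inter> seg s) <+> C))}"
      unfolding middle_def
    proof (rule Collect_cong)
      fix B
      have "saturated x (A <+> B) \<longleftrightarrow> saturated x (A <+> (B \<inter> seg s))" by (rule saturated_diagram_cong[OF x]) auto
      moreover have "saturated y (B <+> C) \<longleftrightarrow> saturated y ((B \<inter> seg s) <+> C)" by (rule saturated_diagram_cong[OF y]) auto
      ultimately show "(B \<in> Pow (seg (Suc s)) \<and> saturated (strand q s x) (A <+> B) \<and> saturated (strand s t y) (B <+> C)) \<longleftrightarrow>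
          (B \<in> Pow (seg (Suc s)) \<and> (Suc s \<in> B \<longleftrightarrow> Suc q \<in> A) \<and> (saturated x (A <+> (B \<inter> seg s)) \<and> saturated y ((B \<inter> seg s) <+> C)))"
        using True unfolding saturated_strand by blast
    qed
    then have "card (middle (Suc s) (strand q s x) (strand s t y) A C) = card (middle s x y A C)"
      by (simp only: card_extend[where P = "\<lambda>B. saturated x (A <+> B) \<and> saturated y (B <+> C)"] middle_def)
    then show ?thesis using True by (simp add: card_middle[OF x y] saturated_strand)
  next
    case False
    then have "middle (Suc s) (strand q s x) (strand s t y) A C = {}"
      unfolding middle_def saturated_strand by blast
    then show ?thesis using False by (simp add: saturated_strand)
  qed
  show "compose_diagrams (strand q s x) (strand s t y) = strand q t (compose_diagrams x y)"
    by (rule composeI(1)[OF strand_diagrams[OF x] strand_diagrams[OF y] strand_diagrams[OF compose_in_diagrams[OF x y]]]) (rule eq)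
  show "loops (strand q s x) (strand s t y) = loops x y"
    by (rule composeI(2)[OF strand_diagrams[OF x] strand_diagrams[OF y] strand_diagrams[OF compose_in_diagrams[OF x y]]]) (rule eq)
qed

section \<open>Bending the last bottom point up\<close>

definition bend_point :: "nat \<Rightarrow> nat \<Rightarrow> nat + nat \<Rightarrow> nat + nat" where
  "bend_point p r v = (if v = Inr (Suc r) then Inl (Suc p) else v)"

definition unbend_point :: "nat \<Rightarrow> nat \<Rightarrow> nat + nat \<Rightarrow> nat + nat" where
  "unbend_point p r v = (if v = Inl (Suc p) then Inr (Suc r) else v)"

definition bend :: "nat \<Rightarrow> nat \<Rightarrow> diagram \<Rightarrow> diagram" where
  "bend p r d = (`) (bend_point p r) ` d"

definition unbend :: "nat \<Rightarrow> nat \<Rightarrow> diagram \<Rightarrow> diagram" where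
  "unbend p r d = (`) (unbend_point p r) ` d"

lemma bend_diagrams [intro]: "d \<in> diagrams p (Suc r) \<Longrightarrow> bend p r d \<in> diagrams (Suc p) r"
  unfolding bend_def
proof (erule diagrams_image)
  show "inj_on (bend_point p r) (seg p <+> seg (Suc r))"
    by (auto simp: inj_on_def bend_point_def)
  show "bend_point p r ` (seg p <+> seg (Suc r)) = seg (Suc p) <+> seg r"
  proof -
    have "bend_point p r ` (seg p <+> seg r) = seg p <+> seg r"
      by (rule image_id_on) (auto simp: bend_point_def)
    moreover have "seg p <+> seg (Suc r) = insert (Inr (Suc r)) (seg p <+> seg r)" by (auto simp: seg_Suc)
    moreover have "seg (Suc p) <+> seg r = insert (Inl (Suc p)) (seg p <+> seg r)" by (auto simp: seg_Suc)
    ultimately show ?thesis by (simp only: image_insert) (simp add: bend_point_def)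
  qed
qed

lemma unbend_diagrams [intro]: "d \<in> diagrams (Suc p) r \<Longrightarrow> unbend p r d \<in> diagrams p (Suc r)"
  unfolding unbend_def
proof (erule diagrams_image)
  show "inj_on (unbend_point p r) (seg (Suc p) <+> seg r)"
    by (auto simp: inj_on_def unbend_point_def)
  show "unbend_point p r ` (seg (Suc p) <+> seg r) = seg p <+> seg (Suc r)"
  proof -
    have "unbend_point p r ` (seg p <+> seg r) = seg p <+> seg r"
      by (rule image_id_on) (auto simp: unbend_point_def)
    moreover have "seg p <+> seg (Suc r) = insert (Inr (Suc r)) (seg p <+> seg r)" by (auto simp: seg_Suc)
    moreover have "seg (Suc p) <+> seg r = insert (Inl (Suc p)) (seg p <+> seg r)" by (auto simp: seg_Suc)
    ultimately show ?thesis by (simp only: image_insert) (simp add: unbend_point_def)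
  qed
qed

lemma image_image_id:
  assumes "\<And>e v. e \<in> d \<Longrightarrow> v \<in> e \<Longrightarrow> f (h v) = v"
  shows "(`) f ` ((`) h ` d) = d"
proof -
  have "f ` h ` e = e" if "e \<in> d" for e
    using assms[OF that] by (auto simp: image_image image_iff)
  then show ?thesis by (simp add: image_image)
qed

lemma unbend_bend: 
  assumes d: "d \<in> diagrams p (Suc r)" shows "unbend p r (bend p r d) = d"
  unfolding unbend_def bend_def
proof (rule image_image_id)
  fix e v assume "e \<in> d" "v \<in> e"
  then have "v \<in> seg p <+> seg (Suc r)" using diagrams_subset[OF d] by blast
  then show "unbend_point p r (bend_point p r v) = v" by (auto simp: bend_point_def unbend_point_def)
qed

lemma bend_unbend: 
  assumes d: "d \<in> diagrams (Suc p) r" shows "bend p r (unbend p r d) = d"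
  unfolding unbend_def bend_def
proof (rule image_image_id)
  fix e v assume "e \<in> d" "v \<in> e"
  then have "v \<in> seg (Suc p) <+> seg r" using diagrams_subset[OF d] by blast
  then show "bend_point p r (unbend_point p r v) = v" by (auto simp: bend_point_def unbend_point_def)
qed

text \<open>The bottom colouring before bending: the last bottom point has the colour that the new
  top point \<open>Suc p\<close> has afterwards.\<close>

definition bent_bottom :: "nat \<Rightarrow> nat \<Rightarrow> nat set \<Rightarrow> nat set \<Rightarrow> nat set" where
  "bent_bottom p r A B = (B \<inter> seg r) \<union> (if Suc p \<in> A then {Suc r} else {})"

lemma saturated_bend:
  assumes d: "d \<in> diagrams p (Suc r)"
  shows "saturated (bend p r d) (A <+> B) \<longleftrightarrow> saturated d (A <+> bent_bottom p r A B)"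
  unfolding bend_def saturated_image
proof (rule saturated_restrict)
  show "partition_on (seg p <+> seg (Suc r)) d" using d by (simp add: diagrams_iff)
  show "bend_point p r -` (A <+> B) \<inter> (seg p <+> seg (Suc r)) = (A <+> bent_bottom p r A B) \<inter> (seg p <+> seg (Suc r))"
    by (auto simp: bend_point_def bent_bottom_def seg_Suc split: if_splits)
qed

text \<open>The strand attached to \<open>y\<close> carries the last bottom point of
  \<open>x\<close> unchanged through the composite, so it can be bent up before or after the
  multiplication. For the counts, its colour in the middle row is fixed by the colour of
  \<open>Suc p\<close>.\<close>

lemma compose_bend:
  assumes x: "x \<in> diagrams p (Suc r)" and y: "y \<in> diagrams r t"
  shows "compose_diagrams (bend p r x) y = bend p t (compose_diagrams x (strand r t y))"
    and "loops (bend p r x) y = loops x (strand r t y)"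
proof -
  let ?y = "strand r t y"
  have y': "?y \<in> diagrams (Suc r) (Suc t)" using y by blast
  have eq: "card (middle r (bend p r x) y A C) =
    (if saturated (bend p t (compose_diagrams x ?y)) (A <+> C) then 2 ^ loops x ?y else 0)" for A C
  proof -
    let ?C = "bent_bottom p t A C"
    have bb: "bent_bottom p r A (B \<inter> seg r) = B" if "B \<subseteq> seg (Suc r)" "Suc r \<in> B \<longleftrightarrow> Suc p \<in> A" for B
      using that by (auto simp: bent_bottom_def seg_Suc)
    have tC: "Suc t \<in> ?C \<longleftrightarrow> Suc p \<in> A" by (auto simp: bent_bottom_def)
    have yC: "saturated y (B <+> ?C) \<longleftrightarrow> saturated y ((B \<inter> seg r) <+> C)" for B
      by (rule saturated_diagram_cong[OF y]) (auto simp: bent_bottom_def)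
    have "middle (Suc r) x ?y A ?C = {B \<in> Pow (seg (Suc r)). (Suc r \<in> B \<longleftrightarrow> Suc p \<in> A) \<and>
        (saturated (bend p r x) (A <+> (B \<inter> seg r)) \<and> saturated y ((B \<inter> seg r) <+> C))}"
      unfolding middle_def
    proof (rule Collect_cong)
      fix B
      show "(B \<in> Pow (seg (Suc r)) \<and> saturated x (A <+> B) \<and> saturated ?y (B <+> ?C)) \<longleftrightarrow>
        (B \<in> Pow (seg (Suc r)) \<and> (Suc r \<in> B \<longleftrightarrow> Suc p \<in> A) \<and>
        (saturated (bend p r x) (A <+> (B \<inter> seg r)) \<and> saturated y ((B \<inter> seg r) <+> C)))"
      proof (cases "B \<in> Pow (seg (Suc r)) \<and> (Suc r \<in> B \<longleftrightarrow> Suc p \<in> A)")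
        case True
        then show ?thesis unfolding saturated_strand tC yC saturated_bend[OF x] using bb[of B] by simp
      qed (auto simp: saturated_strand tC)
    qed
    then have "card (middle (Suc r) x ?y A ?C) = card (middle r (bend p r x) y A C)"
      by (simp only: card_extend[where P = "\<lambda>B. saturated (bend p r x) (A <+> B) \<and> saturated y (B <+> C)"] middle_def)
    then show ?thesis
      by (simp add: card_middle[OF x y'] saturated_bend[OF compose_in_diagrams[OF x y']])
  qed
  show "compose_diagrams (bend p r x) y = bend p t (compose_diagrams x ?y)"
    by (rule composeI(1)[OF bend_diagrams[OF x] y bend_diagrams[OF compose_in_diagrams[OF x y']]]) (rule eq)
  show "loops (bend p r x) y = loops x ?y"
    by (rule composeI(2)[OF bend_diagrams[OF x] y bend_diagrams[OF compose_in_diagrams[OF x y']]]) (rule eq)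
qed

lemma bend_relab:
  assumes "g \<in> Sym p" shows "bend p r (relab g d) = relab g (bend p r d)"
proof -
  have "app g (Suc p) = Suc p" using Sym_app_out[OF assms] by simp
  then have "bend_point p r (map_sum (app g) id v) = map_sum (app g) id (bend_point p r v)" for v
    by (cases v) (auto simp: bend_point_def)
  then show ?thesis by (simp add: bend_def relab_def image_image)
qed

lemma strand_relab:
  assumes "g \<in> Sym q" shows "relab g (strand q r d) = strand q r (relab g d)"
  using Sym_app_out[OF assms, of "Suc q"] by (simp add: strand_def relab_def)

section \<open>Diagrams with all top points propagating\<close>

text \<open>For diagrams with \<open>p\<close> top points this says that the propagating number is
  \<open>p\<close>. Being stated edge by edge, it is easily followed through relabelling, strands
  and bending.\<close>

definition top_free :: "diagram \<Rightarrow> bool" where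
  "top_free d \<longleftrightarrow> (\<forall>e\<in>d. \<not> e \<subseteq> range Inl)"

text \<open>Each propagating edge contains one top point and each edge joining two top points
  contains two, so \<open>p\<close> is the propagating number plus twice the number of the
  latter.\<close>

lemma propagating_number_le:
  assumes d: "d \<in> diagrams p r"
  shows "propagating_number d \<le> p" "propagating_number d = p \<longleftrightarrow> top_free d"
proof -
  have fd: "finite d" by (rule diagrams_finite[OF d])
  let ?M = "{e \<in> d. e \<inter> range Inl \<noteq> {} \<and> e \<inter> range Inr \<noteq> {}}" and ?T = "{e \<in> d. e \<subseteq> range Inl}"
  have c: "card (e \<inter> range Inl) = (if e \<in> ?M then 1 else 0) + (if e \<in> ?T then 2 else 0)" if e: "e \<in> d" for e
  proof -
    obtain v w where vw: "e = {v, w}" "v \<noteq> w" using diagrams_edge[OF d e] by blast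
    show ?thesis using vw e by (cases v; cases w) auto
  qed
  have "Inl ` seg p = (\<Union>e\<in>d. e \<inter> range Inl)"
    using diagrams_Union[OF d] by (auto simp: set_eq_iff)
  moreover have "card (Inl ` seg p :: (nat + nat) set) = p" by (simp add: card_image)
  ultimately have "p = card (\<Union>e\<in>d. e \<inter> range Inl)" by simp
  also have "\<dots> = (\<Sum>e\<in>d. card (e \<inter> range Inl))"
  proof (rule card_UN_disjoint[OF fd])
    show "\<forall>e\<in>d. finite (e \<inter> range Inl)" using diagrams_edge[OF d] by fastforce
    show "\<forall>e\<in>d. \<forall>e'\<in>d. e \<noteq> e' \<longrightarrow> (e \<inter> range Inl) \<inter> (e' \<inter> range Inl) = {}"
      using diagrams_disjoint[OF d] by blast
  qed
  also have "\<dots> = (\<Sum>e\<in>d. if e \<in> ?M then 1 else 0) + (\<Sum>e\<in>d. if e \<in> ?T then 2 else 0)"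
    by (simp only: c sum.distrib cong: sum.cong)
  also have "\<dots> = card ?M + 2 * card ?T"
    using fd by (simp add: sum.If_cases Int_def)
  finally have p: "p = propagating_number d + 2 * card ?T" by (simp add: propagating_number_def)
  then show "propagating_number d \<le> p" by simp
  have "propagating_number d = p \<longleftrightarrow> ?T = {}" using p fd by auto
  then show "propagating_number d = p \<longleftrightarrow> top_free d" by (auto simp: top_free_def)
qed

definition through :: "nat \<Rightarrow> nat \<Rightarrow> diagram set" where "through p r = {d \<in> diagrams p r. top_free d}"

lemma diagrams_prop_through: "diagrams_prop p r p = through p r"
  using propagating_number_le(2) by (auto simp: diagrams_prop_def through_def)

lemma truncated_mult_eq:
  assumes "x \<in> diagrams p r" "y \<in> diagrams r t"
  shows "truncated_mult \<delta> p x y =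
    (if top_free (compose_diagrams x y) then Poly_Mapping.single (compose_diagrams x y) (\<delta> ^ loops x y) else 0)"
  using propagating_number_le[OF compose_in_diagrams[OF assms]]
  by (auto simp: truncated_mult_def diagram_mult_def)

text \<open>An edge \<open>e\<close> of \<open>x\<close> joining two top points survives in the
  composite. Colour the edge \<open>e'\<close> of the composite at an end of \<open>e\<close>; some
  middle colouring is compatible with this, so \<open>x\<close> forces both ends of \<open>e\<close>
  to have the colour of \<open>e'\<close>, and \<open>e = e'\<close>.\<close>

lemma top_free_compose:
  assumes x: "x \<in> diagrams p r" and y: "y \<in> diagrams r t" and tf: "top_free (compose_diagrams x y)"
  shows "top_free x"
proof (rule ccontr)
  assume "\<not> top_free x"
  then obtain e where e: "e \<in> x" "e \<subseteq> range Inl" by (auto simp: top_free_def)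
  let ?z = "compose_diagrams x y"
  have z: "?z \<in> diagrams p t" by (rule compose_in_diagrams[OF x y])
  have ce: "card e = 2" using x e(1) by (simp add: diagrams_iff)
  then obtain a where a: "a \<in> e" by fastforce
  have "a \<in> seg p <+> seg t" using a e(2) diagrams_subset[OF x e(1)] by auto
  then obtain e' where e': "e' \<in> ?z" "a \<in> e'" using diagrams_Union[OF z] by blast
  have eq: "e' = (Inl -` e') <+> (Inr -` e')"
  proof (rule Set.set_eqI)
    fix v show "v \<in> e' \<longleftrightarrow> v \<in> (Inl -` e') <+> (Inr -` e')" by (cases v) auto
  qed
  have "saturated ?z ((Inl -` e') <+> (Inr -` e'))"
    using diagrams_saturated_self[OF z e'(1)] by (simp flip: eq)
  then have "card (middle r x y (Inl -` e') (Inr -` e')) \<noteq> 0" using card_middle[OF x y] by simp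
  then have "middle r x y (Inl -` e') (Inr -` e') \<noteq> {}" by auto
  then obtain B where "saturated x ((Inl -` e') <+> B)" by (auto simp: middle_def)
  then have "e \<subseteq> (Inl -` e') <+> B \<or> e \<inter> ((Inl -` e') <+> B) = {}" using e(1) by (simp add: saturated_def)
  then have "e \<subseteq> e'" using a e'(2) e(2) by auto
  moreover have "card e' = 2" using z e'(1) by (simp add: diagrams_iff)
  ultimately have "e = e'" using ce by (metis card_subset_eq card.infinite zero_neq_numeral)
  then show False using e(2) e'(1) tf by (auto simp: top_free_def)
qed

lemma top_free_relab [simp]: "top_free (relab g d) \<longleftrightarrow> top_free d"
proof -
  have "map_sum (app g) id ` e \<subseteq> range Inl \<longleftrightarrow> e \<subseteq> range Inl" for e :: "(nat + nat) set"
  proof -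
    have "map_sum (app g) id v \<in> range Inl \<longleftrightarrow> v \<in> range Inl" for v :: "nat + nat"
      by (cases v) auto
    then show ?thesis by blast
  qed
  then show ?thesis by (simp add: top_free_def relab_def)
qed

lemma top_free_strand [simp]: "top_free (strand q r d) \<longleftrightarrow> top_free d"
  by (auto simp: top_free_def strand_def)

lemma top_free_bend: "top_free (bend p r d) \<Longrightarrow> top_free d"
  unfolding top_free_def bend_def
proof
  fix e assume t: "\<forall>e\<in>(`) (bend_point p r) ` d. \<not> e \<subseteq> range Inl" and e: "e \<in> d"
  have "bend_point p r ` e = e" if "e \<subseteq> range Inl"
    by (rule image_id_on) (use that in \<open>auto simp: bend_point_def\<close>)
  then show "\<not> e \<subseteq> range Inl" using t e by force
qed

lemma relab_through [intro]: "g \<in> Sym p \<Longrightarrow> d \<in> through p r \<Longrightarrow> relab g d \<in> through p r"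
  by (auto simp: through_def)

lemma strand_through [intro]: "d \<in> through q r \<Longrightarrow> strand q r d \<in> through (Suc q) (Suc r)"
  by (auto simp: through_def)

lemma bend_relab_strand_not_top_free:
  assumes g: "g \<in> Sym (Suc q)" shows "\<not> top_free (bend (Suc q) r (relab g (strand q r d)))"
proof -
  have "bend_point (Suc q) r ` map_sum (app g) id ` {Inl (Suc q), Inr (Suc r)} \<in> bend (Suc q) r (relab g (strand q r d))"
    by (simp add: bend_def relab_def strand_def)
  moreover have "bend_point (Suc q) r ` map_sum (app g) id ` {Inl (Suc q), Inr (Suc r)} \<subseteq> range Inl"
    by (simp add: bend_point_def)
  ultimately show ?thesis unfolding top_free_def by blast
qed

text \<open>The offending edge must join the last bottom point to a top point \<open>i\<close>. The
  transposition of \<open>i\<close> and the last top point turns it into the final strand, which can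
  be removed; so such diagrams are relabelled strands on diagrams with one point less on either
  side.\<close>

lemma bend_not_top_free:
  assumes d: "d \<in> through p (Suc r)" and ntf: "\<not> top_free (bend p r d)"
  obtains q g d0 where "p = Suc q" "g \<in> Sym p" "d0 \<in> through q r" "d = relab g (strand q r d0)"
proof -
  have dd: "d \<in> diagrams p (Suc r)" and tf: "top_free d" using d by (auto simp: through_def)
  obtain e where e: "e \<in> d" "bend_point p r ` e \<subseteq> range Inl" using ntf by (auto simp: top_free_def bend_def)
  have "Inr (Suc r) \<in> e"
  proof (rule ccontr)
    assume "Inr (Suc r) \<notin> e"
    have "bend_point p r ` e = e"
      by (rule image_id_on) (use \<open>Inr (Suc r) \<notin> e\<close> in \<open>auto simp: bend_point_def\<close>)
    then show False using e tf by (simp add: top_free_def)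
  qed
  moreover obtain v w where vw: "e = {v, w}" "v \<noteq> w" using diagrams_edge[OF dd e(1)] by blast
  ultimately have "(v = Inr (Suc r) \<and> e = {w, Inr (Suc r)} \<and> w \<noteq> Inr (Suc r)) \<or> (w = Inr (Suc r) \<and> e = {v, Inr (Suc r)} \<and> v \<noteq> Inr (Suc r))"
    by auto
  then obtain u where u: "e = {u, Inr (Suc r)}" "u \<noteq> Inr (Suc r)" by metis
  have "bend_point p r u \<in> range Inl" using e(2) u(1) by blast
  then obtain i where i: "u = Inl i" using u(2) by (auto simp: bend_point_def)
  have ip: "i \<in> seg p" using diagrams_subset[OF dd e(1)] u i by auto
  then obtain q where q: "p = Suc q" by (cases p) (auto simp: seg_def)
  \<comment> \<open>An involution moving the top end \<open>i\<close> to the last position, so that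
    it serves in both directions.\<close>
  define g where "g = Fperm (transpose i (Suc q))"
  have perm: "transpose i (Suc q) permutes {1..Suc q}" using ip q by (auto simp: seg_def intro!: permutes_swap_id)
  have g: "g \<in> Sym p" unfolding g_def q using perm by (rule Sym_Fperm)
  have ag: "app g = transpose i (Suc q)" unfolding g_def using perm by (simp add: app_Fperm)
  define d' where "d' = relab (- g) d"
  have d': "d' \<in> through p (Suc r)" unfolding d'_def using g d by (intro relab_through) auto
  let ?e = "{Inl (Suc q), Inr (Suc r)} :: (nat + nat) set"
  have "app (- g) i = Suc q" by (metis ag app_uminus_app transpose_apply_second)
  then have e': "?e \<in> d'" unfolding d'_def relab_def using e(1) u i by (auto simp: image_iff intro!: bexI[of _ e])
  define d0 where "d0 = d' - {?e}"
  have d'_eq: "d' = strand q r d0" using e' by (auto simp: d0_def strand_def)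
  have dd': "d' \<in> diagrams (Suc q) (Suc r)" using d' q by (simp add: through_def)
  have disj: "f \<inter> ?e = {}" if "f \<in> d0" for f
    using that e' diagrams_disjoint[OF dd', of f ?e] by (auto simp: d0_def)
  have "\<Union>d' = ?e \<union> \<Union>d0" by (simp add: d'_eq strand_def)
  then have "seg (Suc q) <+> seg (Suc r) = ?e \<union> \<Union>d0" using diagrams_Union[OF dd'] by simp
  then have "\<Union>d0 = (seg (Suc q) <+> seg (Suc r)) - ?e" using disj by blast
  also have "\<dots> = seg q <+> seg r" by (auto simp: seg_Suc)
  finally have "d0 \<in> diagrams q r"
    using dd' by (auto simp: diagrams_iff partition_on_def d0_def disjoint_def)
  moreover have "top_free d0" using d' by (simp add: through_def d'_eq)
  ultimately have "d0 \<in> through q r" by (simp add: through_def)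
  moreover have "d = relab g (strand q r d0)" by (simp flip: d'_eq add: d'_def)
  ultimately show ?thesis using that q g by blast
qed

section \<open>The bimodules of diagrams\<close>

abbreviation act :: "'k perm_alg \<Rightarrow> 'k diagram_comb \<Rightarrow> 'k::comm_ring_1 diagram_comb" where
  "act \<equiv> bilinear_ext (\<lambda>g d. mon (relab g d))"

abbreviation rmul :: "'k \<Rightarrow> nat \<Rightarrow> 'k diagram_comb \<Rightarrow> 'k diagram_comb \<Rightarrow> 'k::comm_ring_1 diagram_comb" where
  "rmul \<delta> p \<equiv> bilinear_ext (truncated_mult \<delta> p)"

abbreviation bmul :: "'k \<Rightarrow> 'k diagram_comb \<Rightarrow> 'k diagram_comb \<Rightarrow> 'k::comm_ring_1 diagram_comb" where
  "bmul \<delta> \<equiv> bilinear_ext (diagram_mult \<delta>)"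

abbreviation through_span :: "nat \<Rightarrow> nat \<Rightarrow> ('k::comm_ring_1 diagram_comb) set" where
  "through_span p r \<equiv> free_on (through p r)"

abbreviation diagram_span :: "nat \<Rightarrow> nat \<Rightarrow> ('k::comm_ring_1 diagram_comb) set" where
  "diagram_span r t \<equiv> free_on (diagrams r t)"

section \<open>The commuting left and right actions\<close>

lemma through_D: "d \<in> through p r \<Longrightarrow> d \<in> diagrams p r" by (simp add: through_def)

lemma trilin_eqI:
  assumes "\<And>b c. lin (\<lambda>a. F a b c)" "\<And>b c. lin (\<lambda>a. G a b c)" "\<And>a c. lin (\<lambda>b. F a b c)" "\<And>a c. lin (\<lambda>b. G a b c)"
    and "\<And>a b. lin (\<lambda>c. F a b c)" "\<And>a b. lin (\<lambda>c. G a b c)"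
    and "a \<in> free_on S" "b \<in> free_on T" "c \<in> free_on V"
    and "\<And>x y z. x \<in> S \<Longrightarrow> y \<in> T \<Longrightarrow> z \<in> V \<Longrightarrow> F (mon x) (mon y) (mon z) = G (mon x) (mon y) (mon z)"
  shows "F a b c = G a b c"
proof (rule lin_eqI[where F = "\<lambda>a. F a b c" and G = "\<lambda>a. G a b c", OF assms(1,2,7)])
  fix x assume x: "x \<in> S"
  show "F (mon x) b c = G (mon x) b c"
    by (rule bilin_eqI[of "F (mon x)" "G (mon x)", OF assms(3,4,5,6,8,9)]) (rule assms(10)[OF x])
qed

lemma act_mult: "act (a * b) x = act a (act b x)"
  by (rule trilin_eqI[of "\<lambda>a b x. act (a * b) x" "\<lambda>a b x. act a (act b x)" _ UNIV _ UNIV _ UNIV])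
    (auto intro!: lin_intros simp: mult_single relab_add free_on_iff)

lemma act_zero_right [simp]: "act a 0 = 0"
  by (rule lin_0[of "\<lambda>x. act a x"]) (intro lin_intros)

lemma act_closed:
  assumes "a \<in> sym_alg p" "x \<in> through_span p r" shows "act a x \<in> through_span p r"
  by (rule bilinear_ext_closed[OF assms]) (auto intro!: free_on_single)

lemma truncated_mult_closed:
  assumes "x \<in> diagrams p r" "y \<in> diagrams r t" shows "truncated_mult \<delta> p x y \<in> through_span p t"
  unfolding truncated_mult_eq[OF assms] using compose_in_diagrams[OF assms] by (simp add: through_def)

lemma rmul_closed:
  assumes "x \<in> through_span p r" "a \<in> diagram_span r t" shows "rmul \<delta> p x a \<in> through_span p t"
  by (rule bilinear_ext_closed[OF assms]) (rule truncated_mult_closed, auto dest: through_D)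

lemma act_rmul:
  assumes "a \<in> sym_alg p" "x \<in> through_span p r" "b \<in> diagram_span r t"
  shows "act a (rmul \<delta> p x b) = rmul \<delta> p (act a x) b"
proof (rule trilin_eqI[of "\<lambda>a x b. act a (rmul \<delta> p x b)" "\<lambda>a x b. rmul \<delta> p (act a x) b", OF _ _ _ _ _ _ assms])
  fix g x y assume g: "g \<in> Sym p" and x: "x \<in> through p r" and y: "y \<in> diagrams r t"
  show "act (mon g) (rmul \<delta> p (mon x) (mon y)) = rmul \<delta> p (act (mon g) (mon x)) (mon y)"
    using truncated_mult_eq[OF through_D[OF x] y, of \<delta>] truncated_mult_eq[OF relab_diagrams[OF g through_D[OF x]] y, of \<delta>]
      compose_relab[OF g through_D[OF x] y]
    by simp
qed (intro lin_intros)+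

text \<open>Truncating after the first step does no harm: a joined pair of top points stays joined
  in every further product, by \<open>top_free_compose\<close>.\<close>

lemma rmul_assoc:
  assumes "x \<in> through_span p r" "a \<in> diagram_span r s" "b \<in> diagram_span s t"
  shows "rmul \<delta> p (rmul \<delta> p x a) b = rmul \<delta> p x (bmul \<delta> a b)"
proof (rule trilin_eqI[of "\<lambda>x a b. rmul \<delta> p (rmul \<delta> p x a) b" "\<lambda>x a b. rmul \<delta> p x (bmul \<delta> a b)", OF _ _ _ _ _ _ assms])
  fix x a b assume x: "x \<in> through p r" and a: "a \<in> diagrams r s" and b: "b \<in> diagrams s t"
  have xa: "compose_diagrams x a \<in> diagrams p s" and ab: "compose_diagrams a b \<in> diagrams r t"
    using compose_in_diagrams through_D[OF x] a b by blast+
  have z: "rmul \<delta> p 0 c = 0" for c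
    by (rule lin_0[of "\<lambda>x. rmul \<delta> p x c"]) (intro lin_intros)
  have tf: "top_free (compose_diagrams x (compose_diagrams a b)) \<Longrightarrow> top_free (compose_diagrams x a)"
    using top_free_compose[OF xa b] compose_assoc(1)[OF through_D[OF x] a b] by simp
  have "rmul \<delta> p (rmul \<delta> p (mon x) (mon a)) (mon b) =
    (if top_free (compose_diagrams (compose_diagrams x a) b)
     then Poly_Mapping.single (compose_diagrams (compose_diagrams x a) b) (\<delta> ^ (loops x a + loops (compose_diagrams x a) b)) else 0)"
    using tf compose_assoc(1)[OF through_D[OF x] a b]
    by (simp add: truncated_mult_eq[OF through_D[OF x] a] truncated_mult_eq[OF xa b] z power_add)
  also have "\<dots> = rmul \<delta> p (mon x) (bmul \<delta> (mon a) (mon b))"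
    using compose_assoc[OF through_D[OF x] a b]
    by (simp add: truncated_mult_eq[OF through_D[OF x] ab] diagram_mult_def power_add)
  finally show "rmul \<delta> p (rmul \<delta> p (mon x) (mon a)) (mon b) = rmul \<delta> p (mon x) (bmul \<delta> (mon a) (mon b))" .
qed (intro lin_intros)+

lemma rmul_identity:
  assumes "x \<in> through_span p r" shows "rmul \<delta> p x (mon (identity_diagram r)) = x"
proof (rule lin_eqI[of "\<lambda>x. rmul \<delta> p x (mon (identity_diagram r))" "\<lambda>x. x", OF _ _ assms])
  fix x assume x: "x \<in> through p r"
  show "rmul \<delta> p (mon x) (mon (identity_diagram r)) = mon x"
    using x truncated_mult_eq[OF through_D[OF x] identity_diagram_diagrams, of \<delta>] compose_identity_right[OF through_D[OF x]]
    by (simp add: through_def)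
qed (intro lin_intros)+

lemma bmul_closed: "a \<in> diagram_span r s \<Longrightarrow> b \<in> diagram_span s t \<Longrightarrow> bmul \<delta> a b \<in> diagram_span r t"
  by (rule bilinear_ext_closed) (auto simp: diagram_mult_def compose_in_diagrams)

definition iota :: "nat \<Rightarrow> nat \<Rightarrow> 'k::comm_ring_1 diagram_comb \<Rightarrow> 'k diagram_comb" where
  "iota q r = linear_ext (\<lambda>d. mon (strand q r d))"

text \<open>The quotient map of the extension. Diagrams in which bending joins two top points are
  sent to zero, in accordance with the truncated product on the target.\<close>

definition beta :: "nat \<Rightarrow> nat \<Rightarrow> 'k::comm_ring_1 diagram_comb \<Rightarrow> 'k diagram_comb" where
  "beta p r = linear_ext (\<lambda>d. if top_free (bend p r d) then mon (bend p r d) else 0)"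

text \<open>A left inverse of \<open>iota q r\<close> on \<open>diagram_span q r\<close>, used to
  show that the summands of the restriction are independent.\<close>

definition unstrand :: "nat \<Rightarrow> nat \<Rightarrow> 'k::comm_ring_1 diagram_comb \<Rightarrow> 'k diagram_comb" where
  "unstrand q r = linear_ext (\<lambda>d. if {Inl (Suc q), Inr (Suc r)} \<in> d then mon (d - {{Inl (Suc q), Inr (Suc r)}}) else 0)"

lemma lin_iota [lin_intros]: "lin F \<Longrightarrow> lin (\<lambda>x. iota q r (F x))"
  and lin_beta [lin_intros]: "lin F \<Longrightarrow> lin (\<lambda>x. beta q r (F x))"
  and lin_unstrand [lin_intros]: "lin F \<Longrightarrow> lin (\<lambda>x. unstrand q r (F x))"
  unfolding iota_def beta_def unstrand_def by (rule lin_comp_linear_ext; assumption)+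

lemma iota_single [simp]: "iota q r (Poly_Mapping.single d c) = Poly_Mapping.single (strand q r d) c"
  by (simp add: iota_def)

lemma beta_single [simp]: "beta p r (Poly_Mapping.single d c) =
    (if top_free (bend p r d) then Poly_Mapping.single (bend p r d) c else 0)"
  by (simp add: beta_def)

lemma beta_zero [simp]: "beta p r 0 = 0" by (rule lin_0[OF lin_beta[OF lin_ident]])
lemma iota_zero [simp]: "iota p r 0 = 0" by (rule lin_0[OF lin_iota[OF lin_ident]])
lemma rmul_zero_left [simp]: "rmul \<delta> p 0 c = 0"
  by (rule lin_0[of "\<lambda>x. rmul \<delta> p x c"]) (intro lin_intros)
lemma act_zero_left [simp]: "act 0 x = 0"
  by (rule lin_0[of "\<lambda>a. act a x"]) (intro lin_intros)

lemma brauer_inclusion_eq_iota: "brauer_inclusion r = iota r r"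
  by (simp add: brauer_inclusion_def iota_def strand_def)

lemma iota_diagram_span: "a \<in> diagram_span r s \<Longrightarrow> iota r s a \<in> diagram_span (Suc r) (Suc s)"
  by (rule lin_closed[where F = "iota r s"]) (auto intro!: lin_intros free_on_single)

lemma iota_through_span: "x \<in> through_span q r \<Longrightarrow> iota q r x \<in> through_span (Suc q) (Suc r)"
  by (rule lin_closed[where F = "iota q r"]) (auto intro!: lin_intros free_on_single)

lemma iota_bmul:
  assumes "a \<in> diagram_span q s" "b \<in> diagram_span s t"
  shows "iota q t (bmul \<delta> a b) = bmul \<delta> (iota q s a) (iota s t b)"
  by (rule bilin_eqI[of "\<lambda>a b. iota q t (bmul \<delta> a b)" "\<lambda>a b. bmul \<delta> (iota q s a) (iota s t b)", OF _ _ _ _ assms])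
    (auto intro!: lin_intros simp: diagram_mult_def compose_strand)

lemma strand_identity: "strand r r (identity_diagram r) = identity_diagram (Suc r)"
  unfolding strand_def identity_diagram_image by (auto simp: atLeastAtMostSuc_conv)

lemma iota_identity: "iota r r (mon (identity_diagram r)) = mon (identity_diagram (Suc r))"
  by (simp add: strand_identity)

lemma iota_rmul:
  assumes "x \<in> through_span q s" "b \<in> diagram_span s t"
  shows "iota q t (rmul \<delta> q x b) = rmul \<delta> (Suc q) (iota q s x) (iota s t b)"
proof (rule bilin_eqI[of "\<lambda>a b. iota q t (rmul \<delta> q a b)" "\<lambda>a b. rmul \<delta> (Suc q) (iota q s a) (iota s t b)", OF _ _ _ _ assms])
  fix x y assume x: "x \<in> through q s" and y: "y \<in> diagrams s t"
  show "iota q t (rmul \<delta> q (mon x) (mon y)) = rmul \<delta> (Suc q) (iota q s (mon x)) (iota s t (mon y))"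
    using truncated_mult_eq[OF through_D[OF x] y, of \<delta>] truncated_mult_eq[OF strand_diagrams[OF through_D[OF x]] strand_diagrams[OF y], of \<delta>]
      compose_strand[OF through_D[OF x] y]
    by simp
qed (intro lin_intros)+

lemma iota_act:
  assumes "a \<in> sym_alg q"
  shows "iota q r (act a x) = act a (iota q r x)"
  by (rule bilin_eqI[of "\<lambda>a x. iota q r (act a x)" "\<lambda>a x. act a (iota q r x)" a "Sym q" x UNIV])
    (use assms in \<open>auto intro!: lin_intros simp: strand_relab free_on_iff\<close>)

lemma beta_through_span: "x \<in> through_span p (Suc r) \<Longrightarrow> beta p r x \<in> through_span (Suc p) r"
  by (rule lin_closed[where F = "beta p r"]) (auto intro!: lin_intros free_on_single simp: through_def)

lemma beta_act:
  assumes "a \<in> sym_alg p"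
  shows "beta p r (act a x) = act a (beta p r x)"
  by (rule bilin_eqI[of "\<lambda>a x. beta p r (act a x)" "\<lambda>a x. act a (beta p r x)" a "Sym p" x UNIV])
    (use assms in \<open>auto intro!: lin_intros simp: bend_relab free_on_iff\<close>)

text \<open>Both truncations agree: if the bent composite joins no two top points, then neither does
  the composite, since bending keeps such edges, nor the bent diagram \<open>x\<close>, since
  multiplication keeps them.\<close>

lemma beta_rmul:
  assumes "x \<in> through_span p (Suc r)" "b \<in> diagram_span r t"
  shows "beta p t (rmul \<delta> p x (iota r t b)) = rmul \<delta> (Suc p) (beta p r x) b"
proof (rule bilin_eqI[of "\<lambda>x b. beta p t (rmul \<delta> p x (iota r t b))" "\<lambda>x b. rmul \<delta> (Suc p) (beta p r x) b", OF _ _ _ _ assms])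
  fix x y assume x: "x \<in> through p (Suc r)" and y: "y \<in> diagrams r t"
  let ?z = "compose_diagrams x (strand r t y)"
  have c: "compose_diagrams (bend p r x) y = bend p t ?z" "loops (bend p r x) y = loops x (strand r t y)"
    using compose_bend[OF through_D[OF x] y] by auto
  have t1: "top_free (bend p t ?z) \<Longrightarrow> top_free ?z" by (rule top_free_bend)
  have t2: "top_free (bend p t ?z) \<Longrightarrow> top_free (bend p r x)"
    using top_free_compose[OF bend_diagrams[OF through_D[OF x]] y] c by simp
  show "beta p t (rmul \<delta> p (mon x) (iota r t (mon y))) = rmul \<delta> (Suc p) (beta p r (mon x)) (mon y)"
    using t1 t2 c truncated_mult_eq[OF through_D[OF x] strand_diagrams[OF y], of \<delta>] truncated_mult_eq[OF bend_diagrams[OF through_D[OF x]] y, of \<delta>]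
    by (auto simp del: bilinear_ext_add_left)
qed (intro lin_intros)+

lemma beta_act_iota:
  assumes "a \<in> sym_alg (Suc q)"
  shows "beta (Suc q) r (act a (iota q r z)) = 0"
  by (rule bilin_eqI[of "\<lambda>a z. beta (Suc q) r (act a (iota q r z))" "\<lambda>a z. 0" a "Sym (Suc q)" z UNIV])
    (use assms in \<open>auto intro!: lin_intros simp: bend_relab_strand_not_top_free free_on_iff\<close>)

lemma beta_surj:
  assumes "z \<in> through_span (Suc p) r" obtains x where "x \<in> through_span p (Suc r)" "beta p r x = z"
proof
  let ?x = "linear_ext (\<lambda>d. mon (unbend p r d)) z"
  have ub: "unbend p r d \<in> through p (Suc r)" if "d \<in> through (Suc p) r" for d
    using that top_free_bend[of p r "unbend p r d"] by (auto simp: through_def bend_unbend)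
  show "?x \<in> through_span p (Suc r)"
    by (rule lin_closed[OF lin_linear_ext assms]) (simp add: ub)
  show "beta p r ?x = z"
    by (rule lin_eqI[of "\<lambda>z. beta p r (linear_ext (\<lambda>d. mon (unbend p r d)) z)" "\<lambda>z. z", OF _ _ assms])
      (auto intro!: lin_intros simp: through_def bend_unbend)
qed

lemma free_on_Un_decompose:
  fixes m :: "'b \<Rightarrow>\<^sub>0 'k::comm_ring_1"
  assumes "m \<in> free_on (S \<union> T)" shows "\<exists>a\<in>free_on S. \<exists>b\<in>free_on T. m = a + b"
  using assms
proof (induction rule: free_on_induct)
  case (scaled x c)
  show ?case
  proof (cases "x \<in> S")
    case True
    then show ?thesis by (intro bexI[of _ "scale c (mon x)"] bexI[of _ 0]) auto
  next
    case False
    then show ?thesis using scaled by (intro bexI[of _ 0] bexI[of _ "scale c (mon x)"]) auto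
  qed
next
  case (add a b)
  then obtain a1 a2 b1 b2 where "a1 \<in> free_on S" "b1 \<in> free_on S" "a2 \<in> free_on T" "b2 \<in> free_on T" "a = a1 + a2" "b = b1 + b2"
    by blast
  then show ?case by (intro bexI[of _ "a1 + b1"] bexI[of _ "a2 + b2"]) auto
qed (intro bexI[of _ 0], auto)

text \<open>On the diagrams not killed by \<open>beta\<close> the map \<open>unbend\<close> recovers
  them from their images, so the kernel is spanned by the killed ones, and these are relabelled
  strands.\<close>

lemma beta_kernel:
  fixes m :: "'k::comm_ring_1 diagram_comb"
  assumes m: "m \<in> through_span p (Suc r)" and b0: "beta p r m = 0"
  shows "m \<in> scale.span {act a (iota q r z) | q a z. p = Suc q \<and> a \<in> sym_alg p \<and> z \<in> through_span q r}" (is "_ \<in> scale.span ?G")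
proof -
  let ?S = "{d \<in> through p (Suc r). \<not> top_free (bend p r d)}" and ?T = "{d \<in> through p (Suc r). top_free (bend p r d)}"
  have "through p (Suc r) = ?S \<union> ?T" by blast
  then obtain a b where ab: "a \<in> free_on ?S" "b \<in> free_on ?T" "m = a + b"
    using free_on_Un_decompose[of m ?S ?T] m by auto
  have "beta p r a = 0"
    by (rule lin_eqI[of "beta p r" "\<lambda>_. 0", OF _ _ ab(1)]) (auto intro!: lin_intros)
  then have "beta p r b = 0" using b0 ab(3) by (simp add: lin_add[OF lin_beta[OF lin_ident]])
  moreover have "linear_ext (\<lambda>d. mon (unbend p r d)) (beta p r b) = b"
    by (rule lin_eqI[of "\<lambda>b. linear_ext (\<lambda>d. mon (unbend p r d)) (beta p r b)" "\<lambda>b. b", OF _ _ ab(2)])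
      (auto intro!: lin_intros simp: through_def unbend_bend)
  ultimately have "b = 0" using lin_0[OF lin_linear_ext] by metis
  then have "m \<in> free_on ?S" using ab by simp
  then show ?thesis
  proof (induction rule: free_on_induct)
    case (scaled d c)
    then have d: "d \<in> through p (Suc r)" "\<not> top_free (bend p r d)" by auto
    obtain q g d0 where g: "p = Suc q" "g \<in> Sym p" "d0 \<in> through q r" "d = relab g (strand q r d0)"
      by (rule bend_not_top_free[OF d])
    have "mon d = act (mon g) (iota q r (mon d0 :: 'k diagram_comb))" by (simp add: g(4))
    moreover have "mon g \<in> (sym_alg p :: ('k perm_alg) set)" "mon d0 \<in> (through_span q r :: ('k diagram_comb) set)" using g by auto
    ultimately have "mon d \<in> ?G" using g(1) by blast
    then show ?case by (intro scale.span_scale scale.span_base)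
  qed (auto intro: scale.span_add scale.span_zero)
qed

text \<open>After relabelling by \<open>g\<close>, the strand to the last bottom point starts at the
  last top point exactly when \<open>g\<close> fixes that point, that is, when \<open>g\<close> lies
  in \<open>Sym q\<close>.\<close>

lemma unstrand_act_iota:
  assumes "a \<in> sym_alg (Suc q)" "z \<in> diagram_span q r"
  shows "unstrand q r (act a (iota q r z)) = act (restrict_to (Sym q) a) z"
proof (rule bilin_eqI[of "\<lambda>a z. unstrand q r (act a (iota q r z))" "\<lambda>a z. act (restrict_to (Sym q) a) z", OF _ _ _ _ assms])
  fix g d assume g: "g \<in> Sym (Suc q)" and d: "d \<in> diagrams q r"
  let ?e = "{Inl (Suc q), Inr (Suc r)} :: (nat + nat) set"
  show "unstrand q r (act (mon g) (iota q r (mon d))) = act (restrict_to (Sym q) (mon g)) (mon d)"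
  proof (cases "g \<in> Sym q")
    case True
    have "relab g (strand q r d) = strand q r (relab g d)" by (rule strand_relab[OF True])
    moreover have "?e \<notin> relab g d" using strand_notin[OF relab_diagrams[OF True d]] .
    ultimately show ?thesis using True by (simp add: unstrand_def strand_def)
  next
    case False
    have "app g (Suc q) \<noteq> Suc q"
      using Sym_Suc_fixed[OF g] False by blast
    moreover have "{Inl (app g (Suc q)), Inr (Suc r)} \<in> relab g (strand q r d)"
      by (simp add: relab_def strand_def)
    moreover have "relab g (strand q r d) \<in> diagrams (Suc q) (Suc r)" using g d by blast
    ultimately have "?e \<notin> relab g (strand q r d)"
      using diagrams_disjoint[of "relab g (strand q r d)" "Suc q" "Suc r" ?e "{Inl (app g (Suc q)), Inr (Suc r)}" "Inr (Suc r)"]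
      by (auto simp: doubleton_eq_iff)
    then show ?thesis using False by (simp add: unstrand_def)
  qed
qed (intro lin_intros)+

section \<open>Complements over a semisimple Brauer algebra\<close>

lemma brauer_algebra_simps [simp]:
  "carrier (brauer_algebra \<delta> r) = diagram_span r r" "add (brauer_algebra \<delta> r) = (+)" "zero (brauer_algebra \<delta> r) = 0"
  "mult (brauer_algebra \<delta> r) = bmul \<delta>"
  by (simp_all add: brauer_algebra_def)

lemma regular_brauer_simps [simp]:
  "carrier (regular_right_module (brauer_algebra \<delta> r)) = diagram_span r r"
  "add (regular_right_module (brauer_algebra \<delta> r)) = (+)"
  "zero (regular_right_module (brauer_algebra \<delta> r)) = 0"
  "ract (regular_right_module (brauer_algebra \<delta> r)) = bmul \<delta>"
  by (simp_all add: regular_right_module_def)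

lemma regular_add_monoid_group: "group (add_monoid (regular_right_module (brauer_algebra \<delta> r)))"
proof (rule groupI)
  fix x assume "x \<in> carrier (add_monoid (regular_right_module (brauer_algebra \<delta> r)))"
  then show "\<exists>y\<in>carrier (add_monoid (regular_right_module (brauer_algebra \<delta> r))).
      y \<otimes>\<^bsub>add_monoid (regular_right_module (brauer_algebra \<delta> r))\<^esub> x = \<one>\<^bsub>add_monoid (regular_right_module (brauer_algebra \<delta> r))\<^esub>"
    by (intro bexI[of _ "- x"]) auto
qed (auto simp: add.assoc)

lemma regular_add_monoid_inv:
  assumes "x \<in> diagram_span r r"
  shows "inv\<^bsub>add_monoid (regular_right_module (brauer_algebra \<delta> r))\<^esub> x = - x"
  by (rule group.inv_equality[OF regular_add_monoid_group]) (use assms in auto)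

lemma brauer_right_submodule_iff:
  "right_submodule (brauer_algebra \<delta> r) (regular_right_module (brauer_algebra \<delta> r)) N \<longleftrightarrow>
    N \<subseteq> diagram_span r r \<and> 0 \<in> N \<and> (\<forall>x\<in>N. \<forall>y\<in>N. x + y \<in> N) \<and> (\<forall>x\<in>N. - x \<in> N) \<and>
    (\<forall>x\<in>N. \<forall>a\<in>diagram_span r r. bmul \<delta> x a \<in> N)"
proof -
  let ?G = "add_monoid (regular_right_module (brauer_algebra \<delta> r))"
  have "additive_subgroup N (regular_right_module (brauer_algebra \<delta> r)) \<longleftrightarrow> subgroup N ?G"
    by (simp add: additive_subgroup_def)
  also have "\<dots> \<longleftrightarrow> N \<subseteq> diagram_span r r \<and> 0 \<in> N \<and> (\<forall>x\<in>N. \<forall>y\<in>N. x + y \<in> N) \<and> (\<forall>x\<in>N. - x \<in> N)"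
  proof
    assume s: "subgroup N ?G"
    have sub: "N \<subseteq> diagram_span r r" using subgroup.subset[OF s] by simp
    moreover have "0 \<in> N" using subgroup.one_closed[OF s] by simp
    moreover have "x + y \<in> N" if "x \<in> N" "y \<in> N" for x y using subgroup.m_closed[OF s that] by simp
    moreover have "- x \<in> N" if "x \<in> N" for x
      using subgroup.m_inv_closed[OF s that] regular_add_monoid_inv[of x r \<delta>] that sub by auto
    ultimately show "N \<subseteq> diagram_span r r \<and> 0 \<in> N \<and> (\<forall>x\<in>N. \<forall>y\<in>N. x + y \<in> N) \<and> (\<forall>x\<in>N. - x \<in> N)" by blast
  next
    assume n: "N \<subseteq> diagram_span r r \<and> 0 \<in> N \<and> (\<forall>x\<in>N. \<forall>y\<in>N. x + y \<in> N) \<and> (\<forall>x\<in>N. - x \<in> N)"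
    show "subgroup N ?G"
    proof
      show "N \<subseteq> carrier ?G" using n by simp
      show "x \<otimes>\<^bsub>?G\<^esub> y \<in> N" if "x \<in> N" "y \<in> N" for x y using n that by simp
      show "\<one>\<^bsub>?G\<^esub> \<in> N" using n by simp
      show "inv\<^bsub>?G\<^esub> x \<in> N" if "x \<in> N" for x using n that regular_add_monoid_inv[of x r \<delta>] by auto
    qed
  qed
  finally show ?thesis by (simp add: right_submodule_def)
qed

text \<open>An arbitrary right module over the Brauer algebra inside the diagram combinations. It is
  applied to \<open>inflate l (Suc r)\<close>, where the algebra acts through its inclusion in the
  next one.\<close>

context
  fixes \<delta> :: "'k::field" and r :: nat
    and M :: "('k diagram_comb) set" and rho :: "'k diagram_comb \<Rightarrow> 'k diagram_comb \<Rightarrow> 'k diagram_comb"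
  assumes ss: "semisimple_ring (brauer_algebra \<delta> r)"
    and M0: "0 \<in> M" and M_add: "\<And>x y. x \<in> M \<Longrightarrow> y \<in> M \<Longrightarrow> x + y \<in> M"
    and M_uminus: "\<And>x. x \<in> M \<Longrightarrow> - x \<in> M"
    and M_rho: "\<And>x a. x \<in> M \<Longrightarrow> a \<in> diagram_span r r \<Longrightarrow> rho x a \<in> M"
    and lin_rho_left: "\<And>a. lin (\<lambda>x. rho x a)" and lin_rho_right: "\<And>x. lin (rho x)"
    and rho_assoc: "\<And>x a b. x \<in> M \<Longrightarrow> a \<in> diagram_span r r \<Longrightarrow> b \<in> diagram_span r r \<Longrightarrow> rho (rho x a) b = rho x (bmul \<delta> a b)"
    and rho_one: "\<And>x. x \<in> M \<Longrightarrow> rho x (mon (identity_diagram r)) = x"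
begin

definition submod :: "('k diagram_comb) set \<Rightarrow> bool" where
  "submod N \<longleftrightarrow> N \<subseteq> M \<and> 0 \<in> N \<and> (\<forall>x\<in>N. \<forall>y\<in>N. x + y \<in> N) \<and> (\<forall>x\<in>N. - x \<in> N) \<and>
    (\<forall>x\<in>N. \<forall>a\<in>diagram_span r r. rho x a \<in> N)"

lemma submod_sum:
  assumes N: "submod N" and C: "submod C"
  shows "submod {n + c | n c. n \<in> N \<and> c \<in> C}"
  unfolding submod_def
proof (intro conjI ballI)
  show "{n + c | n c. n \<in> N \<and> c \<in> C} \<subseteq> M"
  proof
    fix x assume "x \<in> {n + c | n c. n \<in> N \<and> c \<in> C}"
    then obtain n c where x: "x = n + c" "n \<in> N" "c \<in> C" by blast
    have "n \<in> M" "c \<in> M" using x N C unfolding submod_def by blast+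
    then show "x \<in> M" unfolding x(1) by (rule M_add)
  qed
  show "0 \<in> {n + c | n c. n \<in> N \<and> c \<in> C}" 
    by (intro CollectI exI[of _ 0] conjI) (use N C in \<open>simp_all add: submod_def\<close>)
  fix x assume "x \<in> {n + c | n c. n \<in> N \<and> c \<in> C}"
  then obtain n c where x: "x = n + c" "n \<in> N" "c \<in> C" by blast
  have Np: "- n \<in> N" "\<And>a. a \<in> diagram_span r r \<Longrightarrow> rho n a \<in> N" "\<And>n'. n' \<in> N \<Longrightarrow> n + n' \<in> N"
    and Cp: "- c \<in> C" "\<And>a. a \<in> diagram_span r r \<Longrightarrow> rho c a \<in> C" "\<And>c'. c' \<in> C \<Longrightarrow> c + c' \<in> C"
    using x(2,3) N C unfolding submod_def by simp_all
  show "- x \<in> {n + c | n c. n \<in> N \<and> c \<in> C}"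
    by (intro CollectI exI[of _ "- n"] exI[of _ "- c"] conjI) (simp_all add: x(1) Np Cp)
  show "rho x a \<in> {n + c | n c. n \<in> N \<and> c \<in> C}" if "a \<in> diagram_span r r" for a
    by (intro CollectI exI[of _ "rho n a"] exI[of _ "rho c a"] conjI)
      (simp_all add: x(1) lin_add[OF lin_rho_left] Np(2)[OF that] Cp(2)[OF that])
  fix y assume "y \<in> {n + c | n c. n \<in> N \<and> c \<in> C}"
  then obtain n' c' where y: "y = n' + c'" "n' \<in> N" "c' \<in> C" by blast
  show "x + y \<in> {n + c | n c. n \<in> N \<and> c \<in> C}"
    by (intro CollectI exI[of _ "n + n'"] exI[of _ "c + c'"] conjI) (simp_all add: x(1) y Np(3) Cp(3))
qed

lemma submod_translate:
  assumes m: "m \<in> M" and J: "right_submodule (brauer_algebra \<delta> r) (regular_right_module (brauer_algebra \<delta> r)) J"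
  shows "submod (rho m ` J)"
proof -
  have Jp: "J \<subseteq> diagram_span r r" "0 \<in> J" "\<And>x y. x \<in> J \<Longrightarrow> y \<in> J \<Longrightarrow> x + y \<in> J" "\<And>x. x \<in> J \<Longrightarrow> - x \<in> J"
    "\<And>x a. x \<in> J \<Longrightarrow> a \<in> diagram_span r r \<Longrightarrow> bmul \<delta> x a \<in> J"
    using J unfolding brauer_right_submodule_iff by blast+
  show ?thesis
    unfolding submod_def
  proof (intro conjI ballI)
    show "rho m ` J \<subseteq> M" using Jp(1) M_rho[OF m] by blast
    show "0 \<in> rho m ` J" using Jp(2) lin_0[OF lin_rho_right] by (intro image_eqI[of _ _ 0]) simp_all
    fix x assume "x \<in> rho m ` J"
    then obtain j where j: "j \<in> J" "x = rho m j" by blast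
    show "- x \<in> rho m ` J" using j Jp(4) by (intro image_eqI[of _ _ "- j"]) (simp_all add: lin_uminus[OF lin_rho_right])
    show "rho x a \<in> rho m ` J" if "a \<in> diagram_span r r" for a
      using j Jp that rho_assoc[OF m, of j a] by (intro image_eqI[of _ _ "bmul \<delta> j a"]) auto
    fix y assume "y \<in> rho m ` J"
    then obtain j' where j': "j' \<in> J" "y = rho m j'" by blast
    show "x + y \<in> rho m ` J" using j j' Jp(3) by (intro image_eqI[of _ _ "j + j'"]) (simp_all add: lin_add[OF lin_rho_right])
  qed
qed

text \<open>A maximal submodule \<open>C\<close> with \<open>N \<inter> C = 0\<close> is a complement: otherwise some cyclic module
  \<open>m D\<^sub>r\<close> is not contained in \<open>N + C\<close>, and a complement in \<open>D\<^sub>r\<close> of the right ideal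
  \<open>{a. m a \<in> N + C}\<close> yields a larger submodule.\<close>

lemma complement_exists:
  assumes N: "submod N"
  shows "\<exists>C. submod C \<and> N \<inter> C = {0} \<and> (\<forall>m\<in>M. \<exists>n\<in>N. \<exists>c\<in>C. m = n + c)"
proof -
  let ?A = "{C. submod C \<and> N \<inter> C = {0}}"
  have "submod {0}"
    unfolding submod_def using M0 by (auto simp: lin_0[OF lin_rho_left])
  moreover have N0: "0 \<in> N" using N by (simp add: submod_def)
  ultimately have "{0} \<in> ?A" by auto
  then have "?A \<noteq> {}" by blast
  have "\<exists>C\<in>?A. \<forall>X\<in>?A. C \<subseteq> X \<longrightarrow> X = C"
  proof (rule subset_Zorn_nonempty[OF \<open>?A \<noteq> {}\<close>])
    fix K assume K: "K \<noteq> {}" "subset.chain ?A K"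
    then have KA: "\<And>C. C \<in> K \<Longrightarrow> submod C \<and> N \<inter> C = {0}" and ch: "\<And>C D. C \<in> K \<Longrightarrow> D \<in> K \<Longrightarrow> C \<subseteq> D \<or> D \<subseteq> C"
      unfolding subset_chain_def by blast+
    have "submod (\<Union>K)"
      unfolding submod_def
    proof (intro conjI ballI)
      show "\<Union>K \<subseteq> M" using KA unfolding submod_def by blast
      show "0 \<in> \<Union>K" using KA K(1) unfolding submod_def by blast
      fix x assume "x \<in> \<Union>K"
      then obtain C where C: "x \<in> C" "C \<in> K" by blast
      show "- x \<in> \<Union>K" using C KA[OF C(2)] unfolding submod_def by blast
      show "rho x a \<in> \<Union>K" if "a \<in> diagram_span r r" for a using C KA[OF C(2)] that unfolding submod_def by blast
      fix y assume "y \<in> \<Union>K"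
      then obtain D where D: "y \<in> D" "D \<in> K" by blast
      obtain E where E: "E \<in> K" "x \<in> E" "y \<in> E" using ch[OF C(2) D(2)] C D by blast
      then show "x + y \<in> \<Union>K" using KA[OF E(1)] unfolding submod_def by blast
    qed
    moreover have "N \<inter> \<Union>K = {0}" using KA K(1) by blast
    ultimately show "\<Union>K \<in> ?A" by blast
  qed
  then obtain C where CA: "C \<in> ?A" and Cmax: "\<forall>X\<in>?A. C \<subseteq> X \<longrightarrow> X = C" ..
  from CA have C: "submod C" "N \<inter> C = {0}" by simp_all
  have mx: "X = C" if "submod X" "N \<inter> X = {0}" "C \<subseteq> X" for X
  proof -
    have "X \<in> ?A" using that by simp
    then show ?thesis using Cmax that(3) by blast
  qed
  have "\<exists>n\<in>N. \<exists>c\<in>C. m = n + c" if m: "m \<in> M" for m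
  proof -
    let ?P = "{n + c | n c. n \<in> N \<and> c \<in> C}"
    have P: "submod ?P" by (rule submod_sum[OF N C(1)])
    let ?J = "{a \<in> diagram_span r r. rho m a \<in> ?P}"
    have Pp: "0 \<in> ?P" "\<And>x y. x \<in> ?P \<Longrightarrow> y \<in> ?P \<Longrightarrow> x + y \<in> ?P" "\<And>x. x \<in> ?P \<Longrightarrow> - x \<in> ?P"
      "\<And>x a. x \<in> ?P \<Longrightarrow> a \<in> diagram_span r r \<Longrightarrow> rho x a \<in> ?P"
      using P unfolding submod_def by blast+
    have J: "right_submodule (brauer_algebra \<delta> r) (regular_right_module (brauer_algebra \<delta> r)) ?J"
      unfolding brauer_right_submodule_iff
    proof (intro conjI ballI)
      show "0 \<in> ?J" using Pp(1) lin_0[OF lin_rho_right] by simp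
      show "x + y \<in> ?J" if "x \<in> ?J" "y \<in> ?J" for x y
        using that Pp(2)[of "rho m x" "rho m y"] lin_add[OF lin_rho_right, of m x y] free_on_add[of x _ y] by simp
      show "- x \<in> ?J" if "x \<in> ?J" for x
        using that Pp(3)[of "rho m x"] lin_uminus[OF lin_rho_right, of m x] free_on_uminus[of x] by simp
      show "bmul \<delta> x a \<in> ?J" if "x \<in> ?J" "a \<in> diagram_span r r" for x a
        using that Pp(4)[of "rho m x" a] rho_assoc[OF m, of x a] bmul_closed[of x r r a r \<delta>] by simp
    qed auto
    from ss obtain J' where J': "right_submodule (brauer_algebra \<delta> r) (regular_right_module (brauer_algebra \<delta> r)) J'"
      "?J \<inter> J' = {0}" "?J <+>\<^bsub>regular_right_module (brauer_algebra \<delta> r)\<^esub> J' = diagram_span r r"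
      using J unfolding semisimple_ring_def semisimple_right_module_def regular_brauer_simps by blast
    let ?C = "{c + x | c x. c \<in> C \<and> x \<in> rho m ` J'}"
    have sC: "submod ?C" by (rule submod_sum[OF C(1) submod_translate[OF m J'(1)]])
    have J'0: "0 \<in> J'" "J' \<subseteq> diagram_span r r" using J'(1) unfolding brauer_right_submodule_iff by blast+
    have C0: "0 \<in> C" using C(1) by (simp add: submod_def)
    have m0: "rho m 0 = 0" by (rule lin_0[OF lin_rho_right])
    have sub: "C \<subseteq> ?C"
    proof
      fix c assume "c \<in> C"
      then show "c \<in> ?C" using J'0(1) m0 by (intro CollectI exI[of _ c] exI[of _ 0]) (auto intro: image_eqI[of _ _ 0])
    qed
    \<comment> \<open>If \<open>n = c + rho m j\<close>, then \<open>rho m j\<close> lies in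
      \<open>N + C\<close>, so \<open>j\<close> lies in both \<open>?J\<close> and its complement
      and vanishes.\<close>
    have "N \<inter> ?C = {0}"
    proof
      show "N \<inter> ?C \<subseteq> {0}"
      proof
        fix n assume "n \<in> N \<inter> ?C"
        then obtain c j where n: "n \<in> N" "n = c + rho m j" "c \<in> C" "j \<in> J'" by blast
        have "- c \<in> C" using C(1) n(3) by (simp add: submod_def)
        moreover have "rho m j = n + - c" using n(2) by simp
        ultimately have "rho m j \<in> ?P" using n(1) by blast
        then have "j \<in> ?J" using n(4) J'0(2) by blast
        then have "j = 0" using J'(2) n(4) by blast
        then have "n = c" using n(2) m0 by simp
        then show "n \<in> {0}" using n(1,3) C(2) by blast
      qed
      show "{0} \<subseteq> N \<inter> ?C" using N0 sub C0 by blast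
    qed
    then have CC: "?C = C" by (rule mx[OF sC _ sub])
    \<comment> \<open>The unit splits into \<open>a\<close> in \<open>?J\<close> and
      \<open>j\<close> in the complement. Thus \<open>m\<close> is the sum of
      \<open>rho m a\<close>, which lies in \<open>N + C\<close>, and \<open>rho m j\<close>, which
      lies in \<open>C\<close> by maximality.\<close>
    have "mon (identity_diagram r) \<in> ?J <+>\<^bsub>regular_right_module (brauer_algebra \<delta> r)\<^esub> J'"
      unfolding J'(3) by simp
    then obtain a j where aj: "a \<in> ?J" "j \<in> J'" "mon (identity_diagram r) = a + j"
      unfolding set_add_def' regular_brauer_simps by blast
    have "m = rho m a + rho m j"
      using rho_one[OF m] lin_add[OF lin_rho_right, of m a j] by (simp add: aj(3))
    moreover have "rho m a \<in> ?P" using aj(1) by blast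
    moreover have "rho m j \<in> ?C" using aj(2) C0 by (intro CollectI exI[of _ 0] exI[of _ "rho m j"]) auto
    then have "rho m j \<in> C" unfolding CC .
    then have "rho m j \<in> ?P" using N0 by (intro CollectI exI[of _ 0] exI[of _ "rho m j"] conjI) simp_all
    ultimately have "m \<in> ?P" using Pp(2)[of "rho m a" "rho m j"] by simp
    then show ?thesis by blast
  qed
  then show ?thesis using C by blast
qed

end

section \<open>The branching rule for inflated modules\<close>

text \<open>As \<open>idem l\<close> is idempotent, its fixed vectors are its image; this is the
  model of the inflated module as a set of diagram combinations.\<close>

definition inflate :: "nat list \<Rightarrow> nat \<Rightarrow> ('k::field_char_0 diagram_comb) set" where
  "inflate l r = {x \<in> through_span (sum_list l) r. act (idem l) x = x}"

lemma lin_act_right: "lin (\<lambda>x. act a x)" by (intro lin_intros)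
lemma lin_act_left: "lin (\<lambda>a. act a x)" by (intro lin_intros)
lemma lin_rmul_left: "lin (\<lambda>x. rmul \<delta> p x a)" by (intro lin_intros)

context
  fixes \<delta> :: "'k::field_char_0" and r p :: nat and l :: "nat list"
  assumes l: "l \<in> partitions p"
begin

lemma inflate_iff: "x \<in> inflate l r' \<longleftrightarrow> x \<in> through_span p r' \<and> act (idem l) x = (x :: 'k diagram_comb)"
  by (simp add: inflate_def partitions_sum_list[OF l])

lemma inflate_zero: "(0 :: 'k diagram_comb) \<in> inflate l r'" by (simp add: inflate_iff)

lemma inflate_add: "x \<in> inflate l r' \<Longrightarrow> y \<in> inflate l r' \<Longrightarrow> x + y \<in> (inflate l r' :: ('k diagram_comb) set)"
  by (auto simp: inflate_iff lin_add[OF lin_act_right])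

lemma inflate_uminus: "x \<in> inflate l r' \<Longrightarrow> - x \<in> (inflate l r' :: ('k diagram_comb) set)"
  by (auto simp: inflate_iff lin_uminus[OF lin_act_right])

lemma inflate_sum: "(\<And>i. i \<in> I \<Longrightarrow> f i \<in> inflate l r') \<Longrightarrow> (\<Sum>i\<in>I. f i) \<in> (inflate l r' :: ('k diagram_comb) set)"
  by (induction I rule: infinite_finite_induct) (auto intro: inflate_zero inflate_add)

lemma inflate_rmul: "x \<in> inflate l r' \<Longrightarrow> a \<in> diagram_span r' t \<Longrightarrow> rmul \<delta> p x a \<in> inflate l t"
  using act_rmul[OF idem_sym_alg[OF l], of x r' a t \<delta>] by (auto simp: inflate_iff rmul_closed)

lemma idem_act_inflate:
  assumes "x \<in> through_span p r'" shows "act (idem l) x \<in> (inflate l r' :: ('k diagram_comb) set)"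
  using act_closed[OF idem_sym_alg[OF l] assms] by (simp add: inflate_iff act_mult[symmetric] idem_idem[OF l])

text \<open>The map from the summands with a cell removed into \<open>inflate l (Suc r)\<close>; its
  image is the kernel of \<open>beta\<close>. The companion \<open>adds_sum\<close> maps the
  summands with a cell added onto the image of \<open>beta\<close>.\<close>

abbreviation rems_sum :: "(nat list \<Rightarrow> 'k diagram_comb) \<Rightarrow> 'k diagram_comb" where
  "rems_sum f \<equiv> (\<Sum>v\<in>rems l. act (dn v l) (iota (sum_list v) r (f v)))"

abbreviation adds_sum :: "(nat list \<Rightarrow> 'k diagram_comb) \<Rightarrow> 'k diagram_comb" where
  "adds_sum f \<equiv> (\<Sum>m\<in>adds l. act (up l m) (f m))"

lemma rems_facts:
  assumes "v \<in> rems l"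
  shows "v \<in> partitions (sum_list v)" "p = Suc (sum_list v)" "l \<in> adds v"
proof -
  have "p \<noteq> 0"
  proof
    assume "p = 0"
    then have "rems l = {}" using rems_empty l by simp
    then show False using assms by simp
  qed
  then obtain q where q: "p = Suc q" by (cases p) auto
  then have v: "v \<in> partitions q" using rems_partitions assms l by blast
  then show "v \<in> partitions (sum_list v)" "p = Suc (sum_list v)" "l \<in> adds v"
    using q partitions_sum_list[OF v] adds_iff_rems[OF v l] assms by auto
qed

lemma dn_sym_alg_rems: "v \<in> rems l \<Longrightarrow> dn v l \<in> (sym_alg p :: ('k perm_alg) set)"
  and up_sym_alg_rems: "v \<in> rems l \<Longrightarrow> up v l \<in> (sym_alg p :: ('k perm_alg) set)"
  using dn_sym_alg[of v "sum_list v" l] up_sym_alg[of v "sum_list v" l] rems_facts[of v] by simp_all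

lemma rems_sum_inflate:
  assumes "\<And>v. v \<in> rems l \<Longrightarrow> f v \<in> inflate v r"
  shows "rems_sum f \<in> inflate l (Suc r)"
proof (rule inflate_sum)
  fix v assume v: "v \<in> rems l"
  have "f v \<in> through_span (sum_list v) r" using assms[OF v] by (simp add: inflate_def)
  then have i: "iota (sum_list v) r (f v) \<in> through_span p (Suc r)" using iota_through_span rems_facts(2)[OF v] by metis
  have "act (idem l) (act (dn v l) (iota (sum_list v) r (f v))) = act (dn v l) (iota (sum_list v) r (f v))"
    by (simp add: act_mult[symmetric] idem_dn[OF rems_facts(1,3)[OF v]])
  then show "act (dn v l) (iota (sum_list v) r (f v)) \<in> inflate l (Suc r)"
    using act_closed[OF dn_sym_alg_rems[OF v] i] by (simp add: inflate_iff)
qed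

lemma beta_rems_sum: "beta p r (rems_sum f) = 0"
proof -
  have "beta p r (act (dn v l) (iota (sum_list v) r (f v))) = 0" if v: "v \<in> rems l" for v
    using beta_act_iota[of "dn v l" "sum_list v" r "f v"] dn_sym_alg_rems[OF v] rems_facts(2)[OF v] by simp
  then show ?thesis unfolding lin_sum[OF lin_beta[OF lin_ident]] by (rule sum.neutral[rule_format])
qed

lemma rems_sum_linear: "rems_sum (\<lambda>v. f v + g v) = rems_sum f + rems_sum g" "rems_sum (\<lambda>v. scale c (f v)) = scale c (rems_sum f)" "rems_sum (\<lambda>v. f v - g v) = rems_sum f - rems_sum g"
  by (simp_all add: lin_add[OF lin_iota[OF lin_ident]] lin_add[OF lin_act_right] sum.distrib
     lin_scale[OF lin_iota[OF lin_ident]] lin_scale[OF lin_act_right] scale.scale_sum_right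
     lin_diff[OF lin_iota[OF lin_ident]] lin_diff[OF lin_act_right] sum_subtractf)

text \<open>The kernel of \<open>beta\<close> is spanned by the elements
  \<open>act a (iota q r z)\<close>. Applying \<open>idem l\<close>, which fixes \<open>m\<close>,
  lets the restriction rule expand \<open>idem l * a\<close> over the removable cells, and the
  remaining factors from \<open>sym_alg q\<close> pass through \<open>iota\<close>.\<close>

lemma inflate_kernel_beta:
  assumes m: "m \<in> inflate l (Suc r)" and b: "beta p r m = 0"
  shows "\<exists>f. (\<forall>v\<in>rems l. f v \<in> inflate v r) \<and> m = rems_sum f"
proof -
  have "m \<in> scale.span {act a (iota q r z) | q a z. p = Suc q \<and> a \<in> sym_alg p \<and> z \<in> through_span q r}"
    using m b by (intro beta_kernel) (simp_all add: inflate_iff)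
  then have "\<exists>f. (\<forall>v\<in>rems l. f v \<in> inflate v r) \<and> act (idem l) m = rems_sum f"
  proof (induction rule: scale.span_induct_alt)
    case base
    show ?case by (rule exI[of _ "\<lambda>_. 0"]) (simp add: inflate_def)
  next
    case (step c x y)
    obtain q a z where x: "x = act a (iota q r z)" "p = Suc q" "a \<in> sym_alg p" "z \<in> through_span q r" using step(1) by blast
    obtain b where b: "\<forall>v. b v \<in> sym_alg q" "idem l * a = (\<Sum>v\<in>rems l. dn v l * b v)"
      using idem_mult_eq_sum_dn[of l q a] l x by auto
    have q: "sum_list v = q" if "v \<in> rems l" for v using rems_facts(2)[OF that] x(2) by simp
    have vp: "v \<in> partitions q" if "v \<in> rems l" for v using rems_facts(1)[OF that] q[OF that] by simp
    \<comment> \<open>The factor \<open>idem v\<close> is supplied by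
      \<open>dn v l = dn v l * idem v\<close> and puts the component into
      \<open>inflate v r\<close>.\<close>
    define f where "f v = act (idem v) (act (b v) z)" for v
    have f: "f v \<in> inflate v r" if "v \<in> rems l" for v
    proof -
      have "act (b v) z \<in> through_span q r" using b(1) x(4) by (blast intro: act_closed)
      then have "f v \<in> through_span q r" unfolding f_def using idem_sym_alg[OF vp[OF that]] by (blast intro: act_closed)
      then show ?thesis by (simp add: inflate_def q[OF that]) (simp add: f_def act_mult[symmetric] idem_idem[OF vp[OF that]] mult.assoc[symmetric])
    qed
    have "act (idem l) x = (\<Sum>v\<in>rems l. act (dn v l * b v) (iota q r z))"
      by (simp add: x(1) act_mult[symmetric] b(2) bilinear_ext_sum_left)
    also have "\<dots> = rems_sum f"
    proof (rule sum.cong[OF refl])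
      fix v assume v: "v \<in> rems l"
      have "dn v l * b v = dn v l * (idem v * b v)"
        using dn_idem[OF rems_facts(1,3)[OF v], where 'k = 'k] by (simp flip: mult.assoc)
      then have "act (dn v l * b v) (iota q r z) = act (dn v l) (act (idem v * b v) (iota q r z))"
        by (simp add: act_mult)
      also have "act (idem v * b v) (iota q r z) = iota q r (act (idem v * b v) z)"
        using b(1) idem_sym_alg[OF vp[OF v]] by (subst iota_act) auto
      also have "\<dots> = iota (sum_list v) r (f v)" by (simp add: f_def act_mult q[OF v])
      finally show "act (dn v l * b v) (iota q r z) = act (dn v l) (iota (sum_list v) r (f v))" .
    qed
    finally have fx: "act (idem l) x = rems_sum f" .
    obtain g where g: "\<forall>v\<in>rems l. g v \<in> inflate v r" "act (idem l) y = rems_sum g" using step(2) by blast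
    have "act (idem l) (scale c x + y) = rems_sum (\<lambda>v. scale c (f v) + g v)"
      unfolding rems_sum_linear by (simp add: lin_add[OF lin_act_right] lin_scale[OF lin_act_right] fx g(2))
    moreover have "scale c (f v) + g v \<in> inflate v r" if "v \<in> rems l" for v
      using f[OF that] g(1) that by (auto simp: inflate_def lin_add[OF lin_act_right] lin_scale[OF lin_act_right])
    ultimately show ?case by (intro exI[of _ "\<lambda>v. scale c (f v) + g v"] conjI ballI)
  qed
  then show ?thesis using m by (simp add: inflate_iff)
qed

text \<open>Apply \<open>up w l\<close> and remove the last strand. The component at
  \<open>v\<close> is then acted on by an element between \<open>idem w\<close> and
  \<open>idem v\<close> in \<open>sym_alg (sum_list w)\<close>: it is zero for
  \<open>v \<noteq> w\<close> and a nonzero multiple of \<open>idem w\<close> for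
  \<open>v = w\<close>.\<close>

lemma rems_sum_zero_imp:
  assumes f: "\<And>v. v \<in> rems l \<Longrightarrow> f v \<in> inflate v r" and N: "rems_sum f = 0" and w: "w \<in> rems l"
  shows "f w = 0"
proof -
  let ?q = "sum_list w"
  have p: "p = Suc ?q" by (rule rems_facts(2)[OF w])
  have q: "sum_list v = ?q" "v \<in> partitions ?q" if "v \<in> rems l" for v
    using rems_facts[OF that] p by auto
  have wp: "w \<in> partitions ?q" using q(2)[OF w] .
  let ?E = "\<lambda>v. restrict_to (Sym ?q) (up w l * dn v l) :: 'k perm_alg"
  have E: "?E v = idem w * ?E v * idem v" if v: "v \<in> rems l" for v
  proof -
    have "up w l * dn v l = idem w * (up w l * dn v l) * (idem v :: 'k perm_alg)"
      using idem_up[OF rems_facts(1,3)[OF w], where 'k = 'k] dn_idem[OF rems_facts(1,3)[OF v], where 'k = 'k]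
      by (simp add: mult.assoc) (metis mult.assoc)
    then have "?E v = restrict_to (Sym ?q) (idem w * (up w l * dn v l) * idem v)" by simp
    also have "\<dots> = idem w * ?E v * idem v"
      by (simp add: restrict_to_mult_sym_alg[OF idem_sym_alg[OF q(2)[OF v]]] restrict_to_sym_alg_mult[OF idem_sym_alg[OF wp]])
    finally show ?thesis .
  qed
  obtain d where d: "?E w = scale d (idem w)" using E[OF w] idem_sym_alg_idem[OF wp restrict_to_free] by metis
  \<comment> \<open>Restriction keeps the coefficient at the neutral element, and the trace property
    turns \<open>up w l * dn w l\<close> into \<open>dn w l * up w l = idem l\<close>, whose
    coefficient there is nonzero.\<close>
  have "coef (?E w) 0 = coef (up w l * dn w l) (0 :: fperm)" by (rule coef_restrict_to) simp
  also have "\<dots> = coef (idem l) 0" by (subst coef_mult_zero_commute) (simp add: dn_up[OF rems_facts(1,3)[OF w]])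
  finally have "d \<noteq> 0" using coef_idem_zero[OF l, where 'k = 'k] d by auto
  have tm: "unstrand ?q r (act (up w l) (act (dn v l) (iota (sum_list v) r (f v)))) = (if v = w then scale d (f w) else 0)"
    if v: "v \<in> rems l" for v
  proof -
    have ud: "up w l * dn v l \<in> (sym_alg (Suc ?q) :: ('k perm_alg) set)" using up_sym_alg_rems[OF w] dn_sym_alg_rems[OF v] p by auto
    have fv: "f v \<in> through_span ?q r" "act (idem v) (f v) = f v" using f[OF v] q[OF v] by (simp_all add: inflate_def)
    have "f v \<in> diagram_span ?q r" using fv(1) by (rule free_on_mono) (auto simp: through_def)
    then have "unstrand ?q r (act (up w l * dn v l) (iota ?q r (f v))) = act (?E v) (f v)"
      by (rule unstrand_act_iota[OF ud])
    moreover have "act (?E v) (f v) = (if v = w then scale d (f w) else 0)"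
    proof (cases "v = w")
      case True
      then show ?thesis using d fv(2) by (simp add: lin_scale[OF lin_act_left])
    next
      case False
      then have "idem w * ?E v * idem v = 0" by (intro idem_sym_alg_idem_eq_zero[OF wp q(2)[OF v]]) auto
      then show ?thesis using E[OF v] False by simp
    qed
    ultimately show ?thesis by (simp add: act_mult q(1)[OF v])
  qed
  have "0 = unstrand ?q r (act (up w l) (rems_sum f))" using N by (simp add: lin_0[OF lin_unstrand[OF lin_ident]])
  also have "\<dots> = (\<Sum>v\<in>rems l. unstrand ?q r (act (up w l) (act (dn v l) (iota (sum_list v) r (f v)))))"
    by (simp add: bilinear_ext_sum_right lin_sum[OF lin_unstrand[OF lin_ident]])
  also have "\<dots> = scale d (f w)" using w finite_rems by (simp add: tm cong: sum.cong)
  finally show ?thesis using \<open>d \<noteq> 0\<close> by (simp add: scale_eq_0_iff)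
qed

lemma adds_facts: "m \<in> adds l \<Longrightarrow> m \<in> partitions (Suc p)" "m \<in> adds l \<Longrightarrow> sum_list m = Suc p"
  using adds_partitions[OF l] partitions_sum_list by blast+

lemma adds_sum_through_span:
  assumes "\<And>m. m \<in> adds l \<Longrightarrow> f m \<in> inflate m r"
  shows "adds_sum f \<in> through_span (Suc p) r" "act (idem l) (adds_sum f) = adds_sum f"
proof -
  show "adds_sum f \<in> through_span (Suc p) r"
    using assms adds_facts up_sym_alg[OF l, where 'k = 'k] by (intro free_on_sum act_closed) (auto simp: inflate_def)
  show "act (idem l) (adds_sum f) = adds_sum f"
    by (simp add: bilinear_ext_sum_right act_mult[symmetric] idem_up[OF l])
qed

lemma dn_adds_sum:
  assumes f: "\<And>m. m \<in> adds l \<Longrightarrow> f m \<in> inflate m r" and m: "m \<in> adds l"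
  shows "act (dn l m) (adds_sum f) = f m"
proof -
  have "act (dn l m) (adds_sum f) = (\<Sum>n\<in>adds l. act (dn l m * up l n) (f n))"
    by (simp add: bilinear_ext_sum_right act_mult)
  also have "\<dots> = (\<Sum>n\<in>adds l. if n = m then f m else 0)"
  proof (rule sum.cong[OF refl])
    fix n assume n: "n \<in> adds l"
    show "act (dn l m * up l n) (f n) = (if n = m then f m else 0)"
    proof (cases "n = m")
      case True
      then show ?thesis using f[OF m] by (simp add: dn_up[OF l m] inflate_def)
    next
      case False
      then have "dn l m * 1 * up l n = (0 :: 'k perm_alg)"
        by (intro dn_mult_up_eq_zero[OF l m l n]) auto
      then show ?thesis using False by simp
    qed
  qed
  also have "\<dots> = f m" using m finite_adds[OF l] by simp
  finally show ?thesis .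
qed

text \<open>The components are read off with \<open>dn l m\<close>, and they reassemble to
  \<open>z\<close> because the elements \<open>up l m * dn l m\<close> add up to
  \<open>idem l\<close>.\<close>

lemma adds_sum_surj:
  assumes z: "z \<in> through_span (Suc p) r" "act (idem l) z = z"
  shows "\<And>m. m \<in> adds l \<Longrightarrow> act (dn l m) z \<in> inflate m r" "adds_sum (\<lambda>m. act (dn l m) z) = z"
proof -
  fix m assume m: "m \<in> adds l"
  show "act (dn l m) z \<in> inflate m r"
    using act_closed[OF dn_sym_alg[OF l m] z(1)] adds_facts[OF m] by (simp add: inflate_def act_mult[symmetric] idem_dn[OF l m])
next
  have "z = act (\<Sum>m\<in>adds l. up l m * dn l m) z" using z(2) idem_eq_sum_up_dn[OF l, where 'k = 'k] by simp
  then show "adds_sum (\<lambda>m. act (dn l m) z) = z" by (simp add: bilinear_ext_sum_left act_mult)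
qed

lemma rems_sum_rmul:
  assumes f: "\<And>v. v \<in> rems l \<Longrightarrow> f v \<in> inflate v r" and a: "a \<in> diagram_span r r"
  shows "rems_sum (\<lambda>v. rmul \<delta> (sum_list v) (f v) a) = rmul \<delta> p (rems_sum f) (iota r r a)"
  unfolding bilinear_ext_sum_left
proof (rule sum.cong[OF refl])
  fix v assume v: "v \<in> rems l"
  have fv: "f v \<in> through_span (sum_list v) r" using f[OF v] by (simp add: inflate_def)
  have "iota (sum_list v) r (f v) \<in> through_span p (Suc r)" using iota_through_span[OF fv] rems_facts(2)[OF v] by simp
  then show "act (dn v l) (iota (sum_list v) r (rmul \<delta> (sum_list v) (f v) a)) =
      rmul \<delta> p (act (dn v l) (iota (sum_list v) r (f v))) (iota r r a)"
    using iota_rmul[OF fv a, of \<delta>] act_rmul[OF dn_sym_alg_rems[OF v] _ iota_diagram_span[OF a], of _ \<delta>] rems_facts(2)[OF v] by simp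
qed

lemma adds_sum_rmul:
  assumes f: "\<And>m. m \<in> adds l \<Longrightarrow> f m \<in> inflate m r" and a: "a \<in> diagram_span r r"
  shows "adds_sum (\<lambda>m. rmul \<delta> (sum_list m) (f m) a) = rmul \<delta> (Suc p) (adds_sum f) a"
  unfolding bilinear_ext_sum_left
proof (rule sum.cong[OF refl])
  fix m assume m: "m \<in> adds l"
  have "f m \<in> through_span (Suc p) r" using f[OF m] adds_facts(2)[OF m] by (simp add: inflate_def)
  then show "act (up l m) (rmul \<delta> (sum_list m) (f m) a) = rmul \<delta> (Suc p) (act (up l m) (f m)) a"
    using act_rmul[OF up_sym_alg[OF l m] _ a, of "f m" \<delta>] adds_facts(2)[OF m] by simp
qed

text \<open>A complement \<open>C\<close> of the kernel of \<open>beta\<close> is mapped bijectively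
  onto the fixed vectors of \<open>idem l\<close> in \<open>through_span (Suc p) r\<close>. The
  inverse \<open>\<sigma>\<close> is compatible with the action because \<open>C\<close> is a
  submodule, and \<open>H\<close> adds \<open>rems_sum\<close> to \<open>\<sigma>\<close> applied to
  \<open>adds_sum\<close>.\<close>

lemma branching_inflate:
  assumes ss: "semisimple_ring (brauer_algebra \<delta> r)"
  shows "\<exists>H. bij_betw H (\<Pi>\<^sub>E m\<in>add_remove_cell l. inflate m r) (inflate l (Suc r)) \<and>
    (\<forall>f\<in>(\<Pi>\<^sub>E m\<in>add_remove_cell l. inflate m r). \<forall>g\<in>(\<Pi>\<^sub>E m\<in>add_remove_cell l. inflate m r).
       H (\<lambda>m\<in>add_remove_cell l. f m + g m) = H f + H g) \<and>
    (\<forall>f\<in>(\<Pi>\<^sub>E m\<in>add_remove_cell l. inflate m r). \<forall>a\<in>diagram_span r r.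
       H (\<lambda>m\<in>add_remove_cell l. rmul \<delta> (sum_list m) (f m) a) = rmul \<delta> p (H f) (iota r r a))"
proof -
  let ?I = "add_remove_cell l" and ?M = "inflate l (Suc r) :: ('k diagram_comb) set"
  let ?P = "\<Pi>\<^sub>E m\<in>?I. inflate m r :: ('k diagram_comb) set"
  let ?rho = "\<lambda>x a. rmul \<delta> p x (iota r r a)"
  have MX: "x \<in> through_span p (Suc r)" if "x \<in> ?M" for x using that by (simp add: inflate_iff)
  note prems = ss inflate_zero[of "Suc r"] inflate_add[of _ "Suc r"] inflate_uminus[of _ "Suc r"]
  have Mrho: "?rho x a \<in> ?M" if "x \<in> ?M" "a \<in> diagram_span r r" for x a using inflate_rmul that iota_diagram_span by blast
  have l1: "lin (\<lambda>x. ?rho x a)" and l2: "lin (?rho x)" for a x by (intro lin_intros)+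
  have as: "?rho (?rho x a) b = ?rho x (bmul \<delta> a b)" if "x \<in> ?M" "a \<in> diagram_span r r" "b \<in> diagram_span r r" for x a b
    using rmul_assoc[OF MX[OF that(1)] iota_diagram_span[OF that(2)] iota_diagram_span[OF that(3)]] iota_bmul[OF that(2,3)] by simp
  have un: "?rho x (mon (identity_diagram r)) = x" if "x \<in> ?M" for x
    using rmul_identity[OF MX[OF that]] by (simp only: iota_identity)
  let ?sub = "submod r ?M ?rho"
  have sub_def: "?sub N \<longleftrightarrow> N \<subseteq> ?M \<and> 0 \<in> N \<and> (\<forall>x\<in>N. \<forall>y\<in>N. x + y \<in> N) \<and> (\<forall>x\<in>N. - x \<in> N) \<and>
    (\<forall>x\<in>N. \<forall>a\<in>diagram_span r r. ?rho x a \<in> N)" for N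
    by (rule submod_def[OF prems Mrho l1 l2 as un])
  let ?N = "{m \<in> ?M. beta p r m = 0}"
  have N: "?sub ?N"
    unfolding sub_def using inflate_zero inflate_add inflate_uminus Mrho beta_rmul[OF MX]
    by (auto simp: lin_add[OF lin_beta[OF lin_ident]] lin_uminus[OF lin_beta[OF lin_ident]])
  from complement_exists[OF prems Mrho l1 l2 as un N]
  obtain C where C': "?sub C \<and> ?N \<inter> C = {0} \<and> (\<forall>m\<in>?M. \<exists>n\<in>?N. \<exists>c\<in>C. m = n + c)" ..
  then have C: "?sub C" "?N \<inter> C = {0}" "\<And>m. m \<in> ?M \<Longrightarrow> \<exists>n\<in>?N. \<exists>c\<in>C. m = n + c"
    by simp_all
  have CM: "C \<subseteq> ?M" and C_add: "\<And>x y. x \<in> C \<Longrightarrow> y \<in> C \<Longrightarrow> x + y \<in> C" and C_um: "\<And>x. x \<in> C \<Longrightarrow> - x \<in> C"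
    and C_rho: "\<And>x a. x \<in> C \<Longrightarrow> a \<in> diagram_span r r \<Longrightarrow> ?rho x a \<in> C"
    using C(1) unfolding sub_def by blast+
  have uniq: "c = d" if "c \<in> C" "d \<in> C" "beta p r c = beta p r d" for c d
  proof -
    have "c + - d \<in> C" using that C_add C_um by blast
    moreover have "c + - d \<in> ?N"
      using that CM inflate_add[of c "Suc r" "- d"] inflate_uminus[of d "Suc r"] lin_diff[OF lin_beta[OF lin_ident], of p r c d] by auto
    ultimately have "c + - d = 0" using C(2) by blast
    then show ?thesis by simp
  qed
  have ex: "\<exists>c\<in>C. beta p r c = z" if z: "z \<in> through_span (Suc p) r" "act (idem l) z = z" for z
  proof -
    obtain x where x: "x \<in> through_span p (Suc r)" "beta p r x = z" by (rule beta_surj[OF z(1)])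
    \<comment> \<open>The preimage \<open>x\<close> is not fixed by \<open>idem l\<close> in
      general; applying \<open>idem l\<close> repairs this without changing the image, since
      \<open>beta\<close> commutes with it and \<open>z\<close> is fixed.\<close>
    have "act (idem l) x \<in> ?M" by (rule idem_act_inflate[OF x(1)])
    then obtain n c where nc: "n \<in> ?N" "c \<in> C" "act (idem l) x = n + c" using C(3) by blast
    have "beta p r (n + c) = z" using beta_act[OF idem_sym_alg[OF l], of r x] x(2) z(2) nc(3) by simp
    then show ?thesis using nc by (auto simp: lin_add[OF lin_beta[OF lin_ident]])
  qed
  define \<sigma> where "\<sigma> z = (THE c. c \<in> C \<and> beta p r c = z)" for z
  have \<sigma>: "\<sigma> z \<in> C" "beta p r (\<sigma> z) = z" if "z \<in> through_span (Suc p) r" "act (idem l) z = z" for z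
  proof -
    have "\<exists>!c. c \<in> C \<and> beta p r c = z" using ex[OF that] uniq by blast
    then have "\<sigma> z \<in> C \<and> beta p r (\<sigma> z) = z" unfolding \<sigma>_def by (rule theI')
    then show "\<sigma> z \<in> C" "beta p r (\<sigma> z) = z" by auto
  qed
  have \<sigma>_eq: "\<sigma> z = c" if "c \<in> C" "beta p r c = z" for z c
    unfolding \<sigma>_def by (rule the_equality) (use that uniq in auto)
  define H where "H f = rems_sum f + \<sigma> (adds_sum f)" for f
  have Pr: "f v \<in> inflate v r" if "f \<in> ?P" "v \<in> rems l" for f v
    using that by (auto simp: add_remove_cell_eq PiE_def Pi_def)
  have Pa: "f v \<in> inflate v r" if "f \<in> ?P" "v \<in> adds l" for f v
    using that by (auto simp: add_remove_cell_eq PiE_def Pi_def)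
  have Q: "adds_sum f \<in> through_span (Suc p) r" "act (idem l) (adds_sum f) = adds_sum f" if "f \<in> ?P" for f
    using adds_sum_through_span[of f] Pa[OF that] by blast+
  have bH: "beta p r (H f) = adds_sum f" if "f \<in> ?P" for f
    using \<sigma>(2)[OF Q[OF that]] beta_rems_sum[of f] by (simp add: H_def lin_add[OF lin_beta[OF lin_ident]])
  have HM: "H f \<in> ?M" if "f \<in> ?P" for f
    unfolding H_def using rems_sum_inflate[OF Pr[OF that]] \<sigma>(1)[OF Q[OF that]] CM by (blast intro: inflate_add)
  have congN: "rems_sum (restrict f ?I) = rems_sum f" for f by (rule sum.cong) (auto simp: add_remove_cell_eq)
  have congQ: "adds_sum (restrict f ?I) = adds_sum f" for f by (rule sum.cong) (auto simp: add_remove_cell_eq)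
  have add: "H (\<lambda>m\<in>?I. f m + g m) = H f + H g" if f: "f \<in> ?P" and g: "g \<in> ?P" for f g
  proof -
    have "\<sigma> (adds_sum (\<lambda>m. f m + g m)) = \<sigma> (adds_sum f) + \<sigma> (adds_sum g)"
    proof (rule \<sigma>_eq)
      show "\<sigma> (adds_sum f) + \<sigma> (adds_sum g) \<in> C" using \<sigma>(1)[OF Q[OF f]] \<sigma>(1)[OF Q[OF g]] by (rule C_add)
      show "beta p r (\<sigma> (adds_sum f) + \<sigma> (adds_sum g)) = adds_sum (\<lambda>m. f m + g m)"
        using \<sigma>(2)[OF Q[OF f]] \<sigma>(2)[OF Q[OF g]]
        by (simp add: lin_add[OF lin_beta[OF lin_ident]] lin_add[OF lin_act_right] sum.distrib)
    qed
    then show ?thesis unfolding H_def congN congQ rems_sum_linear(1) by (simp add: algebra_simps)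
  qed
  have act: "H (\<lambda>m\<in>?I. rmul \<delta> (sum_list m) (f m) a) = rmul \<delta> p (H f) (iota r r a)" if f: "f \<in> ?P" and a: "a \<in> diagram_span r r" for f a
  proof -
    have "\<sigma> (adds_sum (\<lambda>m. rmul \<delta> (sum_list m) (f m) a)) = ?rho (\<sigma> (adds_sum f)) a"
    proof (rule \<sigma>_eq)
      show "?rho (\<sigma> (adds_sum f)) a \<in> C" using \<sigma>(1)[OF Q[OF f]] a by (rule C_rho)
      show "beta p r (?rho (\<sigma> (adds_sum f)) a) = adds_sum (\<lambda>m. rmul \<delta> (sum_list m) (f m) a)"
        using beta_rmul[OF MX a, of "\<sigma> (adds_sum f)" \<delta>] \<sigma>[OF Q[OF f]] CM adds_sum_rmul[OF Pa[OF f] a] by auto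
    qed
    moreover have "rems_sum (\<lambda>m. rmul \<delta> (sum_list m) (f m) a) = rmul \<delta> p (rems_sum f) (iota r r a)"
      by (rule rems_sum_rmul[OF _ a]) (rule Pr[OF f])
    ultimately show ?thesis
      unfolding H_def congN congQ by (simp only: lin_add[OF lin_rmul_left])
  qed
  have inj: "inj_on H ?P"
  proof (rule inj_onI)
    fix f g assume f: "f \<in> ?P" and g: "g \<in> ?P" and eq: "H f = H g"
    have Qe: "adds_sum f = adds_sum g" using bH[OF f] bH[OF g] eq by simp
    then have a: "f m = g m" if "m \<in> adds l" for m
      using dn_adds_sum[OF Pa[OF f] that] dn_adds_sum[OF Pa[OF g] that] by simp
    have "rems_sum (\<lambda>v. f v - g v) = 0" unfolding rems_sum_linear using eq Qe by (simp add: H_def)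
    moreover have "f v - g v \<in> inflate v r" if "v \<in> rems l" for v
      using Pr[OF f that] Pr[OF g that] by (auto simp: inflate_def lin_diff[OF lin_act_right])
    ultimately have b: "f v - g v = 0" if "v \<in> rems l" for v
      using rems_sum_zero_imp[of "\<lambda>v. f v - g v"] that by blast
    show "f = g"
      by (rule PiE_ext[OF f g]) (use a b in \<open>auto simp: add_remove_cell_eq\<close>)
  qed
  have surj: "?M \<subseteq> H ` ?P"
  proof
    fix m assume m: "m \<in> ?M"
    obtain n c where nc: "n \<in> ?N" "c \<in> C" "m = n + c" using C(3)[OF m] by blast
    obtain f where f: "\<forall>v\<in>rems l. f v \<in> inflate v r" "n = rems_sum f" using inflate_kernel_beta[of n] nc(1) by blast
    let ?z = "beta p r c"
    have cM: "c \<in> ?M" using CM nc(2) by blast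
    have z: "?z \<in> through_span (Suc p) r" "act (idem l) ?z = ?z"
      using beta_through_span[OF MX[OF cM]] beta_act[OF idem_sym_alg[OF l], of r c] cM by (simp_all add: inflate_iff)
    define g where "g = (\<lambda>v\<in>?I. if v \<in> rems l then f v else act (dn l v) ?z)"
    have gr: "g v = f v" if "v \<in> rems l" for v using that by (simp add: g_def add_remove_cell_eq)
    have ga: "g v = act (dn l v) ?z" if "v \<in> adds l" for v
      using that adds_rems_disjoint[of l] by (auto simp: g_def add_remove_cell_eq)
    have "g \<in> ?P"
      unfolding g_def using f(1) adds_sum_surj(1)[OF z] by (auto simp: add_remove_cell_eq)
    moreover have "rems_sum g = n" unfolding f(2) by (rule sum.cong) (simp_all add: gr)
    moreover have "adds_sum g = ?z" using adds_sum_surj(2)[OF z] by (simp add: ga cong: sum.cong)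
    moreover have "\<sigma> ?z = c" by (rule \<sigma>_eq[OF nc(2) refl])
    ultimately show "m \<in> H ` ?P" using nc(3) by (intro image_eqI[of _ _ g]) (simp_all add: H_def)
  qed
  have "bij_betw H ?P ?M" unfolding bij_betw_def using inj surj HM by blast
  then show ?thesis using add act by blast
qed

end

section \<open>Specht modules as right ideals\<close>

lemma sym_group_simps [simp]: "carrier (sym_group p) = app ` Sym p" "\<one>\<^bsub>sym_group p\<^esub> = id" "mult (sym_group p) = (\<circ>)"
proof -
  have "\<pi> \<in> app ` Sym p" if "\<pi> permutes {1..p}" for \<pi>
    using app_Fperm[OF that] Sym_Fperm[OF that] by (intro image_eqI[of _ _ "Fperm \<pi>"]) auto
  then show "carrier (sym_group p) = app ` Sym p" by (auto simp: sym_group_def Sym_def)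
qed (simp_all add: sym_group_def)

lemma group_algebra_carrier: "carrier (group_algebra (sym_group p)) = free_on (app ` Sym p)"
  by (simp add: group_algebra_def)

definition to_sym_alg :: "((nat \<Rightarrow> nat) \<Rightarrow>\<^sub>0 'k::comm_ring_1) \<Rightarrow> 'k perm_alg" where
  "to_sym_alg = linear_ext (\<lambda>\<pi>. mon (Fperm \<pi>))"

definition of_sym_alg :: "'k::comm_ring_1 perm_alg \<Rightarrow> ((nat \<Rightarrow> nat) \<Rightarrow>\<^sub>0 'k)" where
  "of_sym_alg = linear_ext (\<lambda>g. mon (app g))"

lemma lin_to_sym_alg [lin_intros]: "lin F \<Longrightarrow> lin (\<lambda>x. to_sym_alg (F x))"
  and lin_of_sym_alg [lin_intros]: "lin G \<Longrightarrow> lin (\<lambda>x. of_sym_alg (G x))"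
  unfolding to_sym_alg_def of_sym_alg_def by (rule lin_comp_linear_ext; assumption)+

lemma to_sym_alg_single [simp]: "to_sym_alg (Poly_Mapping.single (app g) c) = Poly_Mapping.single g c"
  by (simp add: to_sym_alg_def app_inverse)

lemma to_of_sym_alg: "to_sym_alg (of_sym_alg a) = a"
  by (rule lin_eqI_UNIV[of "\<lambda>a. to_sym_alg (of_sym_alg a)" "\<lambda>a. a"]) (auto intro!: lin_intros simp: of_sym_alg_def app_inverse to_sym_alg_def)

lemma to_sym_alg_closed: "a \<in> free_on (app ` Sym p) \<Longrightarrow> to_sym_alg a \<in> sym_alg p"
  by (rule lin_closed[where F = to_sym_alg]) (auto intro!: lin_intros free_on_single)

lemma of_sym_alg_closed: "a \<in> sym_alg p \<Longrightarrow> of_sym_alg a \<in> free_on (app ` Sym p)"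
  by (rule lin_closed[where F = of_sym_alg]) (auto intro!: lin_intros free_on_single simp: of_sym_alg_def)

lemma lact_diagram_bimodule:
  assumes "a \<in> free_on (app ` Sym p)" "x \<in> through_span p r"
  shows "lact (diagram_bimodule \<delta> p r) a x = act (to_sym_alg a) x"
proof -
  have "bilinear_ext (\<lambda>\<pi>. truncated_mult \<delta> p (permutation_diagram p \<pi>)) a x = act (to_sym_alg a) x"
  proof (rule bilin_eqI[of "bilinear_ext (\<lambda>\<pi>. truncated_mult \<delta> p (permutation_diagram p \<pi>))" "\<lambda>a x. act (to_sym_alg a) x", OF _ _ _ _ assms])
    fix \<pi> d assume "\<pi> \<in> app ` Sym p" and d: "d \<in> through p r"
    then obtain g where g: "g \<in> Sym p" "\<pi> = app g" by blast
    have pd: "permutation_diagram p (app g) \<in> diagrams p p"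
      unfolding permutation_diagram_relab using g(1) by blast
    show "bilinear_ext (\<lambda>\<pi>. truncated_mult \<delta> p (permutation_diagram p \<pi>)) (mon \<pi>) (mon d) = act (to_sym_alg (mon \<pi>)) (mon d)"
      using truncated_mult_eq[OF pd through_D[OF d], of \<delta>] compose_permutation_diagram[OF g(1) through_D[OF d]] d g(2)
      by (simp add: through_def)
  qed (intro lin_intros)+
  then show ?thesis by (simp add: diagram_bimodule_def)
qed

lemma diagram_bimodule_simps [simp]:
  "carrier (diagram_bimodule \<delta> p r) = through_span p r" "add (diagram_bimodule \<delta> p r) = (+)" "zero (diagram_bimodule \<delta> p r) = 0"
  "ract (diagram_bimodule \<delta> p r) = rmul \<delta> p"
  by (simp_all add: diagram_bimodule_def diagrams_prop_through)

lemma specht_module_simps [simp]: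
  "carrier (specht_module l) = scale.span (polytabloid l ` tableaux l)" "add (specht_module l) = (+)" "zero (specht_module l) = 0"
  "ract (specht_module l) = bilinear_ext (\<lambda>f \<pi>. mon (f \<circ> \<pi>))"
  by (simp_all add: specht_module_def)

section \<open>Tabloids in terms of the group algebra\<close>

context
  fixes l :: "nat list" and p :: nat
  assumes l: "l \<in> partitions p"
begin

definition base_tabloid :: "nat \<Rightarrow> nat" where
  "base_tabloid = (\<lambda>a\<in>{1..p}. fst (ptab l a))"

text \<open>Identifies the permutation module on tabloids with the right ideal generated by the row
  symmetrizer, to which the base tabloid corresponds. A tabloid equals
  \<open>base_tabloid \<circ> app g\<close> for a whole coset of permutations \<open>g\<close>, and
  its coefficient is recorded at each of them.\<close>

definition tabloid_coords :: "((nat \<Rightarrow> nat) \<Rightarrow>\<^sub>0 'k::comm_ring_1) \<Rightarrow> 'k perm_alg" where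
  "tabloid_coords v = (\<Sum>g\<in>Sym p. Poly_Mapping.single g (coef v (base_tabloid \<circ> app g)))"

lemma coef_tabloid_coords: "coef (tabloid_coords v) g = (if g \<in> Sym p then coef v (base_tabloid \<circ> app g) else 0)"
  by (simp add: tabloid_coords_def lookup_sum lookup_single when_def)

lemma lin_tabloid_coords [lin_intros]: "lin F \<Longrightarrow> lin (\<lambda>x. tabloid_coords (F x))"
  unfolding lin_def by (auto intro!: poly_mapping_eqI simp: coef_tabloid_coords lookup_add)

lemma tabloid_coords_sym_alg: "tabloid_coords v \<in> sym_alg p"
  by (auto simp: free_on_iff coef_tabloid_coords split: if_splits)

definition tabloid_set :: "(nat \<Rightarrow> nat) set" where
  "tabloid_set = (\<lambda>g. base_tabloid \<circ> app g) ` Sym p"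

lemma tabloid_coords_inj:
  assumes "v \<in> free_on tabloid_set" "w \<in> free_on tabloid_set" "tabloid_coords v = tabloid_coords w"
  shows "v = w"
proof (rule poly_mapping_eqI)
  fix f
  show "coef v f = coef w f"
  proof (cases "f \<in> tabloid_set")
    case True
    then obtain g where "g \<in> Sym p" "f = base_tabloid \<circ> app g" by (auto simp: tabloid_set_def)
    then show ?thesis using coef_tabloid_coords[of v g] coef_tabloid_coords[of w g] assms(3) by simp
  next
    case False
    then have "coef v f = 0" "coef w f = 0" using assms(1,2) unfolding free_on_iff by blast+
    then show ?thesis by simp
  qed
qed

lemma base_tabloid_eq_iff:
  assumes "g \<in> Sym p" shows "base_tabloid \<circ> app g = base_tabloid \<longleftrightarrow> g \<in> stab p (fst \<circ> ptab l)"
proof -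
  have "base_tabloid (app g a) = base_tabloid a \<longleftrightarrow> (a \<in> {1..p} \<longrightarrow> fst (ptab l (app g a)) = fst (ptab l a))" for a
    using Sym_app_in[OF assms, of a] Sym_app_out[OF assms, of a] by (auto simp: base_tabloid_def simp del: atLeastAtMost_iff)
  then show ?thesis using assms by (simp add: fun_eq_iff stab_def Ball_def del: atLeastAtMost_iff)
qed

lemma comp_app_add: "f \<circ> app (g + h) = f \<circ> app g \<circ> app h"
  by (simp add: plus_fperm.rep_eq comp_assoc)

lemma comp_app_diff: "f \<circ> app (g - h) = f \<circ> app g \<circ> app (- h)"
  using comp_app_add[of f g "- h"] by simp

lemma comp_app_cancel: "f \<circ> app h = f' \<circ> app g \<longleftrightarrow> f \<circ> app (h - g) = f'"
proof
  assume "f \<circ> app h = f' \<circ> app g"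
  then have "f \<circ> app h \<circ> app (- g) = f' \<circ> app g \<circ> app (- g)" by simp
  then show "f \<circ> app (h - g) = f'"
    by (simp add: comp_app_add[symmetric]) (simp add: fun_eq_iff)
next
  assume "f \<circ> app (h - g) = f'"
  then have "f' \<circ> app g = f \<circ> app (h - g + g)" by (simp only: comp_app_add)
  then show "f \<circ> app h = f' \<circ> app g" by simp
qed

text \<open>The permutations \<open>x\<close> giving the same tabloid as \<open>h\<close> are those
  with \<open>x - h\<close> in the row stabilizer.\<close>

lemma tabloid_coords_mon:
  assumes h: "h \<in> Sym p"
  shows "tabloid_coords (mon (base_tabloid \<circ> app h)) = row_symm p (fst \<circ> ptab l) * mon h"
proof (rule poly_mapping_eqI)
  fix x
  show "coef (tabloid_coords (mon (base_tabloid \<circ> app h))) x = coef (row_symm p (fst \<circ> ptab l) * mon h) x"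
  proof (cases "x \<in> Sym p")
    case True
    then have "x - h \<in> Sym p" using h Sym_add[of x p "- h"] by simp
    then have "base_tabloid \<circ> app x = base_tabloid \<circ> app h \<longleftrightarrow> x - h \<in> stab p (fst \<circ> ptab l)"
      unfolding comp_app_cancel by (rule base_tabloid_eq_iff)
    then show ?thesis using True by (auto simp: coef_tabloid_coords coef_mult_mon coef_symm lookup_single when_def)
  next
    case False
    then have "x - h \<notin> Sym p" using h Sym_add_iff_right[of "- h" p x] by simp
    then have "x - h \<notin> stab p (fst \<circ> ptab l)" using stab_Sym by blast
    then show ?thesis using False by (simp add: coef_tabloid_coords coef_mult_mon coef_symm)
  qed
qed

lemma tabloid_coords_ract:
  assumes "v \<in> free_on tabloid_set" "a \<in> free_on (app ` Sym p)"
  shows "tabloid_coords (bilinear_ext (\<lambda>f \<pi>. mon (f \<circ> \<pi>)) v a) = tabloid_coords v * to_sym_alg a"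
    and "bilinear_ext (\<lambda>f \<pi>. mon (f \<circ> \<pi>)) v a \<in> (free_on tabloid_set :: ((nat \<Rightarrow> nat) \<Rightarrow>\<^sub>0 'k::comm_ring_1) set)"
proof -
  show "tabloid_coords (bilinear_ext (\<lambda>f \<pi>. mon (f \<circ> \<pi>)) v a) = tabloid_coords v * to_sym_alg a"
  proof (rule bilin_eqI[of "\<lambda>v a. tabloid_coords (bilinear_ext (\<lambda>f \<pi>. mon (f \<circ> \<pi>)) v a)" "\<lambda>v a. tabloid_coords v * to_sym_alg a", OF _ _ _ _ assms])
    fix f \<pi> assume "f \<in> tabloid_set" "\<pi> \<in> app ` Sym p"
    then obtain h g where hg: "h \<in> Sym p" "f = base_tabloid \<circ> app h" "g \<in> Sym p" "\<pi> = app g"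
      by (auto simp: tabloid_set_def)
    have "tabloid_coords (bilinear_ext (\<lambda>f \<pi>. mon (f \<circ> \<pi>)) (mon f) (mon \<pi>)) = tabloid_coords (mon (base_tabloid \<circ> app (h + g)) :: (nat \<Rightarrow> nat) \<Rightarrow>\<^sub>0 'k)"
      by (simp add: hg comp_app_add)
    also have "\<dots> = tabloid_coords (mon f) * to_sym_alg (mon \<pi>)"
      using hg by (simp only: tabloid_coords_mon Sym_add mult.assoc mon_mult to_sym_alg_single)
    finally show "tabloid_coords (bilinear_ext (\<lambda>f \<pi>. mon (f \<circ> \<pi>)) (mon f) (mon \<pi>)) = tabloid_coords (mon f :: (nat \<Rightarrow> nat) \<Rightarrow>\<^sub>0 'k) * to_sym_alg (mon \<pi>)" .
  qed (intro lin_intros)+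
  show "bilinear_ext (\<lambda>f \<pi>. mon (f \<circ> \<pi>)) v a \<in> (free_on tabloid_set :: ((nat \<Rightarrow> nat) \<Rightarrow>\<^sub>0 'k) set)"
  proof (rule bilinear_ext_closed[OF assms])
    fix f \<pi> assume "f \<in> tabloid_set" "\<pi> \<in> app ` Sym p"
    then obtain h g where hg: "h \<in> Sym p" "f = base_tabloid \<circ> app h" "g \<in> Sym p" "\<pi> = app g"
      by (auto simp: tabloid_set_def)
    then have "f \<circ> \<pi> = base_tabloid \<circ> app (h + g)" by (simp add: comp_app_add)
    then show "mon (f \<circ> \<pi>) \<in> free_on tabloid_set" using hg by (auto simp: tabloid_set_def intro!: free_on_single)
  qed
qed

lemma tableau_inv_tab:
  assumes t: "t \<in> tableaux l" shows "tab p l (inv_into (young_diagram l) t)"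
  using t bij_betw_inv_into by (auto simp: tableaux_def tab_def partitions_sum_list[OF l])

lemma column_stabilizer_eq:
  assumes t: "t \<in> tableaux l"
  shows "column_stabilizer l t = app ` stab p (snd \<circ> inv_into (young_diagram l) t)"
proof -
  let ?Y = "young_diagram l" and ?T = "inv_into (young_diagram l) t"
  have bt: "bij_betw t ?Y {1..p}" using t by (simp add: tableaux_def partitions_sum_list[OF l])
  have inv: "?T (t c) = c" if "c \<in> ?Y" for c using bt that by (simp add: bij_betw_def)
  have inv': "t (?T a) = a" "?T a \<in> ?Y" if "a \<in> {1..p}" for a
    using bt that by (metis bij_betw_inv_into_right) (metis bt that bij_betw_def inv_into_into)
  have img: "t c \<in> {1..p}" if "c \<in> ?Y" for c using bt that by (meson bij_betwE)
  have iff: "(\<forall>c\<in>?Y. \<exists>d\<in>?Y. app g (t c) = t d \<and> snd d = snd c) \<longleftrightarrow> (\<forall>a\<in>{1..p}. snd (?T (app g a)) = snd (?T a))"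
    if g: "g \<in> Sym p" for g
  proof
    assume L: "\<forall>c\<in>?Y. \<exists>d\<in>?Y. app g (t c) = t d \<and> snd d = snd c"
    show "\<forall>a\<in>{1..p}. snd (?T (app g a)) = snd (?T a)"
    proof
      fix a assume a: "a \<in> {1..p}"
      obtain d where "d \<in> ?Y" "app g (t (?T a)) = t d" "snd d = snd (?T a)" using L inv'(2)[OF a] by blast
      then show "snd (?T (app g a)) = snd (?T a)" using inv inv'(1)[OF a] by simp
    qed
  next
    assume R: "\<forall>a\<in>{1..p}. snd (?T (app g a)) = snd (?T a)"
    show "\<forall>c\<in>?Y. \<exists>d\<in>?Y. app g (t c) = t d \<and> snd d = snd c"
    proof
      fix c assume c: "c \<in> ?Y"
      have "app g (t c) \<in> {1..p}" using img[OF c] Sym_app_in[OF g] by blast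
      then show "\<exists>d\<in>?Y. app g (t c) = t d \<and> snd d = snd c"
        using inv'[of "app g (t c)"] R img[OF c] inv[OF c] by (intro bexI[of _ "?T (app g (t c))"]) auto
    qed
  qed
  have "column_stabilizer l t = {\<sigma> \<in> app ` Sym p. \<forall>c\<in>?Y. \<exists>d\<in>?Y. \<sigma> (t c) = t d \<and> snd d = snd c}"
    using sym_group_simps(1)[of p] unfolding column_stabilizer_def partitions_sum_list[OF l] sym_group_def by auto
  also have "\<dots> = app ` {g \<in> Sym p. \<forall>c\<in>?Y. \<exists>d\<in>?Y. app g (t c) = t d \<and> snd d = snd c}" by blast
  also have "{g \<in> Sym p. \<forall>c\<in>?Y. \<exists>d\<in>?Y. app g (t c) = t d \<and> snd d = snd c} = stab p (snd \<circ> ?T)"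
    using iff by (auto simp: stab_def)
  finally show ?thesis .
qed

lemma tabloid_comp:
  assumes t: "t \<in> tableaux l" and g: "g \<in> Sym p"
  shows "tabloid l (app g \<circ> t) = tabloid l t \<circ> app (- g)"
proof
  fix a
  let ?Y = "young_diagram l"
  have bt: "bij_betw t ?Y {1..p}" using t by (simp add: tableaux_def partitions_sum_list[OF l])
  show "tabloid l (app g \<circ> t) a = (tabloid l t \<circ> app (- g)) a"
  proof (cases "a \<in> {1..p}")
    case True
    then have b: "app (- g) a \<in> {1..p}" using Sym_app_in[of "- g" p a] g by simp
    let ?c = "inv_into ?Y t (app (- g) a)"
    have c: "?c \<in> ?Y" "t ?c = app (- g) a"
      using bt b by (metis bij_betw_def inv_into_into) (metis bt b bij_betw_inv_into_right)
    have "inj_on (app g \<circ> t) ?Y" using bt by (auto simp: inj_on_def bij_betw_def)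
    moreover have "(app g \<circ> t) ?c = a" using c(2) by simp
    ultimately have "inv_into ?Y (app g \<circ> t) a = ?c" using c(1) by (metis inv_into_f_f)
    then show ?thesis using True b by (simp add: tabloid_def partitions_sum_list[OF l])
  next
    case False
    then have "app (- g) a = a" using Sym_app_out[of "- g" p a] g by simp
    then show ?thesis using False unfolding tabloid_def partitions_sum_list[OF l] by (simp only: comp_apply restrict_apply if_False)
  qed
qed

text \<open>In coordinates the polytabloid is the row symmetrizer times \<open>mon k\<close> times
  the column symmetrizer of \<open>t\<close>. Moving \<open>k\<close> to the right turns the latter
  into the column symmetrizer of the fixed tableau.\<close>

lemma polytabloid_coords:
  assumes t: "t \<in> tableaux l" and k: "k \<in> Sym p"
    and tk: "\<And>a. a \<in> {1..p} \<Longrightarrow> inv_into (young_diagram l) t a = ptab l (app k a)"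
  shows "polytabloid l t \<in> (free_on tabloid_set :: ((nat \<Rightarrow> nat) \<Rightarrow>\<^sub>0 'k::comm_ring_1) set)"
    and "tabloid_coords (polytabloid l t) = (young p (ptab l) * mon k :: 'k perm_alg)"
proof -
  let ?T = "inv_into (young_diagram l) t"
  let ?h = "snd \<circ> ?T"
  have tb: "tabloid l t = base_tabloid \<circ> app k"
  proof
    fix a show "tabloid l t a = (base_tabloid \<circ> app k) a"
      using tk[of a] Sym_app_in[OF k, of a] by (auto simp: tabloid_def base_tabloid_def partitions_sum_list[OF l] simp del: atLeastAtMost_iff)
  qed
  have "polytabloid l t = (\<Sum>g\<in>stab p ?h. Poly_Mapping.single (tabloid l (app g \<circ> t)) (of_int (sign (app g))) :: (nat \<Rightarrow> nat) \<Rightarrow>\<^sub>0 'k)"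
    unfolding polytabloid_def column_stabilizer_eq[OF t]
    by (rule sum.reindex[THEN trans]) (simp_all add: inj_on_def app_inject)
  also have "\<dots> = (\<Sum>g\<in>stab p ?h. scale (of_int (psign g)) (mon (base_tabloid \<circ> app (k + - g))))"
    by (rule sum.cong[OF refl]) (simp add: tabloid_comp[OF t stab_Sym] tb comp_app_diff psign_def)
  finally have pt: "polytabloid l t = (\<Sum>g\<in>stab p ?h. scale (of_int (psign g)) (mon (base_tabloid \<circ> app (k + - g))) :: (nat \<Rightarrow> nat) \<Rightarrow>\<^sub>0 'k)" .
  have ks: "k + - g \<in> Sym p" if "g \<in> stab p ?h" for g
    by (intro Sym_add Sym_uminus) (use k stab_Sym[OF that] in auto)
  show "polytabloid l t \<in> (free_on tabloid_set :: ((nat \<Rightarrow> nat) \<Rightarrow>\<^sub>0 'k) set)"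
    unfolding pt using ks by (intro free_on_sum free_on_scale free_on_single) (auto simp: tabloid_set_def)
  have "tabloid_coords (polytabloid l t) = (\<Sum>g\<in>stab p ?h. scale (of_int (psign g)) (row_symm p (fst \<circ> ptab l) * mon (k + - g)) :: 'k perm_alg)"
    unfolding pt lin_sum[OF lin_tabloid_coords[OF lin_ident]] lin_scale[OF lin_tabloid_coords[OF lin_ident]]
    by (rule sum.cong[OF refl]) (simp only: tabloid_coords_mon[OF ks])
  also have "\<dots> = row_symm p (fst \<circ> ptab l) * mon k * (\<Sum>g\<in>stab p ?h. scale (of_int (psign g)) (mon (- g)))"
    by (simp only: sum_distrib_left scale_mult_right mult.assoc mon_mult)
  \<comment> \<open>The action by composition on the right introduces inverses; they are harmless
    because the column symmetrizer is invariant under \<open>star\<close>.\<close>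
  also have "(\<Sum>g\<in>stab p ?h. scale (of_int (psign g)) (mon (- g))) = (star (col_symm p ?h) :: 'k perm_alg)"
    by (simp add: symm_def lin_sum[OF lin_star[OF lin_ident]])
  also have "\<dots> = col_symm p ?h" by (rule star_symm[OF multiplicative_psign])
  also have "row_symm p (fst \<circ> ptab l) * mon k * col_symm p ?h = row_symm p (fst \<circ> ptab l) * (mon k * (col_symm p ?h :: 'k perm_alg))"
    by (rule mult.assoc)
  also have "mon k * col_symm p ?h = (col_symm p (?h \<circ> app (- k)) * mon k :: 'k perm_alg)"
    by (rule symm_conj[OF multiplicative_psign k])
  also have "(col_symm p (?h \<circ> app (- k)) :: 'k perm_alg) = col_symm p (snd \<circ> ptab l)"
  proof (rule symm_cong)
    fix a assume "a \<in> {1..p}"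
    then have "app (- k) a \<in> {1..p}" using Sym_app_in[of "- k" p a] k by simp
    then show "(?h \<circ> app (- k)) a = (snd \<circ> ptab l) a" using tk[of "app (- k) a"] by simp
  qed
  finally show "tabloid_coords (polytabloid l t) = (young p (ptab l) * mon k :: 'k perm_alg)"
    by (simp add: young_def mult.assoc comp_def)
qed

lemma polytabloid_coords_ex:
  assumes t: "t \<in> tableaux l"
  shows "polytabloid l t \<in> (free_on tabloid_set :: ((nat \<Rightarrow> nat) \<Rightarrow>\<^sub>0 'k::comm_ring_1) set)"
    and "\<exists>k\<in>Sym p. tabloid_coords (polytabloid l t) = (young p (ptab l) * mon k :: 'k perm_alg)"
proof -
  obtain k where "k \<in> Sym p" "\<And>a. a \<in> {1..p} \<Longrightarrow> ptab l (app k a) = inv_into (young_diagram l) t a"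
    using tab_transition[OF tab_ptab[OF l] tableau_inv_tab[OF t]] by metis
  then show "polytabloid l t \<in> (free_on tabloid_set :: ((nat \<Rightarrow> nat) \<Rightarrow>\<^sub>0 'k) set)"
    and "\<exists>k\<in>Sym p. tabloid_coords (polytabloid l t) = (young p (ptab l) * mon k :: 'k perm_alg)"
    using polytabloid_coords[OF t, of k, where 'k = 'k] by auto
qed

lemma tableau_of_Sym:
  assumes k: "k \<in> Sym p"
  obtains t where "t \<in> tableaux l" "\<And>a. a \<in> {1..p} \<Longrightarrow> inv_into (young_diagram l) t a = ptab l (app k a)"
proof
  have T: "bij_betw (ptab l \<circ> app k) {1..p} (young_diagram l)"
    using tab_comp[OF tab_ptab[OF l] k] by (simp add: tab_def)
  let ?t = "inv_into {1..p} (ptab l \<circ> app k)"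
  have t: "bij_betw ?t (young_diagram l) {1..p}" using T by (rule bij_betw_inv_into)
  then show "?t \<in> tableaux l" by (simp add: tableaux_def partitions_sum_list[OF l])
  fix a assume a: "a \<in> {1..p}"
  have "?t (ptab l (app k a)) = a" using bij_betw_inv_into_left[OF T a] by simp
  moreover have "ptab l (app k a) \<in> young_diagram l" using T a by (auto simp: bij_betw_def)
  ultimately show "inv_into (young_diagram l) ?t a = ptab l (app k a)"
    using bij_betw_inv_into_left[OF t, of "ptab l (app k a)"] by simp
qed

abbreviation specht_carrier :: "((nat \<Rightarrow> nat) \<Rightarrow>\<^sub>0 'k::field_char_0) set" where
  "specht_carrier \<equiv> scale.span (polytabloid l ` tableaux l)"

lemma specht_carrier_tabloid_set: "v \<in> specht_carrier \<Longrightarrow> v \<in> free_on tabloid_set"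
proof (induction rule: scale.span_induct_alt)
  case (step c x y)
  then show ?case using polytabloid_coords_ex(1) by auto
qed simp

lemma specht_coords_idem:
  "v \<in> specht_carrier \<Longrightarrow> idem l * tabloid_coords v = (tabloid_coords v :: 'k::field_char_0 perm_alg)"
proof (induction rule: scale.span_induct_alt)
  case base
  show ?case by (simp add: lin_0[OF lin_tabloid_coords[OF lin_ident]])
next
  case (step c x y)
  then obtain t where t: "t \<in> tableaux l" "x = polytabloid l t" by blast
  obtain k where k: "tabloid_coords x = (young p (ptab l) * mon k :: 'k perm_alg)"
    using polytabloid_coords_ex(2)[OF t(1), where 'k = 'k] t(2) by blast
  obtain d where d: "d \<noteq> 0" "(idem l :: 'k perm_alg) = scale d (young p (ptab l))" by (rule idem_young[OF l])
  have "young p (ptab l) = scale (inverse d) (idem l :: 'k perm_alg)" using d by simp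
  then have "idem l * young p (ptab l) = (young p (ptab l) :: 'k perm_alg)"
    by (simp add: scale_mult_right idem_idem[OF l])
  then have "idem l * tabloid_coords x = tabloid_coords x" unfolding k by (simp flip: mult.assoc)
  then show ?case using step(2)
    by (simp add: lin_add[OF lin_tabloid_coords[OF lin_ident]] lin_scale[OF lin_tabloid_coords[OF lin_ident]] distrib_left scale_mult_right)
qed

text \<open>Every permutation \<open>k\<close> comes from a tableau, whose polytabloid has the
  coordinates \<open>young p (ptab l) * mon k\<close>. Together with
  \<open>specht_coords_idem\<close> and \<open>tabloid_coords_inj\<close> this identifies the Specht
  module with the right ideal of \<open>idem l\<close>.\<close>

lemma specht_coords_surj:
  assumes "a \<in> sym_alg p"
  shows "\<exists>v\<in>specht_carrier. tabloid_coords v = (idem l * a :: 'k::field_char_0 perm_alg)"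
  using assms
proof (induction rule: free_on_induct)
  case (scaled k c)
  obtain t where t: "t \<in> tableaux l" "\<And>a. a \<in> {1..p} \<Longrightarrow> inv_into (young_diagram l) t a = ptab l (app k a)"
    by (rule tableau_of_Sym[OF scaled]) blast
  obtain d where d: "d \<noteq> 0" "(idem l :: 'k perm_alg) = scale d (young p (ptab l))" by (rule idem_young[OF l])
  have "tabloid_coords (polytabloid l t) = (young p (ptab l) * mon k :: 'k perm_alg)"
    by (rule polytabloid_coords(2)[OF t(1) scaled]) (rule t(2))
  then have "tabloid_coords (scale (c * d) (polytabloid l t)) = (idem l * scale c (mon k) :: 'k perm_alg)"
    unfolding lin_scale[OF lin_tabloid_coords[OF lin_ident]] d(2) scale_mult_left scale_mult_right
    by simp
  moreover have "scale (c * d) (polytabloid l t) \<in> specht_carrier"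
    using t(1) by (intro scale.span_scale scale.span_base) blast
  ultimately show ?case by blast
next
  case (add a b)
  then obtain v w where "v \<in> specht_carrier" "tabloid_coords v = idem l * a" "w \<in> specht_carrier" "tabloid_coords w = idem l * b" by blast
  then show ?case
    by (intro bexI[of _ "v + w"]) (simp_all add: lin_add[OF lin_tabloid_coords[OF lin_ident]] distrib_left scale.span_add)
next
  show "\<exists>v\<in>specht_carrier. tabloid_coords v = idem l * 0"
    by (intro bexI[of _ 0]) (simp_all add: lin_0[OF lin_tabloid_coords[OF lin_ident]] scale.span_zero)
qed

text \<open>Closure is read off in coordinates: a right multiple of the coordinates of
  \<open>v\<close> stays in the right ideal of \<open>idem l\<close>, so it comes from some
  \<open>w\<close> in the Specht module, and injectivity gives \<open>w\<close>.\<close>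

lemma specht_ract_closed:
  assumes v: "v \<in> specht_carrier" and a: "a \<in> free_on (app ` Sym p)"
  shows "bilinear_ext (\<lambda>f \<pi>. mon (f \<circ> \<pi>)) v a \<in> (specht_carrier :: ((nat \<Rightarrow> nat) \<Rightarrow>\<^sub>0 'k::field_char_0) set)"
proof -
  have vt: "v \<in> free_on tabloid_set" by (rule specht_carrier_tabloid_set[OF v])
  obtain w where w: "w \<in> specht_carrier" "tabloid_coords w = idem l * (tabloid_coords v * to_sym_alg a)"
    using specht_coords_surj[OF sym_alg_mult[OF tabloid_coords_sym_alg to_sym_alg_closed[OF a]], of v] by blast
  have "idem l * (tabloid_coords v * to_sym_alg a) = tabloid_coords v * to_sym_alg a"
    using specht_coords_idem[OF v] by (simp flip: mult.assoc)
  then have "tabloid_coords w = tabloid_coords (bilinear_ext (\<lambda>f \<pi>. mon (f \<circ> \<pi>)) v a)"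
    using w(2) tabloid_coords_ract(1)[OF vt a] by simp
  then have "w = bilinear_ext (\<lambda>f \<pi>. mon (f \<circ> \<pi>)) v a"
    by (rule tabloid_coords_inj[OF specht_carrier_tabloid_set[OF w(1)] tabloid_coords_ract(2)[OF vt a]])
  then show ?thesis using w(1) by simp
qed

end

section \<open>Inflation of Specht modules\<close>

text \<open>Two modules parametrized by one set \<open>P\<close>, which carries no structure of its
  own: the sum and the action are matched by a common parameter \<open>h\<close>.\<close>

lemma right_module_iso_via:
  assumes B: "bij_betw B P (carrier M)" and A: "bij_betw A P (carrier N)"
    and add: "\<And>f g. f \<in> P \<Longrightarrow> g \<in> P \<Longrightarrow> \<exists>h\<in>P. B h = B f \<oplus>\<^bsub>M\<^esub> B g \<and> A h = A f \<oplus>\<^bsub>N\<^esub> A g"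
    and act: "\<And>f a. f \<in> P \<Longrightarrow> a \<in> carrier R \<Longrightarrow> \<exists>h\<in>P. B h = B f \<lhd>\<^bsub>M\<^esub> a \<and> A h = A f \<lhd>\<^bsub>N\<^esub> a"
  shows "right_module_iso R M N"
  unfolding right_module_iso_def
proof (intro exI conjI ballI)
  let ?F = "\<lambda>x. A (inv_into P B x)"
  have inv: "inv_into P B (B f) = f" if "f \<in> P" for f using B that by (simp add: bij_betw_def)
  have ex: "\<exists>f\<in>P. x = B f" if "x \<in> carrier M" for x using B that unfolding bij_betw_def by blast
  show "bij_betw ?F (carrier M) (carrier N)"
    using bij_betw_trans[OF bij_betw_inv_into[OF B] A] by (simp add: comp_def)
  fix x assume "x \<in> carrier M"
  then obtain f where f: "f \<in> P" "x = B f" using ex by blast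
  show "?F (x \<lhd>\<^bsub>M\<^esub> a) = ?F x \<lhd>\<^bsub>N\<^esub> a" if a: "a \<in> carrier R" for a
  proof -
    obtain h where "h \<in> P" "B h = B f \<lhd>\<^bsub>M\<^esub> a" "A h = A f \<lhd>\<^bsub>N\<^esub> a" using act[OF f(1) a] by blast
    then show ?thesis using f inv by metis
  qed
  fix y assume "y \<in> carrier M"
  then obtain g where g: "g \<in> P" "y = B g" using ex by blast
  obtain h where "h \<in> P" "B h = B f \<oplus>\<^bsub>M\<^esub> B g" "A h = A f \<oplus>\<^bsub>N\<^esub> A g" using add[OF f(1) g(1)] by blast
  then show "?F (x \<oplus>\<^bsub>M\<^esub> y) = ?F x \<oplus>\<^bsub>N\<^esub> ?F y" using f g inv by metis
qed

text \<open>The tensor product \<open>S\<^sup>l \<otimes> KD(p,r;p)\<close> is identified with \<open>e KD(p,r;p)\<close> via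
  \<open>v \<otimes> w \<mapsto> \<phi>(v) w\<close>, where \<open>\<phi>\<close> identifies the Specht module with the right ideal generated by
  the idempotent \<open>e\<close>; the inverse map sends \<open>z\<close> to \<open>\<phi>\<^sup>-\<^sup>1(e) \<otimes> z\<close>.\<close>

context
  fixes \<delta> :: "'k::field_char_0" and l :: "nat list" and p r :: nat
  assumes l: "l \<in> partitions p"
begin

section \<open>The tensor product as a quotient of a free abelian group\<close>

abbreviation "specht \<equiv> (specht_carrier l :: ((nat \<Rightarrow> nat) \<Rightarrow>\<^sub>0 'k) set)"
abbreviation "pair_group \<equiv> free_Abelian_group (specht \<times> (through_span p r :: ('k diagram_comb) set))"
abbreviation "rel_gens \<equiv> tensor_relations (group_algebra (sym_group p)) (specht_module l) (diagram_bimodule \<delta> p r)"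
abbreviation "rel_group \<equiv> generate pair_group rel_gens"
abbreviation "phi \<equiv> (tabloid_coords l p :: ((nat \<Rightarrow> nat) \<Rightarrow>\<^sub>0 'k) \<Rightarrow> _)"
abbreviation ractV :: "((nat \<Rightarrow> nat) \<Rightarrow>\<^sub>0 'k) \<Rightarrow> ((nat \<Rightarrow> nat) \<Rightarrow>\<^sub>0 'k) \<Rightarrow> ((nat \<Rightarrow> nat) \<Rightarrow>\<^sub>0 'k)" where
  "ractV \<equiv> bilinear_ext (\<lambda>f \<pi>. mon (f \<circ> \<pi>))"

lemma rel_gens_eq: "rel_gens =
     {frag_of (v + v', w) - frag_of (v, w) - frag_of (v', w) | v v' w. v \<in> specht \<and> v' \<in> specht \<and> w \<in> through_span p r} \<union>
     {frag_of (v, w + w') - frag_of (v, w) - frag_of (v, w') | v w w'. v \<in> specht \<and> w \<in> through_span p r \<and> w' \<in> through_span p r} \<union>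
     {frag_of (ractV v a, w) - frag_of (v, act (to_sym_alg a) w) | v a w. v \<in> specht \<and> a \<in> free_on (app ` Sym p) \<and> w \<in> through_span p r}"
  (is "_ = ?A \<union> ?B \<union> ?C")
proof -
  have "{frag_of (v \<lhd>\<^bsub>specht_module l\<^esub> a, w) - frag_of (v, lact (diagram_bimodule \<delta> p r) a w) | v a w.
        v \<in> carrier (specht_module l) \<and> a \<in> carrier (group_algebra (sym_group p)) \<and> w \<in> carrier (diagram_bimodule \<delta> p r)} = ?C"
    unfolding group_algebra_carrier specht_module_simps diagram_bimodule_simps
    by (intro Collect_cong iff_exI) (auto simp: lact_diagram_bimodule)
  then show ?thesis unfolding tensor_relations_def by simp
qed

lemma frag_in_pair_group: "v \<in> specht \<Longrightarrow> w \<in> through_span p r \<Longrightarrow> frag_of (v, w) \<in> carrier pair_group"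
  by simp

lemma pair_group_diff: "x \<in> carrier pair_group \<Longrightarrow> y \<in> carrier pair_group \<Longrightarrow> x - y \<in> carrier pair_group"
  using keys_diff[of x y] by auto

lemma rel_gens_pair_group: "rel_gens \<subseteq> carrier pair_group"
proof
  fix x assume "x \<in> rel_gens"
  then consider (1) v v' w where "x = frag_of (v + v', w) - frag_of (v, w) - frag_of (v', w)" "v \<in> specht" "v' \<in> specht" "w \<in> through_span p r"
    | (2) v w w' where "x = frag_of (v, w + w') - frag_of (v, w) - frag_of (v, w')" "v \<in> specht" "w \<in> through_span p r" "w' \<in> through_span p r"
    | (3) v a w where "x = frag_of (ractV v a, w) - frag_of (v, act (to_sym_alg a) w)" "v \<in> specht" "a \<in> free_on (app ` Sym p)" "w \<in> through_span p r"
    unfolding rel_gens_eq by blast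
  then show "x \<in> carrier pair_group"
  proof cases
    case 1
    then show ?thesis using scale.span_add[OF 1(2,3)] by (simp only:) (intro pair_group_diff frag_in_pair_group)
  next
    case 2
    then show ?thesis using free_on_add[OF 2(3,4)] by (simp only:) (intro pair_group_diff frag_in_pair_group)
  next
    case 3
    then show ?thesis using specht_ract_closed[OF l 3(2,3)] act_closed[OF to_sym_alg_closed[OF 3(3)] 3(4)]
      by (simp only:) (intro pair_group_diff frag_in_pair_group)
  qed
qed

lemma rel_group_subgroup: "subgroup rel_group pair_group"
  by (rule group.generate_is_subgroup[OF group_free_Abelian_group rel_gens_pair_group])

lemma rel_group_pair_group: "x \<in> rel_group \<Longrightarrow> x \<in> carrier pair_group" using subgroup.subset[OF rel_group_subgroup] by blast
lemma rel_group_zero: "0 \<in> rel_group" using subgroup.one_closed[OF rel_group_subgroup] by simp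
lemma rel_group_add: "x \<in> rel_group \<Longrightarrow> y \<in> rel_group \<Longrightarrow> x + y \<in> rel_group" using subgroup.m_closed[OF rel_group_subgroup] by simp
lemma rel_group_uminus: "x \<in> rel_group \<Longrightarrow> - x \<in> rel_group"
  using subgroup.m_inv_closed[OF rel_group_subgroup, of x] rel_group_pair_group[of x] by simp
lemma rel_group_diff: "x \<in> rel_group \<Longrightarrow> y \<in> rel_group \<Longrightarrow> x - y \<in> rel_group" using rel_group_add[of x "- y"] rel_group_uminus by simp
lemma rel_group_rel: "x \<in> rel_gens \<Longrightarrow> x \<in> rel_group" by (rule generate.incl)

lemma rel_group_induct [consumes 1, case_names zero rel diff]:
  assumes "x \<in> rel_group" "Q 0" "\<And>x. x \<in> rel_gens \<Longrightarrow> Q x" "\<And>x y. Q x \<Longrightarrow> Q y \<Longrightarrow> Q (x - y)"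
  shows "Q x"
proof -
  have neg: "Q (- x)" if "Q x" for x using assms(4)[OF assms(2) that] by simp
  from assms(1) show ?thesis
  proof (induction rule: generate.induct)
    case one
    then show ?case using assms(2) by simp
  next
    case (incl h)
    then show ?case by (rule assms(3))
  next
    case (inv h)
    then have "h \<in> carrier pair_group" using rel_gens_pair_group by blast
    then have "inv\<^bsub>pair_group\<^esub> h = - h" by simp
    then show ?case using neg assms(3)[OF inv] by simp
  next
    case (eng h1 h2)
    then show ?case using assms(4)[OF eng(3) neg[OF eng(4)]] by simp
  qed
qed

abbreviation cls :: "(((nat \<Rightarrow> nat) \<Rightarrow>\<^sub>0 'k) \<times> 'k diagram_comb \<Rightarrow>\<^sub>0 int) \<Rightarrow> _" where
  "cls x \<equiv> rel_group #>\<^bsub>pair_group\<^esub> x"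

lemma cls_eq: "cls x = (\<lambda>n. n + x) ` rel_group" by (auto simp: r_coset_def)

lemma cls_eq_iff: "cls x = cls y \<longleftrightarrow> x - y \<in> rel_group"
proof
  assume "cls x = cls y"
  moreover have "x \<in> cls x" unfolding cls_eq using rel_group_zero by (intro image_eqI[of _ _ 0]) simp_all
  ultimately obtain n where "n \<in> rel_group" "x = n + y" unfolding cls_eq by blast
  then show "x - y \<in> rel_group" by simp
next
  assume d: "x - y \<in> rel_group"
  show "cls x = cls y"
    unfolding cls_eq
  proof
    show "(\<lambda>n. n + x) ` rel_group \<subseteq> (\<lambda>n. n + y) ` rel_group"
    proof (rule image_subsetI)
      fix n assume "n \<in> rel_group"
      then show "n + x \<in> (\<lambda>n. n + y) ` rel_group" using rel_group_add[OF _ d, of n] by (intro image_eqI[of _ _ "n + (x - y)"]) simp_all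
    qed
    show "(\<lambda>n. n + y) ` rel_group \<subseteq> (\<lambda>n. n + x) ` rel_group"
    proof (rule image_subsetI)
      fix n assume "n \<in> rel_group"
      then show "n + y \<in> (\<lambda>n. n + x) ` rel_group" using rel_group_diff[OF _ d, of n] by (intro image_eqI[of _ _ "n - (x - y)"]) simp_all
    qed
  qed
qed

definition contract :: "(((nat \<Rightarrow> nat) \<Rightarrow>\<^sub>0 'k) \<times> 'k diagram_comb \<Rightarrow>\<^sub>0 int) \<Rightarrow> 'k diagram_comb" where
  "contract x = (\<Sum>q\<in>Poly_Mapping.keys x. scale (of_int (coef x q)) (act (phi (fst q)) (snd q)))"

lemma contract_superset:
  assumes "finite S" "Poly_Mapping.keys x \<subseteq> S"
  shows "contract x = (\<Sum>q\<in>S. scale (of_int (coef x q)) (act (phi (fst q)) (snd q)))"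
  unfolding contract_def by (rule sum.mono_neutral_left) (use assms in \<open>auto simp: in_keys_iff\<close>)

lemma contract_diff: "contract (x - y) = contract x - contract y"
proof -
  let ?S = "Poly_Mapping.keys x \<union> Poly_Mapping.keys y"
  have "Poly_Mapping.keys (x - y) \<subseteq> ?S" by (rule keys_diff)
  then show ?thesis
    by (simp add: contract_superset[of ?S] lookup_minus scale.scale_left_diff_distrib sum_subtractf)
qed

lemma contract_zero: "contract 0 = 0" by (simp add: contract_def)

lemma contract_frag_of: "contract (frag_of (v, w)) = act (phi v) w"
  by (simp add: contract_def keys_frag_of)

lemma phi_add: "phi (v + v') = phi v + phi v'"
  by (rule lin_add[OF lin_tabloid_coords[OF l lin_ident]])

lemma contract_rel_group: "x \<in> rel_group \<Longrightarrow> contract x = 0"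
proof (induction rule: rel_group_induct)
  case (rel x)
  then consider (1) v v' w where "x = frag_of (v + v', w) - frag_of (v, w) - frag_of (v', w)"
    | (2) v w w' where "x = frag_of (v, w + w') - frag_of (v, w) - frag_of (v, w')"
    | (3) v a w where "x = frag_of (ractV v a, w) - frag_of (v, act (to_sym_alg a) w)" "v \<in> specht" "a \<in> free_on (app ` Sym p)"
    unfolding rel_gens_eq by blast
  then show ?case
  proof cases
    case 1
    then show ?thesis by (simp add: contract_diff contract_frag_of phi_add bilinear_ext_add_left)
  next
    case 2
    then show ?thesis by (simp add: contract_diff contract_frag_of bilinear_ext_add_right)
  next
    case 3
    then show ?thesis
      by (simp add: contract_diff contract_frag_of tabloid_coords_ract(1)[OF l specht_carrier_tabloid_set[OF l 3(2)] 3(3)] act_mult)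
  qed
qed (simp_all add: contract_zero contract_diff)

lemma phi_sym_alg: "phi v \<in> sym_alg p" by (rule tabloid_coords_sym_alg[OF l])

lemma contract_inflate: "x \<in> carrier pair_group \<Longrightarrow> contract x \<in> inflate l r"
  unfolding contract_def
proof (rule inflate_sum[OF l])
  fix q assume "x \<in> carrier pair_group" "q \<in> Poly_Mapping.keys x"
  then have q: "fst q \<in> specht" "snd q \<in> through_span p r" by auto
  have "act (phi (fst q)) (snd q) \<in> inflate l r"
    using act_closed[OF phi_sym_alg q(2)] specht_coords_idem[OF l q(1)]
    by (simp add: inflate_iff[OF l] act_mult[symmetric])
  then show "scale (of_int (coef x q)) (act (phi (fst q)) (snd q)) \<in> inflate l r"
    by (auto simp: inflate_iff[OF l] lin_scale[OF lin_act_right])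
qed

definition v0 :: "(nat \<Rightarrow> nat) \<Rightarrow>\<^sub>0 'k" where "v0 = (SOME v. v \<in> specht \<and> phi v = idem l)"

lemma v0: "v0 \<in> specht" "phi v0 = idem l"
proof -
  have "\<exists>v. v \<in> specht \<and> phi v = idem l" using specht_coords_surj[OF l sym_alg_one] by auto
  then have "v0 \<in> specht \<and> phi v0 = idem l" unfolding v0_def by (rule someI_ex)
  then show "v0 \<in> specht" "phi v0 = idem l" by auto
qed

text \<open>The vector \<open>v0\<close> generates the Specht module: in coordinates the claim is
  that \<open>idem l\<close> fixes those of \<open>v\<close> from the left.\<close>

lemma v0_ract: "v \<in> specht \<Longrightarrow> ractV v0 (of_sym_alg (phi v)) = v"
  by (rule tabloid_coords_inj[OF l])
    (simp_all add: tabloid_coords_ract[OF l specht_carrier_tabloid_set[OF l v0(1)] of_sym_alg_closed[OF phi_sym_alg]]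
      specht_carrier_tabloid_set[OF l] to_of_sym_alg v0(2) specht_coords_idem[OF l])

lemma frag_add_rel: "w \<in> through_span p r \<Longrightarrow> w' \<in> through_span p r \<Longrightarrow> frag_of (v0, w + w') - frag_of (v0, w) - frag_of (v0, w') \<in> rel_group"
  using v0(1) by (intro rel_group_rel) (unfold rel_gens_eq, blast)

text \<open>Modulo the relations, a pair \<open>(v, w)\<close> may be rewritten with first entry
  \<open>v0\<close>: express \<open>v\<close> as \<open>v0\<close> acted on by \<open>phi v\<close>
  and move this factor to \<open>w\<close>. Additivity in the second entry then merges all terms
  into one.\<close>

lemma frag_normal_form:
  assumes "x \<in> carrier pair_group" shows "x - frag_of (v0, contract x) \<in> rel_group"
proof -
  have "Poly_Mapping.keys x \<subseteq> specht \<times> through_span p r" using assms by simp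
  then have "Poly_Mapping.keys x \<subseteq> specht \<times> through_span p r \<and> x - frag_of (v0, contract x) \<in> rel_group"
  proof (induction rule: frag_induction)
    case zero
    \<comment> \<open>Additivity at \<open>0 + 0\<close> reduces to minus the pair
      \<open>(v0, 0)\<close>, which is the difference to be shown.\<close>
    have "frag_of (v0, 0 + 0) - frag_of (v0, 0) - frag_of (v0, 0) \<in> rel_group" by (rule frag_add_rel) simp_all
    then show ?case by (simp add: contract_zero)
  next
    case (one x)
    obtain v w where x: "x = (v, w)" "v \<in> specht" "w \<in> through_span p r" using one by blast
    have "frag_of (ractV v0 (of_sym_alg (phi v)), w) - frag_of (v0, act (to_sym_alg (of_sym_alg (phi v))) w) \<in> rel_group"
      using v0(1) of_sym_alg_closed[OF phi_sym_alg, of v] x(3) by (intro rel_group_rel) (unfold rel_gens_eq, blast)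
    then show ?case using x by (simp add: contract_frag_of v0_ract to_of_sym_alg)
  next
    case (diff a b)
    have T: "contract (a - b) \<in> through_span p r" "contract b \<in> through_span p r"
      using contract_inflate[of "a - b"] contract_inflate[of b] pair_group_diff[of a b] diff by (simp_all add: inflate_iff[OF l])
    have "frag_of (v0, contract (a - b) + contract b) - frag_of (v0, contract (a - b)) - frag_of (v0, contract b) \<in> rel_group"
      by (rule frag_add_rel[OF T])
    then have "(a - frag_of (v0, contract a)) - (b - frag_of (v0, contract b)) + (frag_of (v0, contract (a - b) + contract b) - frag_of (v0, contract (a - b)) - frag_of (v0, contract b)) \<in> rel_group"
      using rel_group_diff[of "a - frag_of (v0, contract a)" "b - frag_of (v0, contract b)"] diff by (intro rel_group_add) auto
    moreover have "contract (a - b) + contract b = contract a" by (simp add: contract_diff)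
    ultimately have "(a - b) - frag_of (v0, contract (a - b)) \<in> rel_group" by (simp add: algebra_simps)
    then show ?case using diff pair_group_diff[of a b] by simp
  qed
  then show ?thesis by blast
qed

definition rext :: "'k diagram_comb \<Rightarrow> (((nat \<Rightarrow> nat) \<Rightarrow>\<^sub>0 'k) \<times> 'k diagram_comb \<Rightarrow>\<^sub>0 int) \<Rightarrow> _" where
  "rext a = frag_extend (\<lambda>(v, w). frag_of (v, rmul \<delta> p w a))"

lemma rext_rel_group:
  assumes a: "a \<in> diagram_span r r" and x: "x \<in> rel_group" shows "rext a x \<in> rel_group"
  using x
proof (induction rule: rel_group_induct)
  case zero
  show ?case using rel_group_zero by (simp add: rext_def)
next
  case (diff x y)
  then show ?case by (simp add: rext_def frag_extend_diff rel_group_diff)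
next
  case (rel x)
  then consider (1) v v' w where "x = frag_of (v + v', w) - frag_of (v, w) - frag_of (v', w)" "v \<in> specht" "v' \<in> specht" "w \<in> through_span p r"
    | (2) v w w' where "x = frag_of (v, w + w') - frag_of (v, w) - frag_of (v, w')" "v \<in> specht" "w \<in> through_span p r" "w' \<in> through_span p r"
    | (3) v b w where "x = frag_of (ractV v b, w) - frag_of (v, act (to_sym_alg b) w)" "v \<in> specht" "b \<in> free_on (app ` Sym p)" "w \<in> through_span p r"
    unfolding rel_gens_eq by blast
  then show ?case
  proof cases
    case 1
    have "rext a x = frag_of (v + v', rmul \<delta> p w a) - frag_of (v, rmul \<delta> p w a) - frag_of (v', rmul \<delta> p w a)"
      by (simp add: 1(1) rext_def frag_extend_diff)
    then show ?thesis using 1(2,3) rmul_closed[OF 1(4) a, of \<delta>] by (intro rel_group_rel) (unfold rel_gens_eq, blast)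
  next
    case 2
    have "rext a x = frag_of (v, rmul \<delta> p w a + rmul \<delta> p w' a) - frag_of (v, rmul \<delta> p w a) - frag_of (v, rmul \<delta> p w' a)"
      by (simp add: 2(1) rext_def frag_extend_diff bilinear_ext_add_left)
    then show ?thesis using 2(2) rmul_closed[OF 2(3) a, of \<delta>] rmul_closed[OF 2(4) a, of \<delta>] by (intro rel_group_rel) (unfold rel_gens_eq, blast)
  next
    case 3
    have "rext a x = frag_of (ractV v b, rmul \<delta> p w a) - frag_of (v, act (to_sym_alg b) (rmul \<delta> p w a))"
      by (simp add: 3(1) rext_def frag_extend_diff act_rmul[OF to_sym_alg_closed[OF 3(3)] 3(4) a])
    then show ?thesis using 3(2,3) rmul_closed[OF 3(4) a, of \<delta>] by (intro rel_group_rel) (unfold rel_gens_eq, blast)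
  qed
qed

text \<open>The action on the tensor product is a union over all representatives of a coset; since
  the extended action preserves the relations, every representative gives the same coset.\<close>

lemma rext_cls:
  assumes a: "a \<in> diagram_span r r"
  shows "(\<Union>x\<in>cls u. cls (rext a x)) = cls (rext a u)"
proof -
  have "cls (rext a x) = cls (rext a u)" if x: "x \<in> cls u" for x
  proof -
    obtain n where n: "n \<in> rel_group" "x = n + u" using x unfolding cls_eq by blast
    have "rext a x - rext a u = rext a n" by (simp add: n(2) rext_def frag_extend_add)
    then show ?thesis using rext_rel_group[OF a n(1)] by (simp add: cls_eq_iff)
  qed
  moreover have "cls u \<noteq> {}" unfolding cls_eq using rel_group_zero by blast
  ultimately show ?thesis by blast
qed

lemma U_simps:
  "carrier (U \<delta> r l) = carrier (pair_group Mod rel_group)" "add (U \<delta> r l) = mult (pair_group Mod rel_group)"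
  "ract (U \<delta> r l) = (\<lambda>X a. \<Union>x\<in>X. cls (rext a x))"
  by (simp_all add: U_def inflation_def tensor_module_def Let_def partitions_sum_list[OF l] rext_def)

lemma inflation_iso:
  "\<exists>\<Psi>. bij_betw \<Psi> (inflate l r) (carrier (U \<delta> r l)) \<and>
     (\<forall>z\<in>inflate l r. \<forall>z'\<in>inflate l r. \<Psi> (z + z') = \<Psi> z \<oplus>\<^bsub>U \<delta> r l\<^esub> \<Psi> z') \<and>
     (\<forall>z\<in>inflate l r. \<forall>a\<in>diagram_span r r. \<Psi> (rmul \<delta> p z a) = \<Psi> z \<lhd>\<^bsub>U \<delta> r l\<^esub> a)"
proof (intro exI conjI ballI)
  let ?\<Psi> = "\<lambda>z. cls (frag_of (v0, z))"
  interpret F: comm_group pair_group by (rule abelian_free_Abelian_group)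
  have norm: "rel_group \<lhd> pair_group" by (rule F.subgroup_imp_normal[OF rel_group_subgroup])
  have inflate: "z \<in> through_span p r" "act (idem l) z = z" if "z \<in> inflate l r" for z :: "'k diagram_comb"
    using that by (simp_all add: inflate_iff[OF l])
  have fz: "frag_of (v0, z) \<in> carrier pair_group" if "z \<in> inflate l r" for z
    using v0(1) inflate(1)[OF that] by simp
  show "bij_betw ?\<Psi> (inflate l r) (carrier (U \<delta> r l))"
    unfolding bij_betw_def
  proof
    show "inj_on ?\<Psi> (inflate l r)"
    proof (rule inj_onI)
      fix z z' assume z: "z \<in> inflate l r" "z' \<in> inflate l r" and eq: "?\<Psi> z = ?\<Psi> z'"
      have "contract (frag_of (v0, z) - frag_of (v0, z')) = 0"
        by (rule contract_rel_group) (use eq in \<open>simp add: cls_eq_iff\<close>)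
      then show "z = z'" using inflate(2)[OF z(1)] inflate(2)[OF z(2)] by (simp add: contract_diff contract_frag_of v0(2))
    qed
    show "?\<Psi> ` inflate l r = carrier (U \<delta> r l)"
      unfolding U_simps FactGroup_def RCOSETS_def
    proof
      show "?\<Psi> ` inflate l r \<subseteq> carrier \<lparr>carrier = \<Union>a\<in>carrier pair_group. {cls a}, monoid.mult = set_mult pair_group, one = rel_group\<rparr>"
      proof (rule image_subsetI)
        fix z :: "'k diagram_comb" assume "z \<in> inflate l r"
        then have "?\<Psi> z \<in> (\<Union>a\<in>carrier pair_group. {cls a})" using fz by blast
        then show "?\<Psi> z \<in> carrier \<lparr>carrier = \<Union>a\<in>carrier pair_group. {cls a}, monoid.mult = set_mult pair_group, one = rel_group\<rparr>"
          by (simp only: partial_object.select_convs)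
      qed
      show "carrier \<lparr>carrier = \<Union>a\<in>carrier pair_group. {cls a}, monoid.mult = set_mult pair_group, one = rel_group\<rparr> \<subseteq> ?\<Psi> ` inflate l r"
      proof
        fix X assume "X \<in> carrier \<lparr>carrier = \<Union>a\<in>carrier pair_group. {cls a}, monoid.mult = set_mult pair_group, one = rel_group\<rparr>"
        then obtain x where x: "x \<in> carrier pair_group" "X = cls x" by auto
        have "X = ?\<Psi> (contract x)" unfolding x(2) cls_eq_iff by (rule frag_normal_form[OF x(1)])
        then show "X \<in> ?\<Psi> ` inflate l r" using contract_inflate[OF x(1)] by blast
      qed
    qed
  qed
  fix z :: "'k diagram_comb" assume z: "z \<in> inflate l r"
  show "?\<Psi> (rmul \<delta> p z a) = ?\<Psi> z \<lhd>\<^bsub>U \<delta> r l\<^esub> a" if a: "a \<in> diagram_span r r" for a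
    unfolding U_simps rext_cls[OF a] by (simp add: rext_def)
  fix z' :: "'k diagram_comb" assume z': "z' \<in> inflate l r"
  have "?\<Psi> z \<oplus>\<^bsub>U \<delta> r l\<^esub> ?\<Psi> z' = ?\<Psi> z <#>\<^bsub>pair_group\<^esub> ?\<Psi> z'" by (simp add: U_simps FactGroup_def)
  also have "\<dots> = cls (frag_of (v0, z) \<otimes>\<^bsub>pair_group\<^esub> frag_of (v0, z'))"
    by (rule normal.rcos_sum[OF norm fz[OF z] fz[OF z']])
  also have "\<dots> = cls (frag_of (v0, z) + frag_of (v0, z'))" by simp
  also have "\<dots> = ?\<Psi> (z + z')"
    unfolding cls_eq_iff
    using rel_group_uminus[OF frag_add_rel[OF inflate(1)[OF z] inflate(1)[OF z']]] by (simp add: algebra_simps)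
  finally show "?\<Psi> (z + z') = ?\<Psi> z \<oplus>\<^bsub>U \<delta> r l\<^esub> ?\<Psi> z'" by simp
qed

end

theorem corollary7p3p2:
  fixes \<delta> :: "'k::field_char_0" and r p :: nat and l :: "nat list"
  assumes "semisimple_ring (brauer_algebra \<delta> r)"
    and "l \<in> partitions p"
  shows "right_module_iso (brauer_algebra \<delta> r)
           (restrict_scalars (brauer_inclusion r) (U \<delta> (r + 1) l))
           (direct_sum_module (add_remove_cell l) (\<lambda>m. U \<delta> r m))"
proof -
  let ?I = "add_remove_cell l"
  let ?P = "\<Pi>\<^sub>E m\<in>?I. inflate m r :: ('k diagram_comb) set"
  note l = assms(2)
  obtain H where H: "bij_betw H ?P (inflate l (Suc r))"
    "\<And>f g. f \<in> ?P \<Longrightarrow> g \<in> ?P \<Longrightarrow> H (\<lambda>m\<in>?I. f m + g m) = H f + H g"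
    "\<And>f a. f \<in> ?P \<Longrightarrow> a \<in> diagram_span r r \<Longrightarrow> H (\<lambda>m\<in>?I. rmul \<delta> (sum_list m) (f m) a) = rmul \<delta> p (H f) (iota r r a)"
    using branching_inflate[OF l assms(1)] by blast
  obtain \<Phi> where \<Phi>: "bij_betw \<Phi> (inflate l (Suc r)) (carrier (U \<delta> (Suc r) l))"
    "\<And>z z'. z \<in> inflate l (Suc r) \<Longrightarrow> z' \<in> inflate l (Suc r) \<Longrightarrow> \<Phi> (z + z') = \<Phi> z \<oplus>\<^bsub>U \<delta> (Suc r) l\<^esub> \<Phi> z'"
    "\<And>z a. z \<in> inflate l (Suc r) \<Longrightarrow> a \<in> diagram_span (Suc r) (Suc r) \<Longrightarrow> \<Phi> (rmul \<delta> p z a) = \<Phi> z \<lhd>\<^bsub>U \<delta> (Suc r) l\<^esub> a"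
    using inflation_iso[OF l, of "Suc r" \<delta>] by blast
  have part: "m \<in> partitions (sum_list m)" if "m \<in> ?I" for m
    using that by (auto simp: add_remove_cell_def partitions_def)
  have fin: "finite ?I" using finite_adds[OF l] finite_rems by (simp add: add_remove_cell_eq)
  have "\<forall>m\<in>?I. \<exists>\<psi>. bij_betw \<psi> (inflate m r) (carrier (U \<delta> r m)) \<and>
     (\<forall>z\<in>inflate m r. \<forall>z'\<in>inflate m r. \<psi> (z + z') = \<psi> z \<oplus>\<^bsub>U \<delta> r m\<^esub> \<psi> z') \<and>
     (\<forall>z\<in>inflate m r. \<forall>a\<in>diagram_span r r. \<psi> (rmul \<delta> (sum_list m) z a) = \<psi> z \<lhd>\<^bsub>U \<delta> r m\<^esub> a)"
    using inflation_iso[OF part] by blast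
  then obtain \<Psi> where \<Psi>: "\<And>m. m \<in> ?I \<Longrightarrow> bij_betw (\<Psi> m) (inflate m r) (carrier (U \<delta> r m))"
    "\<And>m z z'. m \<in> ?I \<Longrightarrow> z \<in> inflate m r \<Longrightarrow> z' \<in> inflate m r \<Longrightarrow> \<Psi> m (z + z') = \<Psi> m z \<oplus>\<^bsub>U \<delta> r m\<^esub> \<Psi> m z'"
    "\<And>m z a. m \<in> ?I \<Longrightarrow> z \<in> inflate m r \<Longrightarrow> a \<in> diagram_span r r \<Longrightarrow> \<Psi> m (rmul \<delta> (sum_list m) z a) = \<Psi> m z \<lhd>\<^bsub>U \<delta> r m\<^esub> a"
    unfolding bchoice_iff by blast
  \<comment> \<open>The families in \<open>?P\<close> parametrize both modules: the direct sum
    through \<open>A\<close>, the restricted module through \<open>H\<close> followed by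
    \<open>\<Phi>\<close>.\<close>
  define A where "A f = (\<lambda>m\<in>?I. \<Psi> m (f m))" for f
  have HM: "H f \<in> inflate l (Suc r)" if "f \<in> ?P" for f using H(1) that by (auto simp: bij_betw_def)
  have fm: "f m \<in> inflate m r" if "f \<in> ?P" "m \<in> ?I" for f m using that by (auto simp: PiE_def Pi_def)
  have "right_module_iso (brauer_algebra \<delta> r)
           (restrict_scalars (brauer_inclusion r) (U \<delta> (Suc r) l))
           (direct_sum_module ?I (\<lambda>m. U \<delta> r m))"
  proof (rule right_module_iso_via[where P = ?P and B = "\<lambda>f. \<Phi> (H f)" and A = A])
    show "bij_betw (\<lambda>f. \<Phi> (H f)) ?P (carrier (restrict_scalars (brauer_inclusion r) (U \<delta> (Suc r) l)))"
      using bij_betw_trans[OF H(1) \<Phi>(1)] by (simp add: restrict_scalars_def comp_def)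
    \<comment> \<open>As there are finitely many summands, the finite support condition holds for
      every family.\<close>
    have "carrier (direct_sum_module ?I (\<lambda>m. U \<delta> r m)) = (\<Pi>\<^sub>E m\<in>?I. carrier (U \<delta> r m))"
      using fin by (simp add: direct_sum_module_def)
    moreover have "bij_betw A ?P (\<Pi>\<^sub>E m\<in>?I. carrier (U \<delta> r m))"
      unfolding bij_betw_def
    proof
      show "inj_on A ?P"
      proof (rule inj_onI)
        fix f g assume f: "f \<in> ?P" and g: "g \<in> ?P" and eq: "A f = A g"
        show "f = g"
        proof (rule PiE_ext[OF f g])
          fix m assume m: "m \<in> ?I"
          have "\<Psi> m (f m) = \<Psi> m (g m)" using fun_cong[OF eq, of m] m by (simp add: A_def)
          then show "f m = g m" using \<Psi>(1)[OF m] fm[OF f m] fm[OF g m] by (metis bij_betw_def inj_onD)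
        qed
      qed
      show "A ` ?P = (\<Pi>\<^sub>E m\<in>?I. carrier (U \<delta> r m))"
      proof
        show "A ` ?P \<subseteq> (\<Pi>\<^sub>E m\<in>?I. carrier (U \<delta> r m))"
          using \<Psi>(1) fm unfolding A_def by (intro image_subsetI restrict_PiE_iff[THEN iffD2] ballI) (meson bij_betwE)
        show "(\<Pi>\<^sub>E m\<in>?I. carrier (U \<delta> r m)) \<subseteq> A ` ?P"
        proof
          fix y assume y: "y \<in> (\<Pi>\<^sub>E m\<in>?I. carrier (U \<delta> r m))"
          define f where "f = (\<lambda>m\<in>?I. inv_into (inflate m r) (\<Psi> m) (y m))"
          have ym: "y m \<in> \<Psi> m ` inflate m r" if "m \<in> ?I" for m
            using y that \<Psi>(1)[OF that] by (auto simp: bij_betw_def PiE_def Pi_def)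
          have "f \<in> ?P" unfolding f_def using inv_into_into[OF ym] by (simp add: restrict_PiE_iff)
          moreover have "A f = y"
          proof
            fix m show "A f m = y m"
            proof (cases "m \<in> ?I")
              case True
              then show ?thesis using f_inv_into_f[OF ym[OF True]] by (simp add: A_def f_def)
            next
              case False
              then show ?thesis using y by (simp add: A_def PiE_def extensional_def)
            qed
          qed
          ultimately show "y \<in> A ` ?P" by blast
        qed
      qed
    qed
    ultimately show "bij_betw A ?P (carrier (direct_sum_module ?I (\<lambda>m. U \<delta> r m)))" by simp
  next
    fix f g assume f: "f \<in> ?P" and g: "g \<in> ?P"
    let ?h = "\<lambda>m\<in>?I. f m + g m"
    have "?h \<in> ?P" by (intro restrict_PiE_iff[THEN iffD2] ballI inflate_add[OF part] fm[OF f] fm[OF g])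
    moreover have "\<Phi> (H ?h) = \<Phi> (H f) \<oplus>\<^bsub>restrict_scalars (brauer_inclusion r) (U \<delta> (Suc r) l)\<^esub> \<Phi> (H g)"
      using H(2)[OF f g] \<Phi>(2)[OF HM[OF f] HM[OF g]] by (simp add: restrict_scalars_def)
    moreover have "A ?h = A f \<oplus>\<^bsub>direct_sum_module ?I (\<lambda>m. U \<delta> r m)\<^esub> A g"
    proof -
      have "A ?h = (\<lambda>m\<in>?I. A f m \<oplus>\<^bsub>U \<delta> r m\<^esub> A g m)"
        using \<Psi>(2) fm[OF f] fm[OF g] unfolding A_def by (intro restrict_ext) simp
      then show ?thesis by (simp add: direct_sum_module_def)
    qed
    ultimately show "\<exists>h\<in>?P. \<Phi> (H h) = \<Phi> (H f) \<oplus>\<^bsub>restrict_scalars (brauer_inclusion r) (U \<delta> (Suc r) l)\<^esub> \<Phi> (H g) \<and>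
        A h = A f \<oplus>\<^bsub>direct_sum_module ?I (\<lambda>m. U \<delta> r m)\<^esub> A g" by blast
  next
    fix f a assume f: "f \<in> ?P" and "a \<in> carrier (brauer_algebra \<delta> r)"
    then have a: "a \<in> diagram_span r r" by simp
    let ?h = "\<lambda>m\<in>?I. rmul \<delta> (sum_list m) (f m) a"
    have "?h \<in> ?P" using inflate_rmul[OF part _ a] fm[OF f] by (simp add: restrict_PiE_iff)
    moreover have "\<Phi> (H ?h) = \<Phi> (H f) \<lhd>\<^bsub>restrict_scalars (brauer_inclusion r) (U \<delta> (Suc r) l)\<^esub> a"
      using H(3)[OF f a] \<Phi>(3)[OF HM[OF f] iota_diagram_span[OF a]] by (simp add: restrict_scalars_def brauer_inclusion_eq_iota)
    moreover have "A ?h = A f \<lhd>\<^bsub>direct_sum_module ?I (\<lambda>m. U \<delta> r m)\<^esub> a"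
    proof -
      have "A ?h = (\<lambda>m\<in>?I. A f m \<lhd>\<^bsub>U \<delta> r m\<^esub> a)"
        using \<Psi>(3)[OF _ fm[OF f] a] unfolding A_def by (intro restrict_ext) simp
      then show ?thesis by (simp add: direct_sum_module_def)
    qed
    ultimately show "\<exists>h\<in>?P. \<Phi> (H h) = \<Phi> (H f) \<lhd>\<^bsub>restrict_scalars (brauer_inclusion r) (U \<delta> (Suc r) l)\<^esub> a \<and>
        A h = A f \<lhd>\<^bsub>direct_sum_module ?I (\<lambda>m. U \<delta> r m)\<^esub> a" by blast
  qed
  then show ?thesis by simp
qed

end
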